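(* The combinatorial versions of the Busemann–Petty problem and Bourgain's slicing problem are false. More precisely, for every dimension $d\ge 3$, every $k\in\{1,\dots,d-1\}$ and every constant $C>0$, there exist $n,m\in\mathbb{N}$ (with $n,m\ge 3$) such that $$f_{k-1}\bigl(G^d(m)\cap u^\perp\bigr)\le f_{k-1}\bigl(\operatorname{bipyr}^{d-3}(S_n)\cap u^\perp\bigr)\quad\text{for every } u\in\mathbb{S}^{d-1},$$ and $$f_k\bigl(G^d(m)\bigr)> C\cdot f_k\bigl(\operatorname{bipyr}^{d-3}(S_n)\bigr).$$
   Context: $f_k(P)$ is the number of $k$-dimensional faces of a polytope $P$; $u^\perp$ is the hyperplane through the origin orthogonal to $u$. Combinatorial Busemann–Petty problem: given $d$-dimensional polytopes $P,Q\subset\mathbb{R}^d$ containing the origin in their interiors and $k\in\{1,\dots,d-1\}$ with $f_{k-1}(Q\cap u^\perp)\le f_{k-1}(P\cap u^\perp)$ for all $u\in\mathbb{S}^{d-1}$, does it follow that $f_k(Q)\le f_k(P)$? Combinatorial Bourgain's slicing problem: is there a universal constant $C>0$ such that $f_k(Q)\le C\cdot f_k(P)$ whenever $P,Q\subset\mathbb{R}^d$ are $d$-dimensional polytopes containing the origin in their interiors and $k\in\{1,\dots,d-1\}$ satisfies $f_{k-1}(Q\cap u^\perp)\le f_{k-1}(P\cap u^\perp)$ for all $u\in\mathbb{S}^{d-1}$? (A weaker variant allows $C$ to depend on $d$.) Globes: for a polytope $P\subset\mathbb{R}^d$ with the origin in its interior and $n\ge 2$, $$\operatorname{globe}(n,P)=\operatorname{conv}\Bigl(\bigcup_{k=-n+1}^{n-1}\sqrt{1-(k/n)^2}\,P\times\{k/n\}\Bigr)\subset\mathbb{R}^{d+1}.$$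 For $m\ge 3$, $G^2(m)\subset\mathbb{R}^2$ is the regular $m$-gon with vertices on the unit circle, and $G^{d}(m)=\operatorname{globe}(m,G^{d-1}(m))\subset\mathbb{R}^d$ for $d\ge 3$ (i.e. $d-2$ iterated $m$-globes over the regular $m$-gon). Shell polytopes: for $n\ge 3$ and $1\le i\le n-1$ let $\theta_i=-\frac{\pi}{4}+(i-1)\frac{\pi}{2(n-2)}$, $v_i=(\sin\theta_i,0,\cos\theta_i)$, $w_i=(0,\sin\theta_i,-\cos\theta_i)$, and $S_n=\operatorname{conv}(v_1,\dots,v_{n-1},w_1,\dots,w_{n-1})\subset\mathbb{R}^3$. Bipyramids: for $P\subset\mathbb{R}^d$ containing the origin in its interior, $\operatorname{bipyr}(P)=\operatorname{conv}(P\times\{0\},e_{d+1},-e_{d+1})\subset\mathbb{R}^{d+1}$, and $\operatorname{bipyr}^{r}$ denotes its $r$-fold iteration. *)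

theory Defs
  imports "HOL-Analysis.Analysis"
begin

definition f_num :: "nat \<Rightarrow> 'a::euclidean_space set \<Rightarrow> nat" where
  "f_num k P = card {F. F face_of P \<and> aff_dim F = int k}"

definition central_section :: "'a::euclidean_space set \<Rightarrow> 'a \<Rightarrow> 'a set" where
  "central_section P u = P \<inter> {x. u \<bullet> x = 0}"

definition full_polytope :: "'a::euclidean_space set \<Rightarrow> bool" where
  "full_polytope P \<longleftrightarrow> polytope P \<and> aff_dim P = int DIM('a) \<and> 0 \<in> interior P"

text \<open>The two problems in a fixed dimension \<open>d = DIM('a)\<close>. In the slicing problem the constant is
  a parameter: the dimension-free version asks for one \<open>C\<close> that works for all \<open>d\<close>, the weaker
  version for some \<open>C\<close> for each \<open>d\<close>. Refuting the weaker version in one dimension refutes both.\<close>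

definition comb_busemann_petty :: "'a::euclidean_space itself \<Rightarrow> bool" where
  "comb_busemann_petty _ \<longleftrightarrow>
     (\<forall>(P::'a set) Q. \<forall>k\<in>{1..DIM('a) - 1}.
        full_polytope P \<and> full_polytope Q \<and>
        (\<forall>u\<in>sphere 0 1. f_num (k - 1) (central_section Q u) \<le> f_num (k - 1) (central_section P u))
        \<longrightarrow> f_num k Q \<le> f_num k P)"

definition comb_slicing :: "'a::euclidean_space itself \<Rightarrow> real \<Rightarrow> bool" where
  "comb_slicing _ C \<longleftrightarrow>
     (\<forall>(P::'a set) Q. \<forall>k\<in>{1..DIM('a) - 1}.
        full_polytope P \<and> full_polytope Q \<and>
        (\<forall>u\<in>sphere 0 1. f_num (k - 1) (central_section Q u) \<le> f_num (k - 1) (central_section P u))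
        \<longrightarrow> real (f_num k Q) \<le> C * real (f_num k P))"

text \<open>Constructions that raise the dimension are carried out inside one ambient space \<open>'a\<close>: given
  an enumeration \<open>e 0, e 1, \<dots>\<close> of its standard basis, \<open>\<real>\<^sup>j\<close> is the coordinate subspace
  \<open>span (e ` {..<j})\<close>, and \<open>\<real>\<^sup>j \<times> \<real>\<close> is obtained by adjoining the direction \<open>e j\<close>.
  Thus the \<open>i\<close>-th standard basis vector (counted from 1) is \<open>e (i - 1)\<close>, and the argument \<open>v\<close> of
  \<open>globe\<close> and \<open>bipyr\<close> is the basis vector of the new coordinate.\<close>

definition globe :: "'a::euclidean_space \<Rightarrow> nat \<Rightarrow> 'a set \<Rightarrow> 'a set" where
  "globe v n P = convex hull
     (\<Union>k\<in>{- int n + 1..int n - 1}.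
        (\<lambda>x. sqrt (1 - (real_of_int k / real n)\<^sup>2) *\<^sub>R x + (real_of_int k / real n) *\<^sub>R v) ` P)"

text \<open>The rotation of the regular polygon is normalised so that \<open>(1, 0)\<close> is a vertex.\<close>

definition regular_polygon :: "(nat \<Rightarrow> 'a::euclidean_space) \<Rightarrow> nat \<Rightarrow> 'a set" where
  "regular_polygon e m = convex hull
     ((\<lambda>i. cos (2 * pi * real i / real m) *\<^sub>R e 0 + sin (2 * pi * real i / real m) *\<^sub>R e 1) ` {..<m})"

primrec iter_globe :: "(nat \<Rightarrow> 'a::euclidean_space) \<Rightarrow> nat \<Rightarrow> nat \<Rightarrow> 'a set" where
  "iter_globe e m 0 = regular_polygon e m"
| "iter_globe e m (Suc r) = globe (e (r + 2)) m (iter_globe e m r)"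

text \<open>\<open>G e d m\<close> is meant for \<open>d \<ge> 2\<close>.\<close>

definition G :: "(nat \<Rightarrow> 'a::euclidean_space) \<Rightarrow> nat \<Rightarrow> nat \<Rightarrow> 'a set" where
  "G e d m = iter_globe e m (d - 2)"

definition shell_angle :: "nat \<Rightarrow> nat \<Rightarrow> real" where
  "shell_angle n i = - (pi / 4) + (real i - 1) * (pi / (2 * (real n - 2)))"

definition shell_polytope :: "(nat \<Rightarrow> 'a::euclidean_space) \<Rightarrow> nat \<Rightarrow> 'a set" where
  "shell_polytope e n = convex hull
     ((\<lambda>i. sin (shell_angle n i) *\<^sub>R e 0 + cos (shell_angle n i) *\<^sub>R e 2) ` {1..n - 1} \<union>
      (\<lambda>i. sin (shell_angle n i) *\<^sub>R e 1 - cos (shell_angle n i) *\<^sub>R e 2) ` {1..n - 1})"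

definition bipyr :: "'a::euclidean_space \<Rightarrow> 'a set \<Rightarrow> 'a set" where
  "bipyr v P = convex hull (P \<union> {v, - v})"

text \<open>The \<open>r\<close>-fold bipyramid over a set \<open>P\<close> in \<open>span (e ` {..<j})\<close>.\<close>

primrec iter_bipyr :: "(nat \<Rightarrow> 'a::euclidean_space) \<Rightarrow> nat \<Rightarrow> nat \<Rightarrow> 'a set \<Rightarrow> 'a set" where
  "iter_bipyr e j 0 P = P"
| "iter_bipyr e j (Suc r) P = bipyr (e (j + r)) (iter_bipyr e j r P)"

end

theory Submission
  imports Defs
begin

text \<open>A linear functional restricted to a circular arc shorter than a half circle attains a positive
  maximum at one point or at two neighbouring points of any finite subset of the arc. Hence the proper
  faces of a globe over \<open>P\<close> are the copies of faces of \<open>P\<close> on one level and the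
  hulls of two such copies on neighbouring levels. So \<open>G\<^sup>d(m)\<close> has at least
  \<open>m\<^sup>d\<^sup>-\<^sup>1 / 2\<close> faces of every dimension below \<open>d\<close>. The faces of
  a section by a hyperplane correspond to the faces whose relative interior meets the hyperplane; since
  a sinusoid takes a given value at most twice on such an arc, each face of \<open>P\<close> contributes
  boundedly many frusta that are crossed between two levels, and by induction only
  \<open>O(m\<^sup>d\<^sup>-\<^sup>2)\<close> faces of \<open>G\<^sup>d(m)\<close> are met.

  The shell polytope has \<open>O(n)\<close> faces, because interior points of its two arcs never share a
  proper face, but every central plane crosses linearly many of the edges that join a point of one arc
  to an end point of the other. Bipyramids preserve both properties: a section that contains the apices is
  a bipyramid over a section, and any other section has at least as many \<open>i\<close>-faces as the base.
  Taking \<open>n\<close> of order \<open>m\<^sup>d\<^sup>-\<^sup>2\<close> makes the sections comparable, while the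
  face numbers differ by a factor of order \<open>m\<close>.\<close>

section \<open>Faces, sections and face numbers\<close>

text \<open>Two obstacles shape the induction over the dimension. A central hyperplane meets the
  copy of the base on a given level in a rescaled cut of the base by an affine hyperplane that
  depends on the level, so the upper bound on crossed faces has to be proved for every value
  \<open>c\<close> in \<open>u \<bullet> x = c\<close>. And if \<open>u\<close> vanishes on the
  base, the hyperplane can contain a whole layer; but then it meets at most one layer, which costs
  one more copy of the face number of the base, of the same order as the rest.

  No face lattice is computed exactly. A proper face of a polytope around the origin is the set of
  maximizers of a functional with positive maximum, and positivity is what keeps a sinusoid from
  peaking at two nodes with another node between them. One pair of polytopes serves all
  \<open>k\<close>: on the globe side all crossed faces are counted regardless of dimension, on the
  bipyramid side every single face number of every section is bounded below. Constants are chosen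
  for short arithmetic; only the exponents of \<open>m\<close> matter.\<close>

lemma rel_interior_minimizer:
  fixes S :: "'a::euclidean_space set"
  assumes "convex S" "y \<in> rel_interior S" "\<And>x. x \<in> S \<Longrightarrow> a \<bullet> y \<le> a \<bullet> x" "x \<in> S"
  shows "a \<bullet> x = a \<bullet> y"
proof -
  have "S \<inter> {x. a \<bullet> x = a \<bullet> y} face_of S"
    by (rule face_of_Int_supporting_hyperplane_ge) (use assms in auto)
  moreover have "y \<in> S \<inter> {x. a \<bullet> x = a \<bullet> y}"
    using assms(2) rel_interior_subset by auto
  ultimately have "S \<inter> {x. a \<bullet> x = a \<bullet> y} = S"
    using face_of_disjoint_rel_interior assms(2) by blast
  with assms(4) show ?thesis by blast
qed

text \<open>A point of the relative boundary has a supporting functional that is strictly larger on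
  the relative interior. The lemma is a test for relative interior points by functionals alone,
  which suits sets given as convex hulls.\<close>

lemma rel_interiorI_minimizers:
  fixes S :: "'a::euclidean_space set"
  assumes "convex S" "y \<in> S"
    and "\<And>a x. (\<And>x. x \<in> S \<Longrightarrow> a \<bullet> y \<le> a \<bullet> x) \<Longrightarrow> x \<in> S \<Longrightarrow> a \<bullet> x = a \<bullet> y"
  shows "y \<in> rel_interior S"
proof (rule ccontr)
  assume "y \<notin> rel_interior S"
  then obtain a where a: "\<And>x. x \<in> S \<Longrightarrow> a \<bullet> y \<le> a \<bullet> x"
      "\<And>x. x \<in> rel_interior S \<Longrightarrow> a \<bullet> y < a \<bullet> x"
    using supporting_hyperplane_rel_boundary[OF assms(1,2)] by metis
  obtain z where z: "z \<in> rel_interior S"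
    using rel_interior_eq_empty assms(1,2) by blast
  then have "z \<in> S" using rel_interior_subset by blast
  then show False using a(2)[OF z] assms(3)[OF a(1)] by force
qed

text \<open>This is how faces are told apart and counted later: a face is known as soon as the
  generators in it are known.\<close>

lemma face_of_convex_hull_eq:
  fixes S :: "'a::euclidean_space set"
  assumes "compact S" "F face_of convex hull S"
  shows "F = convex hull (F \<inter> S)"
proof
  obtain S' where S': "S' \<subseteq> S" "F = convex hull S'"
    using face_of_convex_hull_subset[OF assms] .
  then have "S' \<subseteq> F \<inter> S" using hull_subset[of S' convex] by auto
  then show "F \<subseteq> convex hull (F \<inter> S)" using S'(2) hull_mono[of S' "F \<inter> S" convex] by simp
  show "convex hull (F \<inter> S) \<subseteq> F"
    by (rule hull_minimal) (use assms face_of_imp_convex in auto)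
qed

lemma convex_hull_le_hyperplane:
  assumes "\<And>x. x \<in> S \<Longrightarrow> w \<bullet> x \<le> b" "x \<in> convex hull S"
  shows "w \<bullet> x \<le> b"
proof -
  have "convex hull S \<subseteq> {x. w \<bullet> x \<le> b}"
    by (rule hull_minimal) (use assms convex_halfspace_le in auto)
  with assms(2) show ?thesis by blast
qed

lemma convex_hull_Int_supporting_hyperplane:
  fixes S :: "'a::euclidean_space set"
  assumes "compact S" "\<And>x. x \<in> S \<Longrightarrow> w \<bullet> x \<le> b"
  shows "convex hull S \<inter> {x. w \<bullet> x = b} = convex hull {x \<in> S. w \<bullet> x = b}"
proof -
  have *: "(convex hull S \<inter> {x. w \<bullet> x = b}) face_of convex hull S"
    by (rule face_of_Int_supporting_hyperplane_le) (use convex_hull_le_hyperplane[OF assms(2)] in auto)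
  have "convex hull S \<inter> {x. w \<bullet> x = b} = convex hull (convex hull S \<inter> {x. w \<bullet> x = b} \<inter> S)"
    by (rule face_of_convex_hull_eq[OF assms(1) *])
  also have "convex hull S \<inter> {x. w \<bullet> x = b} \<inter> S = {x \<in> S. w \<bullet> x = b}"
    by (auto intro: hull_inc)
  finally show ?thesis .
qed

lemma exposed_face_of_convex_hull:
  fixes S :: "'a::euclidean_space set"
  assumes "compact S" "\<And>x. x \<in> S \<Longrightarrow> w \<bullet> x \<le> b"
  shows "convex hull {x \<in> S. w \<bullet> x = b} face_of convex hull S"
proof -
  have "convex hull S \<inter> {x. w \<bullet> x = b} face_of convex hull S"
    by (rule face_of_Int_supporting_hyperplane_le) (use convex_hull_le_hyperplane[OF assms(2)] in auto)
  then show ?thesis using convex_hull_Int_supporting_hyperplane[OF assms] by simp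
qed

text \<open>The maximum cannot be 0, for then the face would contain the origin, a relative interior
  point, and be all of \<open>P\<close>. The strict inequality \<open>b > 0\<close> is the form in
  which the arc lemmas use this.\<close>

lemma proper_face_exposed:
  fixes P :: "'a::euclidean_space set"
  assumes "polytope P" "0 \<in> rel_interior P" "F face_of P" "F \<noteq> P" "F \<noteq> {}"
  obtains a b where "b > 0" "\<And>x. x \<in> P \<Longrightarrow> a \<bullet> x \<le> b" "F = {x \<in> P. a \<bullet> x = b}"
proof -
  have "F exposed_face_of P"
    using assms exposed_face_of_polyhedron polytope_imp_polyhedron by blast
  then obtain a b where ab: "P \<subseteq> {x. a \<bullet> x \<le> b}" "F = P \<inter> {x. a \<bullet> x = b}"
    unfolding exposed_face_of_def by blast
  have 0: "0 \<in> P" using assms(2) rel_interior_subset by blast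
  then have "b \<ge> 0" using ab(1) by force
  moreover have "b \<noteq> 0"
  proof
    assume "b = 0"
    then have "0 \<in> F" using 0 ab by auto
    then show False using face_of_disjoint_rel_interior assms by blast
  qed
  ultimately show thesis using ab by (intro that[of b a]) auto
qed

text \<open>Meeting the relative interior makes the passage to faces of the section one to one: a
  face that touches \<open>H\<close> only in its relative boundary has the same intersection with
  \<open>H\<close> as one of its proper faces.\<close>

definition hit_faces :: "'a::euclidean_space set \<Rightarrow> 'a set \<Rightarrow> 'a set set" where
  "hit_faces P H = {F. F face_of P \<and> rel_interior F \<inter> H \<noteq> {}}"

lemma finite_hit_faces: "polytope P \<Longrightarrow> finite (hit_faces P H)"
  unfolding hit_faces_def by (rule finite_subset[OF _ finite_polytope_faces]) auto

text \<open>Take a minimal face containing \<open>p\<close>: a functional minimized at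
  \<open>p\<close> cuts out a smaller face through \<open>p\<close>, so it must be constant.\<close>

lemma polytope_point_in_rel_interior_face:
  fixes P :: "'a::euclidean_space set"
  assumes "polytope P" "p \<in> P"
  obtains F where "F face_of P" "p \<in> rel_interior F"
proof -
  let ?A = "{F. F face_of P \<and> p \<in> F}"
  have "finite ?A" by (rule finite_subset[OF _ finite_polytope_faces[OF assms(1)]]) auto
  moreover have "P \<in> ?A" using assms polytope_imp_convex face_of_refl by auto
  ultimately obtain F where F: "F face_of P" "p \<in> F" and
    min: "\<And>G. G face_of P \<Longrightarrow> p \<in> G \<Longrightarrow> G \<subseteq> F \<Longrightarrow> F = G"
    using finite_has_minimal[of ?A] by blast
  have "p \<in> rel_interior F"
  proof (rule rel_interiorI_minimizers)
    show cF: "convex F" using F(1) face_of_imp_convex by blast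
    fix a x assume a: "\<And>x. x \<in> F \<Longrightarrow> a \<bullet> p \<le> a \<bullet> x" "x \<in> F"
    have "F \<inter> {x. a \<bullet> x = a \<bullet> p} face_of F"
      by (rule face_of_Int_supporting_hyperplane_ge) (use a cF in auto)
    then have "F \<inter> {x. a \<bullet> x = a \<bullet> p} face_of P" using F(1) face_of_trans by blast
    then have "F = F \<inter> {x. a \<bullet> x = a \<bullet> p}" using min F(2) by blast
    then show "a \<bullet> x = a \<bullet> p" using a(2) by blast
  qed (rule F(2))
  then show thesis using F that by blast
qed

text \<open>For a crossed face, intersecting with \<open>H\<close> commutes with taking the relative
  interior. Injectivity then follows because faces sharing a relative interior point are equal; for
  surjectivity, a relative interior point of a face of the section lies in the relative interior of
  some face of \<open>P\<close>.\<close>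

lemma bij_betw_hit_faces:
  fixes P :: "'a::euclidean_space set"
  assumes "polytope P" "affine H"
  shows "bij_betw (\<lambda>F. F \<inter> H) (hit_faces P H) {E. E face_of (P \<inter> H) \<and> E \<noteq> {}}"
proof -
  have ri: "rel_interior (F \<inter> H) = rel_interior F \<inter> H" if "F \<in> hit_faces P H" for F
    using that assms(2) unfolding hit_faces_def
    by (intro convex_affine_rel_interior_Int) (auto dest: face_of_imp_convex)
  have inj: "F = G" if FG: "F \<in> hit_faces P H" "G \<in> hit_faces P H" "F \<inter> H = G \<inter> H" for F G
  proof -
    have "rel_interior F \<inter> H = rel_interior G \<inter> H" using ri FG by metis
    then have "rel_interior F \<inter> rel_interior G \<noteq> {}" using FG(1) unfolding hit_faces_def by blast
    then show "F = G" using FG face_of_eq unfolding hit_faces_def by blast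
  qed
  have into: "F \<inter> H face_of P \<inter> H \<and> F \<inter> H \<noteq> {}" if "F \<in> hit_faces P H" for F
  proof -
    have F: "F face_of P" "rel_interior F \<inter> H \<noteq> {}" using that unfolding hit_faces_def by auto
    have "F \<inter> H face_of P \<inter> H" by (rule face_of_slice[OF F(1) affine_imp_convex[OF assms(2)]])
    moreover have "F \<inter> H \<noteq> {}" using F(2) rel_interior_subset[of F] by blast
    ultimately show ?thesis by blast
  qed
  have onto: "\<exists>F\<in>hit_faces P H. E = F \<inter> H" if E: "E face_of P \<inter> H" "E \<noteq> {}" for E
  proof -
    obtain p where p: "p \<in> rel_interior E"
      using rel_interior_eq_empty[OF face_of_imp_convex[OF E(1)]] E(2) by blast
    then have pH: "p \<in> P" "p \<in> H"
      using rel_interior_subset[of E] face_of_imp_subset[OF E(1)] by auto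
    obtain F where F: "F face_of P" "p \<in> rel_interior F"
      using polytope_point_in_rel_interior_face[OF assms(1) pH(1)] .
    have hit: "F \<in> hit_faces P H" using F pH unfolding hit_faces_def by blast
    have "p \<in> rel_interior (F \<inter> H)" using ri[OF hit] F pH by blast
    then have "E = F \<inter> H" using face_of_eq[OF E(1)] into[OF hit] p by blast
    then show ?thesis using hit by blast
  qed
  show ?thesis
    unfolding bij_betw_def inj_on_def using into onto inj by blast
qed

lemma f_num_Int:
  fixes P :: "'a::euclidean_space set"
  assumes "polytope P" "affine H"
  shows "f_num k (P \<inter> H) = card {F \<in> hit_faces P H. aff_dim (F \<inter> H) = int k}"
proof -
  have inj: "inj_on (\<lambda>F. F \<inter> H) (hit_faces P H)"
    and img: "(\<lambda>F. F \<inter> H) ` hit_faces P H = {E. E face_of (P \<inter> H) \<and> E \<noteq> {}}"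
    using bij_betw_hit_faces[OF assms] by (auto simp only: bij_betw_def)
  have "{E. E face_of P \<inter> H \<and> aff_dim E = int k} = {E \<in> {E. E face_of (P \<inter> H) \<and> E \<noteq> {}}. aff_dim E = int k}"
    by auto
  also have "\<dots> = (\<lambda>F. F \<inter> H) ` {F \<in> hit_faces P H. aff_dim (F \<inter> H) = int k}"
    unfolding img[symmetric] by auto
  also have "card \<dots> = card {F \<in> hit_faces P H. aff_dim (F \<inter> H) = int k}"
    by (rule card_image) (rule inj_on_subset[OF inj], auto)
  finally show ?thesis unfolding f_num_def .
qed

lemma f_num_central_section_eq:
  fixes P :: "'a::euclidean_space set"
  assumes "polytope P"
  shows "f_num k (central_section P u) =
    card {F \<in> hit_faces P {x. u \<bullet> x = 0}. aff_dim (F \<inter> {x. u \<bullet> x = 0}) = int k}"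
  unfolding central_section_def by (rule f_num_Int[OF assms affine_hyperplane])

text \<open>Discarding the dimension of the faces lets one count serve every
  \<open>k\<close>.\<close>

lemma f_num_central_section_le:
  fixes P :: "'a::euclidean_space set"
  assumes "polytope P"
  shows "f_num k (central_section P u) \<le> card (hit_faces P {x. u \<bullet> x = 0})"
  unfolding f_num_central_section_eq[OF assms] using finite_hit_faces[OF assms] by (intro card_mono) auto

lemma f_num_le_card_faces:
  fixes P :: "'a::euclidean_space set"
  assumes "polytope P"
  shows "f_num k P \<le> card {F. F face_of P}"
  unfolding f_num_def using finite_polytope_faces[OF assms] by (intro card_mono) auto

text \<open>Near a relative interior point the set \<open>F\<close> fills its affine hull, so the
  section has the same affine hull as the section of that hull.\<close>

lemma aff_dim_Int_hyperplane:
  fixes F :: "'a::euclidean_space set"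
  assumes "convex F" "rel_interior F \<inter> {x. u \<bullet> x = c} \<noteq> {}" "\<not> F \<subseteq> {x. u \<bullet> x = c}"
  shows "aff_dim (F \<inter> {x. u \<bullet> x = c}) = aff_dim F - 1"
proof -
  let ?H = "{x. u \<bullet> x = c}"
  obtain p where p: "p \<in> rel_interior F" "p \<in> ?H" using assms(2) by blast
  then obtain T where T: "open T" "p \<in> T \<inter> F" "T \<inter> affine hull F \<subseteq> F"
    unfolding mem_rel_interior by blast
  have aff: "affine (affine hull F \<inter> ?H)" by (simp add: affine_Int affine_hyperplane)
  have ne: "affine hull F \<inter> ?H \<inter> T \<noteq> {}" using T(2) p(2) hull_subset[of F affine] by blast
  have eq: "affine hull F \<inter> ?H = affine hull (affine hull F \<inter> ?H \<inter> T)"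
    using affine_hull_affine_Int_open[OF aff T(1) ne] by (metis aff affine_hull_eq)
  have sub: "affine hull (affine hull F \<inter> ?H \<inter> T) \<subseteq> affine hull (F \<inter> ?H)"
    by (rule hull_mono) (use T(3) in blast)
  have "affine hull (F \<inter> ?H) \<subseteq> affine hull F \<inter> ?H"
    using hull_minimal[of "F \<inter> ?H" "affine hull F \<inter> ?H" affine] aff hull_subset[of F affine] by blast
  with eq sub have "affine hull (F \<inter> ?H) = affine hull F \<inter> ?H" by simp
  then have "aff_dim (F \<inter> ?H) = aff_dim (affine hull F \<inter> ?H)" by (metis aff_dim_affine_hull)
  also have "\<dots> = aff_dim (affine hull F) - 1"
    unfolding aff_dim_affine_Int_hyperplane[OF affine_affine_hull]
    using ne assms(3) hull_subset[of F affine] by auto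
  finally show ?thesis by simp
qed

lemma polytope_aff_dim_le_1:
  fixes P :: "'a::euclidean_space set"
  assumes "polytope P" "aff_dim P \<le> 1"
  obtains A where "finite A" "card A \<le> 2" "P = convex hull A"
proof (cases "P = {}")
  case True
  then show ?thesis using that[of "{}"] by simp
next
  case False
  then obtain a b where "P = closed_segment a b"
    using compact_convex_collinear_segment[of P] assms collinear_aff_dim
      polytope_imp_compact polytope_imp_convex by blast
  then show ?thesis using that[of "{a,b}"] by (simp add: segment_convex_hull card_insert_if)
qed

lemma card_faces_convex_hull_le:
  fixes A :: "'a::euclidean_space set"
  assumes "finite A" 
  shows "card {F. F face_of convex hull A} \<le> 2 ^ card A"
proof -
  have "{F. F face_of convex hull A} \<subseteq> (hull) convex ` Pow A"
    using face_of_convex_hull_subset[OF finite_imp_compact[OF assms]] by blast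
  then have "card {F. F face_of convex hull A} \<le> card (Pow A)"
    using assms surj_card_le[of "Pow A"] by blast
  then show ?thesis by (simp add: card_Pow assms)
qed

text \<open>Double counting of incidences: a vertex is a proper face in positive dimension, hence
  lies in some facet. With \<open>c = 2\<close> this is the source of the factor 2 in the lower
  bounds.\<close>

lemma card_facets_ge:
  fixes P :: "'a::euclidean_space set"
  assumes P: "polytope P" "aff_dim P > 0" and V: "finite V" "\<And>x. x \<in> V \<Longrightarrow> x extreme_point_of P"
    and c: "\<And>F. F facet_of P \<Longrightarrow> card (F \<inter> V) \<le> c"
  shows "card V \<le> c * card {F. F facet_of P}"
proof -
  have fin: "finite {F. F facet_of P}" by (rule finite_polytope_facets[OF P(1)])
  have "V \<subseteq> (\<Union>F\<in>{F. F facet_of P}. F \<inter> V)"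
  proof
    fix x assume x: "x \<in> V"
    have "{x} face_of P" using V(2)[OF x] by (simp add: face_of_singleton)
    moreover have "{x} \<noteq> P" using P(2) by auto
    ultimately obtain F where "F facet_of P" "{x} \<subseteq> F"
      using face_of_polyhedron_subset_facet[OF polytope_imp_polyhedron[OF P(1)], of "{x}"] by blast
    then show "x \<in> (\<Union>F\<in>{F. F facet_of P}. F \<inter> V)" using x by blast
  qed
  then have "card V \<le> card (\<Union>F\<in>{F. F facet_of P}. F \<inter> V)"
    using fin V(1) by (intro card_mono) auto
  also have "\<dots> \<le> (\<Sum>F\<in>{F. F facet_of P}. card (F \<inter> V))" by (rule card_UN_le[OF fin])
  also have "\<dots> \<le> (\<Sum>F\<in>{F. F facet_of P}. c)" using c by (intro sum_mono) auto
  finally show ?thesis by (simp add: mult.commute)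
qed

lemma f_num_facets: "aff_dim P = int (Suc k) \<Longrightarrow> f_num k P = card {F. F facet_of P}"
  unfolding f_num_def facet_of_def by (rule arg_cong[where f=card]) auto

lemma f_num_0: "f_num 0 P = card {x. x extreme_point_of P}"
proof -
  have "{F. F face_of P \<and> aff_dim F = int 0} = (\<lambda>x. {x}) ` {x. x extreme_point_of P}"
    by (auto simp: aff_dim_eq_0 face_of_singleton[symmetric])
  then show ?thesis unfolding f_num_def by (simp add: card_image)
qed

lemma f_num_polygon:
  fixes P :: "'a::euclidean_space set"
  assumes "polytope P" "aff_dim P = 2"
  shows "f_num 0 P \<le> 2 * f_num 1 P"
proof -
  have fin: "finite {x. x extreme_point_of P}"
    using assms finite_polyhedron_extreme_points polytope_imp_polyhedron by blast
  have "card {x. x extreme_point_of P} \<le> 2 * card {F. F facet_of P}"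
  proof (rule card_facets_ge[OF assms(1) _ fin])
    fix F assume F: "F facet_of P"
    then have FP: "F face_of P" "aff_dim F \<le> 1" using assms by (auto simp: facet_of_def)
    then obtain A where A: "finite A" "card A \<le> 2" "F = convex hull A"
      using polytope_aff_dim_le_1 face_of_polytope_polytope assms(1) by blast
    have "F \<inter> {x. x extreme_point_of P} \<subseteq> A"
      using extreme_point_of_face[OF FP(1)] extreme_point_of_convex_hull A(3) by blast
    then show "card (F \<inter> {x. x extreme_point_of P}) \<le> 2"
      using card_mono[OF A(1)] A(2) le_trans by blast
  qed (use assms in auto)
  then show ?thesis using f_num_0[of P] f_num_facets[of P 1] assms(2) by simp
qed

section \<open>Linear functionals on circular arcs\<close>

lemma sin_add_less: 
  fixes x y :: real
  assumes "0 < x" "0 < y" "x + y < pi"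
  shows "sin (x + y) < sin x + sin y"
proof -
  have s: "sin x > 0" "sin y > 0" using assms by (auto intro!: sin_gt_zero)
  have "cos x < 1" using cos_monotone_0_pi[of 0 x] assms by simp
  moreover have "cos y < 1" using cos_monotone_0_pi[of 0 y] assms by simp
  ultimately have "sin x * cos y < sin x * 1" "cos x * sin y < 1 * sin y"
    using s by (auto intro!: mult_strict_left_mono mult_strict_right_mono)
  then show ?thesis by (simp add: sin_add)
qed

text \<open>Linear interpolation with lengths replaced by sines. On an arc shorter than
  \<open>pi\<close> the weights of the two ends add up to more than the weight of the middle point,
  so a positive sinusoid behaves as if it were strictly concave.\<close>

lemma sinusoid_three_points:
  fixes p q :: real
  defines "f \<equiv> \<lambda>x. p * cos x + q * sin x"
  shows "sin (c - a) * f b = sin (c - b) * f a + sin (b - a) * f c"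
  unfolding f_def sin_diff by (simp add: algebra_simps)

lemma sinusoid_arc_gt:
  fixes p q :: real
  defines "f \<equiv> \<lambda>x. p * cos x + q * sin x"
  assumes "a < b" "b < c" "c - a < pi" "f a = M" "f c = M" "M > 0"
  shows "f b > M"
proof -
  have pos: "sin (c - a) > 0" using assms by (intro sin_gt_zero) auto
  have "sin (c - a) < sin (c - b) + sin (b - a)"
    using sin_add_less[of "c - b" "b - a"] assms by simp
  then have "sin (c - a) * M < (sin (c - b) + sin (b - a)) * M" using assms by simp
  also have "\<dots> = sin (c - a) * f b"
    using sinusoid_three_points[of c a p b q] assms unfolding f_def by (simp add: algebra_simps)
  finally show ?thesis using pos by simp
qed

text \<open>A node strictly between two maximizers would have a value above \<open>M\<close>, so
  maximizers are neighbours. The order is kept abstract because the nodes are integers for globe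
  levels and natural numbers for shell points.\<close>

lemma sinusoid_argmax_adjacent:
  fixes \<psi> :: "'k::{linorder,discrete_linordered_semidom} \<Rightarrow> real" and p q M :: real
  defines "f \<equiv> \<lambda>k. p * cos (\<psi> k) + q * sin (\<psi> k)"
  assumes mono: "strict_mono_on {l..h} \<psi>" and diam: "\<psi> h - \<psi> l < pi"
    and le: "\<And>k. k \<in> {l..h} \<Longrightarrow> f k \<le> M" and "M > 0"
    and fin: "finite {l..h}"
  defines "T \<equiv> {k \<in> {l..h}. f k = M}"
  assumes "T \<noteq> {}"
  obtains i where "i \<in> {l..h}" "T = {i} \<or> i + 1 \<in> {l..h} \<and> T = {i, i + 1}"
proof -
  have finT: "finite T" unfolding T_def by (rule finite_subset[OF _ fin]) auto
  define i where "i = Min T"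
  have iT: "i \<in> T" using Min_in[OF finT \<open>T \<noteq> {}\<close>] unfolding i_def .
  have le_i: "i \<le> k" if "k \<in> T" for k using Min_le[OF finT that] unfolding i_def .
  have ab: "k = i \<or> k = i + 1" if k: "k \<in> T" for k
  proof (rule ccontr)
    assume "\<not> (k = i \<or> k = i + 1)"
    with le_i[OF k] have "i < k" "k \<noteq> i + 1" by auto
    then have "i < i + 1" "i + 1 < k" using less_iff_succ_less_eq[of i k] by auto
    have ik: "i \<in> {l..h}" "k \<in> {l..h}" using iT k by (auto simp: T_def)
    then have "l \<le> i" "k \<le> h" by auto
    then have "l \<le> i + 1" "i + 1 \<le> h"
      using order_trans[OF _ less_imp_le[OF \<open>i < i + 1\<close>], of l]
        order_trans[OF less_imp_le[OF \<open>i + 1 < k\<close>], of h] by blast+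
    then have j: "i + 1 \<in> {l..h}" by simp
    have "\<psi> i < \<psi> (i + 1)" "\<psi> (i + 1) < \<psi> k"
      using strict_mono_onD[OF mono] ik j \<open>i < i + 1\<close> \<open>i + 1 < k\<close> by auto
    moreover have "\<psi> l \<le> \<psi> i" "\<psi> k \<le> \<psi> h"
      using strict_mono_on_leD[OF mono, of l i] strict_mono_on_leD[OF mono, of k h] ik by auto
    ultimately have "f (i + 1) > M"
      using sinusoid_arc_gt[of "\<psi> i" "\<psi> (i + 1)" "\<psi> k" p q M] iT k diam \<open>M > 0\<close>
      unfolding f_def T_def by auto
    then show False using le[OF j] by simp
  qed
  show thesis
  proof (cases "i + 1 \<in> T")
    case True
    then show ?thesis using that[of i] ab iT by (auto simp: T_def)
  next
    case False
    then have "T = {i}" using ab iT by blast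
    then show ?thesis using that[of i] iT by (auto simp: T_def)
  qed
qed

lemma sign_change_root:
  fixes f :: "real \<Rightarrow> real"
  assumes "a < b" "f a * f b < 0" "continuous_on {a..b} f"
  obtains x where "a < x" "x < b" "f x = 0"
proof -
  have "\<exists>x. a \<le> x \<and> x \<le> b \<and> f x = 0"
  proof (cases "f a < 0")
    case True
    then have "0 < f b" using assms(2) by (simp add: mult_less_0_iff)
    then show ?thesis using IVT'[of f a 0 b] True assms by auto
  next
    case False
    then have "f b < 0" "f a > 0" using assms(2) by (auto simp: mult_less_0_iff)
    then show ?thesis using IVT2'[of f b 0 a] assms by auto
  qed
  then obtain x where x: "a \<le> x" "x \<le> b" "f x = 0" by blast
  moreover have "x \<noteq> a" "x \<noteq> b" using x(3) assms(2) by auto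
  ultimately show thesis using that by force
qed

text \<open>The three-point identity together with the strict sine inequality forces
  \<open>c = 0\<close>; two zeros less than \<open>pi\<close> apart then kill both coefficients by
  Cramer's rule with determinant \<open>sin (y - x)\<close>.\<close>

lemma sinusoid_three_roots:
  fixes \<alpha> \<beta> c :: real
  assumes "x < y" "y < z" "z - x < pi"
    and "\<alpha> * cos x + \<beta> * sin x = c" "\<alpha> * cos y + \<beta> * sin y = c" "\<alpha> * cos z + \<beta> * sin z = c"
  shows "\<alpha> = 0" "\<beta> = 0" "c = 0"
proof -
  have "sin (z - x) * c = sin (z - y) * c + sin (y - x) * c"
    using sinusoid_three_points[of z x \<alpha> y \<beta>] assms by simp
  then have "(sin (z - y) + sin (y - x) - sin (z - x)) * c = 0" by (simp add: algebra_simps)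
  moreover have "sin (z - x) < sin (z - y) + sin (y - x)"
    using sin_add_less[of "z - y" "y - x"] assms by simp
  ultimately show c: "c = 0" by simp
  have s: "sin (y - x) > 0" using assms by (intro sin_gt_zero) auto
  have "sin (y - x) * \<alpha> = sin y * (\<alpha> * cos x + \<beta> * sin x) - sin x * (\<alpha> * cos y + \<beta> * sin y)"
    unfolding sin_diff by (simp add: algebra_simps)
  then show "\<alpha> = 0" using s c assms(4,5) by simp
  have "sin (y - x) * \<beta> = cos x * (\<alpha> * cos y + \<beta> * sin y) - cos y * (\<alpha> * cos x + \<beta> * sin x)"
    unfolding sin_diff by (simp add: algebra_simps)
  then show "\<beta> = 0" using s c assms(4,5) by simp
qed

lemma card_le_2_linorder:
  fixes S :: "'k::linorder set"
  assumes "finite S" "\<And>i j k. i \<in> S \<Longrightarrow> j \<in> S \<Longrightarrow> k \<in> S \<Longrightarrow> i < j \<Longrightarrow> j < k \<Longrightarrow> False"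
  shows "card S \<le> 2"
proof (cases "S = {}")
  case False
  have "S \<subseteq> {Min S, Max S}"
  proof
    fix j assume "j \<in> S"
    then show "j \<in> {Min S, Max S}"
      using assms(2)[of "Min S" j "Max S"] Min_le[OF assms(1)] Max_ge[OF assms(1)]
        Min_in[OF assms(1) False] Max_in[OF assms(1) False] by (metis insertCI order_neq_le_trans)
  qed
  then have "card S \<le> card {Min S, Max S}" by (intro card_mono) auto
  also have "\<dots> \<le> 2" by (simp add: card_insert_if)
  finally show ?thesis .
qed simp

text \<open>Each sign change produces a root strictly between two neighbouring nodes, so three sign
  changes give three distinct roots. Then \<open>g\<close> vanishes identically, against the strict
  inequality.\<close>

lemma card_sinusoid_sign_changes:
  fixes \<psi> :: "int \<Rightarrow> real" and \<alpha> \<beta> c :: real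
  defines "g \<equiv> \<lambda>k. \<alpha> * cos (\<psi> k) + \<beta> * sin (\<psi> k) - c"
  assumes mono: "strict_mono_on {l..h} \<psi>" and diam: "\<psi> h - \<psi> l < pi"
  shows "card {k \<in> {l..h}. k + 1 \<in> {l..h} \<and> g k * g (k + 1) < 0} \<le> 2" (is "card ?S \<le> 2")
proof (rule card_le_2_linorder)
  show "finite ?S" by (rule finite_subset[of _ "{l..h}"]) auto
  fix i j k assume ijk: "i \<in> ?S" "j \<in> ?S" "k \<in> ?S" "i < j" "j < k"
  let ?f = "\<lambda>x. \<alpha> * cos x + \<beta> * sin x - c"
  have root: "\<exists>x. \<psi> i < x \<and> x < \<psi> (i + 1) \<and> ?f x = 0" if "i \<in> ?S" for i
  proof -
    have "\<psi> i < \<psi> (i + 1)" using that strict_mono_onD[OF mono, of i "i + 1"] by auto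
    moreover have "?f (\<psi> i) * ?f (\<psi> (i + 1)) < 0" using that by (auto simp: g_def)
    moreover have "continuous_on {\<psi> i..\<psi> (i + 1)} ?f" by (intro continuous_intros)
    ultimately obtain x where "\<psi> i < x" "x < \<psi> (i + 1)" "?f x = 0" by (rule sign_change_root)
    then show ?thesis by blast
  qed
  obtain x y z where x: "\<psi> i < x" "x < \<psi> (i + 1)" "?f x = 0"
    and y: "\<psi> j < y" "y < \<psi> (j + 1)" "?f y = 0" and z: "\<psi> k < z" "z < \<psi> (k + 1)" "?f z = 0"
    using root[OF ijk(1)] root[OF ijk(2)] root[OF ijk(3)] by blast
  have "\<psi> (i + 1) \<le> \<psi> j" "\<psi> (j + 1) \<le> \<psi> k" "\<psi> l \<le> \<psi> i" "\<psi> (k + 1) \<le> \<psi> h"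
    using ijk by (auto intro!: strict_mono_on_leD[OF mono])
  then have "x < y" "y < z" "z - x < pi" using x y z diam by linarith+
  then have "\<alpha> = 0" "\<beta> = 0" "c = 0"
    using sinusoid_three_roots[of x y z \<alpha> \<beta> c] x(3) y(3) z(3) by simp_all
  then show False using ijk(1) by (auto simp: g_def)
qed

lemma cos_le_cos_abs:
  fixes x y :: real
  assumes "\<bar>x\<bar> \<le> pi" "\<bar>y\<bar> \<le> pi"
  shows "cos x \<le> cos y \<longleftrightarrow> \<bar>y\<bar> \<le> \<bar>x\<bar>"
  using cos_mono_le_eq[of "\<bar>x\<bar>" "\<bar>y\<bar>"] assms by (simp add: cos_abs_real)

section \<open>Faces of globes\<close>

lemma polytope_convex_hull_UN:
  assumes "finite I" "\<And>i. i \<in> I \<Longrightarrow> polytope (S i)"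
  shows "polytope (convex hull (\<Union>i\<in>I. S i))"
proof -
  obtain A where A: "\<And>i. i \<in> I \<Longrightarrow> finite (A i) \<and> S i = convex hull (A i)"
    using assms(2) unfolding polytope_def by metis
  have "convex hull (\<Union>i\<in>I. S i) = convex hull (\<Union>i\<in>I. A i)"
  proof
    show "convex hull (\<Union>i\<in>I. S i) \<subseteq> convex hull (\<Union>i\<in>I. A i)"
    proof (rule hull_minimal)
      show "(\<Union>i\<in>I. S i) \<subseteq> convex hull (\<Union>i\<in>I. A i)"
      proof (rule UN_least)
        fix i assume i: "i \<in> I"
        then have "convex hull (A i) \<subseteq> convex hull (\<Union>i\<in>I. A i)" by (intro hull_mono) auto
        then show "S i \<subseteq> convex hull (\<Union>i\<in>I. A i)" using A[OF i] by simp
      qed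
    qed simp
    have "A i \<subseteq> S i" if "i \<in> I" for i using A[OF that] hull_subset[of "A i" convex] by simp
    then show "convex hull (\<Union>i\<in>I. A i) \<subseteq> convex hull (\<Union>i\<in>I. S i)" by (intro hull_mono) blast
  qed
  moreover have "finite (\<Union>i\<in>I. A i)" using A assms(1) by blast
  ultimately show ?thesis using polytope_convex_hull by metis
qed

text \<open>Measuring levels by angle turns the height into a sine and the scaling factor into a
  cosine, so a functional followed along the levels becomes a sinusoid.\<close>

definition latitude :: "nat \<Rightarrow> int \<Rightarrow> real" where
  "latitude m k = arcsin (of_int k / real m)"

definition layer :: "'a::euclidean_space \<Rightarrow> nat \<Rightarrow> int \<Rightarrow> 'a set \<Rightarrow> 'a set" where
  "layer v m k F = (\<lambda>x. cos (latitude m k) *\<^sub>R x + sin (latitude m k) *\<^sub>R v) ` F"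

definition frustum :: "'a::euclidean_space \<Rightarrow> nat \<Rightarrow> int \<Rightarrow> 'a set \<Rightarrow> 'a set" where
  "frustum v m k F = convex hull (layer v m k F \<union> layer v m (k + 1) F)"

lemma
  assumes "k \<in> {- int m + 1..int m - 1}"
  shows sin_latitude: "sin (latitude m k) = of_int k / real m"
    and cos_latitude: "cos (latitude m k) = sqrt (1 - (of_int k / real m)\<^sup>2)"
    and latitude_gt: "latitude m k > - (pi / 2)"
    and latitude_lt: "latitude m k < pi / 2"
    and cos_latitude_pos: "cos (latitude m k) > 0"
proof -
  have "0 < real m" using assms by (cases m) auto
  moreover have "- real m < of_int k" "of_int k < real m" using assms by auto
  ultimately have b: "- 1 < of_int k / real m" "of_int k / real m < 1" by (auto simp: field_simps)
  show "sin (latitude m k) = of_int k / real m" unfolding latitude_def using b by (intro sin_arcsin less_imp_le)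
  show "cos (latitude m k) = sqrt (1 - (of_int k / real m)\<^sup>2)"
    unfolding latitude_def using b by (intro cos_arcsin less_imp_le)
  show *: "latitude m k > - (pi / 2)" "latitude m k < pi / 2"
    unfolding latitude_def using arcsin_lt_bounded[OF b] by auto
  show "cos (latitude m k) > 0" using * by (intro cos_gt_zero_pi) auto
qed

lemma strict_mono_on_latitude: "strict_mono_on {- int m + 1..int m - 1} (latitude m)"
proof (rule strict_mono_onI)
  fix j k assume jk: "j \<in> {- int m + 1..int m - 1}" "k \<in> {- int m + 1..int m - 1}" "j < k"
  have m: "0 < real m" using jk by (cases m) auto
  have "of_int j / real m < of_int k / real m" using m jk(3) by (simp add: divide_strict_right_mono)
  then have "sin (latitude m j) < sin (latitude m k)" using jk by (simp add: sin_latitude)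
  then show "latitude m j < latitude m k"
    using latitude_gt[OF jk(1)] latitude_lt[OF jk(1)] latitude_gt[OF jk(2)] latitude_lt[OF jk(2)]
      sin_mono_less_eq by force
qed

lemma latitude_0 [simp]: "latitude m 0 = 0"
  by (simp add: latitude_def)

lemma layer_0 [simp]: "layer v m 0 F = F"
  by (simp add: layer_def)

lemma globe_eq_layers: "globe v m P = convex hull (\<Union>k\<in>{- int m + 1..int m - 1}. layer v m k P)"
  unfolding globe_def layer_def
  by (rule arg_cong[where f="\<lambda>S. convex hull S"]) (rule SUP_cong[OF refl], simp add: sin_latitude cos_latitude)

lemma layer_eq: "layer v m k F = (+) (sin (latitude m k) *\<^sub>R v) ` (*\<^sub>R) (cos (latitude m k)) ` F"
  by (simp add: layer_def image_image add.commute)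

lemma convex_layer: "convex F \<Longrightarrow> convex (layer v m k F)"
  by (simp add: layer_eq convex_translation convex_scaling)

lemma compact_layer: "compact F \<Longrightarrow> compact (layer v m k F)"
  unfolding layer_eq by (intro compact_translation compact_scaling)

lemma polytope_layer: "polytope F \<Longrightarrow> polytope (layer v m k F)"
  unfolding layer_eq polytope_translation_eq by (intro polytope_scaling)

lemma layer_eq_empty [simp]: "layer v m k F = {} \<longleftrightarrow> F = {}"
  by (simp add: layer_def)

context
  fixes m :: nat and k :: int
  assumes k: "k \<in> {- int m + 1..int m - 1}"
begin

lemma rel_interior_layer: "rel_interior (layer v m k F) = layer v m k (rel_interior F)"
  using cos_latitude_pos[OF k]
  by (simp add: layer_eq rel_interior_translation rel_interior_scaleR)

lemma aff_dim_layer: "aff_dim (layer v m k F) = aff_dim F"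
proof -
  have "aff_dim ((*\<^sub>R) (cos (latitude m k)) ` F) = aff_dim F"
    by (rule aff_dim_injective_linear_image) (use cos_latitude_pos[OF k] in \<open>auto intro!: injI\<close>)
  then show ?thesis unfolding layer_eq by (simp add: aff_dim_translation_eq)
qed

lemma layer_inject: "layer v m k E = layer v m k F \<longleftrightarrow> E = F"
proof -
  have "inj (\<lambda>x. cos (latitude m k) *\<^sub>R x + sin (latitude m k) *\<^sub>R v)"
    using cos_latitude_pos[OF k] by (auto intro!: injI)
  then show ?thesis unfolding layer_def by (rule inj_image_eq_iff)
qed

end

abbreviation levels :: "nat \<Rightarrow> int set" where
  "levels m \<equiv> {- int m + 1..int m - 1}"

locale globe_over =
  fixes v :: "'a::euclidean_space" and m :: nat and P :: "'a set"
  assumes poly: "polytope P" and zero: "0 \<in> rel_interior P"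
    and orth: "\<And>x. x \<in> P \<Longrightarrow> v \<bullet> x = 0" and unit: "v \<bullet> v = 1" and m2: "m \<ge> 2"
begin

abbreviation L where "L k \<equiv> layer v m k"
abbreviation lat where "lat \<equiv> latitude m"

lemma zero_mem: "0 \<in> P"
  using zero rel_interior_subset by blast

lemma inner_layer_point:
  "w \<bullet> (cos (lat k) *\<^sub>R x + sin (lat k) *\<^sub>R v) = cos (lat k) * (w \<bullet> x) + sin (lat k) * (w \<bullet> v)"
  by (simp add: inner_add_right)

lemma layer_height: "F \<subseteq> P \<Longrightarrow> y \<in> L k F \<Longrightarrow> v \<bullet> y = sin (lat k)"
  using orth by (auto simp: layer_def inner_layer_point unit)

lemma compact_layers: "compact (\<Union>k\<in>levels m. L k P)"
  by (intro compact_UN compact_layer polytope_imp_compact poly) simp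

lemma polytope_globe: "polytope (globe v m P)"
  unfolding globe_eq_layers by (intro polytope_convex_hull_UN polytope_layer poly) simp

lemma layer_subset_globe: "k \<in> levels m \<Longrightarrow> L k P \<subseteq> globe v m P"
  unfolding globe_eq_layers by (rule order_trans[OF _ hull_subset]) blast

lemma subset_globe: "P \<subseteq> globe v m P"
  using layer_subset_globe[of 0] m2 by simp

lemma axis_point:
  assumes "k \<in> levels m"
  shows "(of_int k / real m) *\<^sub>R v \<in> globe v m P"
proof -
  have "sin (lat k) *\<^sub>R v \<in> L k P" using zero_mem by (force simp: layer_def)
  then show ?thesis using layer_subset_globe[OF assms] by (simp add: sin_latitude[OF assms] subset_iff)
qed

lemma span_globe: "span (globe v m P) = span (insert v P)"
proof (rule span_eq[THEN iffD2], intro conjI)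
  have "L k P \<subseteq> span (insert v P)" for k
    by (auto simp: layer_def intro!: span_add span_scale intro: span_base)
  then have "(\<Union>k\<in>levels m. L k P) \<subseteq> span (insert v P)" by blast
  then show "globe v m P \<subseteq> span (insert v P)"
    unfolding globe_eq_layers by (rule hull_minimal) (simp add: subspace_imp_convex)
  have "(1 / real m) *\<^sub>R v \<in> span (globe v m P)"
    using axis_point[of 1] m2 by (auto intro: span_base)
  then have "real m *\<^sub>R (1 / real m) *\<^sub>R v \<in> span (globe v m P)" by (rule span_scale)
  then have "v \<in> span (globe v m P)" using m2 by simp
  then show "insert v P \<subseteq> span (globe v m P)" using subset_globe by (auto intro: span_base)
qed

text \<open>A functional that is nonnegative on the globe vanishes on \<open>P\<close>, where the
  origin is relatively interior, and on \<open>v\<close>, since small multiples of both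
  \<open>v\<close> and \<open>- v\<close> lie in the globe.\<close>

lemma zero_rel_interior_globe: "0 \<in> rel_interior (globe v m P)"
proof (rule rel_interiorI_minimizers)
  show "convex (globe v m P)" using polytope_globe polytope_imp_convex by blast
  show "0 \<in> globe v m P" using zero_mem subset_globe by blast
  fix a x assume a: "\<And>x. x \<in> globe v m P \<Longrightarrow> a \<bullet> 0 \<le> a \<bullet> x" and x: "x \<in> globe v m P"
  have aP: "a \<bullet> y = 0" if "y \<in> P" for y
    using rel_interior_minimizer[OF polytope_imp_convex[OF poly] zero, of a y] a subset_globe that by auto
  have "a \<bullet> ((1 / real m) *\<^sub>R v) \<ge> 0" "a \<bullet> ((- 1 / real m) *\<^sub>R v) \<ge> 0"
    using a[OF axis_point[of 1]] a[OF axis_point[of "- 1"]] m2 by auto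
  then have "a \<bullet> v = 0" using m2 by (auto simp: zero_le_divide_iff divide_le_0_iff)
  then have "insert v P \<subseteq> {y. a \<bullet> y = 0}" using aP by blast
  then have "span (insert v P) \<subseteq> {y. a \<bullet> y = 0}" by (rule span_minimal) (rule subspace_hyperplane)
  moreover have "x \<in> span (insert v P)" using x span_base[of x "globe v m P"] span_globe by simp
  ultimately show "a \<bullet> x = a \<bullet> 0" by auto
qed

text \<open>A face of the base exposed by \<open>a\<close> and a target latitude
  \<open>\<mu>\<close> combine into one functional. Its value at a copied point is
  \<open>b * cos (lat j - \<mu>)\<close> minus a nonnegative defect, so it is largest on the levels
  closest in angle to \<open>\<mu>\<close>, at the copies of maximizers of \<open>a\<close>.\<close>

lemma exposed_layers:
  assumes "b > 0" "\<And>x. x \<in> P \<Longrightarrow> a \<bullet> x \<le> b"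
    and mu: "cos \<mu> > 0" and rho: "\<And>j. j \<in> levels m \<Longrightarrow> cos (lat j - \<mu>) \<le> \<rho>"
  shows "convex hull (\<Union>j\<in>{j \<in> levels m. cos (lat j - \<mu>) = \<rho>}. L j {x \<in> P. a \<bullet> x = b})
    face_of globe v m P"
proof -
  \<comment> \<open>Removing the \<open>v\<close>-component of \<open>a\<close> does not change its
    values on \<open>P\<close> and leaves the value at \<open>v\<close> free;
    \<open>b * sin \<mu>\<close> is the choice for which the cosine addition formula
    applies.\<close>
  define w where "w = cos \<mu> *\<^sub>R (a - (a \<bullet> v) *\<^sub>R v) + (b * sin \<mu>) *\<^sub>R v"
  have wx: "w \<bullet> x = cos \<mu> * (a \<bullet> x)" if "x \<in> P" for x
    using orth[OF that] by (simp add: w_def inner_add_left inner_diff_left)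
  have wv: "w \<bullet> v = b * sin \<mu>"
    by (simp add: w_def inner_add_left inner_diff_left unit)
  have val: "w \<bullet> (cos (lat j) *\<^sub>R x + sin (lat j) *\<^sub>R v) =
      b * cos (lat j - \<mu>) - cos (lat j) * cos \<mu> * (b - a \<bullet> x)" if "x \<in> P" for j x
    unfolding inner_layer_point wx[OF that] wv cos_diff by (simp add: algebra_simps)
  have nn: "cos (lat j) * cos \<mu> * (b - a \<bullet> x) \<ge> 0" if "x \<in> P" "j \<in> levels m" for j x
    using cos_latitude_pos[OF that(2)] mu assms(2)[OF that(1)] by simp
  have brho: "b * cos (lat j - \<mu>) \<le> b * \<rho>" if "j \<in> levels m" for j
    using rho[OF that] assms(1) by simp
  have le: "w \<bullet> y \<le> b * \<rho>" if y: "y \<in> (\<Union>k\<in>levels m. L k P)" for y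
  proof -
    obtain j x where "j \<in> levels m" "x \<in> P" "y = cos (lat j) *\<^sub>R x + sin (lat j) *\<^sub>R v"
      using y unfolding layer_def by blast
    then show ?thesis using val nn[of x j] brho[of j] by simp
  qed
  have eq: "w \<bullet> (cos (lat j) *\<^sub>R x + sin (lat j) *\<^sub>R v) = b * \<rho> \<longleftrightarrow> a \<bullet> x = b \<and> cos (lat j - \<mu>) = \<rho>"
    if "x \<in> P" "j \<in> levels m" for j x
  proof
    assume "w \<bullet> (cos (lat j) *\<^sub>R x + sin (lat j) *\<^sub>R v) = b * \<rho>"
    then have "cos (lat j) * cos \<mu> * (b - a \<bullet> x) = 0" "b * cos (lat j - \<mu>) = b * \<rho>"
      using val[OF that(1), of j] nn[OF that] brho[OF that(2)] by linarith+
    then show "a \<bullet> x = b \<and> cos (lat j - \<mu>) = \<rho>"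
      using cos_latitude_pos[OF that(2)] mu assms(1) by auto
  next
    assume "a \<bullet> x = b \<and> cos (lat j - \<mu>) = \<rho>"
    then show "w \<bullet> (cos (lat j) *\<^sub>R x + sin (lat j) *\<^sub>R v) = b * \<rho>" using val[OF that(1)] by simp
  qed
  have "{y \<in> (\<Union>k\<in>levels m. L k P). w \<bullet> y = b * \<rho>} =
      (\<Union>j\<in>{j \<in> levels m. cos (lat j - \<mu>) = \<rho>}. L j {x \<in> P. a \<bullet> x = b})" (is "?A = ?B")
  proof (intro equalityI subsetI)
    fix y assume "y \<in> ?A"
    then obtain j x where "j \<in> levels m" "x \<in> P" "y = cos (lat j) *\<^sub>R x + sin (lat j) *\<^sub>R v" "w \<bullet> y = b * \<rho>"
      unfolding layer_def by blast
    then show "y \<in> ?B" using eq[of x j] unfolding layer_def by blast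
  next
    fix y assume "y \<in> ?B"
    then obtain j x where "j \<in> levels m" "cos (lat j - \<mu>) = \<rho>" "x \<in> P" "a \<bullet> x = b"
      "y = cos (lat j) *\<^sub>R x + sin (lat j) *\<^sub>R v"
      unfolding layer_def by blast
    then show "y \<in> ?A" using eq[of x j] unfolding layer_def by blast
  qed
  then show ?thesis
    using exposed_face_of_convex_hull[OF compact_layers le] unfolding globe_eq_layers by simp
qed

text \<open>Aim the functional at the latitude of level \<open>k\<close> itself: the cosine reaches
  1 on no other level.\<close>

lemma face_of_globe_layer:
  assumes "F face_of P" "F \<noteq> {}" "F \<noteq> P" "k \<in> levels m"
  shows "L k F face_of globe v m P"
proof -
  obtain a b where ab: "b > 0" "\<And>x. x \<in> P \<Longrightarrow> a \<bullet> x \<le> b" "F = {x \<in> P. a \<bullet> x = b}"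
    using proper_face_exposed[OF poly zero assms(1,3,2)] by metis
  have "{j \<in> levels m. cos (lat j - lat k) = 1} = {k}"
  proof (intro equalityI subsetI)
    fix j assume j: "j \<in> {j \<in> levels m. cos (lat j - lat k) = 1}"
    have "\<bar>lat j - lat k\<bar> \<le> pi"
      using latitude_gt[of j m] latitude_lt[of j m] latitude_gt[of k m] latitude_lt[of k m] j assms(4)
      by auto
    then have "lat j = lat k" using j cos_le_cos_abs[of 0 "lat j - lat k"] by simp
    then show "j \<in> {k}" using strict_mono_on_eqD[OF strict_mono_on_latitude] j assms(4) by auto
  qed (use assms in auto)
  then show ?thesis
    using exposed_layers[OF ab(1,2), of "lat k" 1] cos_latitude_pos[OF assms(4)] ab(3)
      convex_layer[of F v m k] face_of_imp_convex[OF assms(1)]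
    by (simp add: hull_same)
qed

lemma face_of_globe_frustum:
  assumes "F face_of P" "F \<noteq> {}" "F \<noteq> P" "k \<in> levels m" "k + 1 \<in> levels m"
  shows "frustum v m k F face_of globe v m P"
proof -
  obtain a b where ab: "b > 0" "\<And>x. x \<in> P \<Longrightarrow> a \<bullet> x \<le> b" "F = {x \<in> P. a \<bullet> x = b}"
    using proper_face_exposed[OF poly zero assms(1,3,2)] by metis
  \<comment> \<open>The midpoint in angle is equally far from the two neighbouring levels, and every
    other level is farther away, at distance more than \<open>h\<close>.\<close>
  define \<mu> where "\<mu> = (lat k + lat (k + 1)) / 2"
  define h where "h = (lat (k + 1) - lat k) / 2"
  note bd = latitude_gt[OF assms(4)] latitude_lt[OF assms(4)] latitude_gt[OF assms(5)] latitude_lt[OF assms(5)]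
  have lt: "lat k < lat (k + 1)"
    using strict_mono_onD[OF strict_mono_on_latitude assms(4,5)] by simp
  have mu: "cos \<mu> > 0" by (rule cos_gt_zero_pi) (use bd in \<open>auto simp: \<mu>_def\<close>)
  have h: "0 < h" "h < pi" using bd lt by (auto simp: h_def)
  have far: "\<bar>lat j - \<mu>\<bar> \<ge> h \<and> (\<bar>lat j - \<mu>\<bar> = h \<longleftrightarrow> j = k \<or> j = k + 1) \<and> \<bar>lat j - \<mu>\<bar> \<le> pi"
    if j: "j \<in> levels m" for j
  proof -
    have jb: "- (pi / 2) < lat j" "lat j < pi / 2" using latitude_gt[OF j] latitude_lt[OF j] by auto
    consider "j < k" | "j = k" | "j = k + 1" | "k + 1 < j" by linarith
    then show ?thesis
    proof cases
      case 1
      then have "lat j < lat k" using strict_mono_onD[OF strict_mono_on_latitude j assms(4)] by simp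
      then show ?thesis using 1 lt bd jb unfolding h_def \<mu>_def by (auto simp: abs_if field_simps)
    next
      case 4
      then have "lat (k + 1) < lat j" using strict_mono_onD[OF strict_mono_on_latitude assms(5) j] by simp
      then show ?thesis using 4 lt bd jb unfolding h_def \<mu>_def by (auto simp: abs_if field_simps)
    qed (use lt bd in \<open>auto simp: h_def \<mu>_def abs_if field_simps\<close>)
  qed
  have cosle: "cos (lat j - \<mu>) \<le> cos h" if "j \<in> levels m" for j
    using far[OF that] h cos_le_cos_abs[of "lat j - \<mu>" h] by simp
  have "{j \<in> levels m. cos (lat j - \<mu>) = cos h} = {k, k + 1}"
  proof (intro equalityI subsetI)
    fix j assume j: "j \<in> {j \<in> levels m. cos (lat j - \<mu>) = cos h}"
    then have jl: "j \<in> levels m" by blast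
    have "\<bar>lat j - \<mu>\<bar> \<le> h" using cos_le_cos_abs[of h "lat j - \<mu>"] far[OF jl] h j by simp
    then show "j \<in> {k, k + 1}" using far[OF jl] by auto
  next
    fix j assume j: "j \<in> {k, k + 1}"
    then have jl: "j \<in> levels m" using assms(4,5) by blast
    have "\<bar>lat j - \<mu>\<bar> = h" using far[OF jl] j by blast
    then have "cos (lat j - \<mu>) = cos h" by (metis cos_abs_real)
    then show "j \<in> {j \<in> levels m. cos (lat j - \<mu>) = cos h}" using jl by blast
  qed
  then show ?thesis
    using exposed_layers[OF ab(1,2) mu cosle] ab(3) by (simp add: frustum_def)
qed

text \<open>An exposing functional attains its maximum over every layer at the copy of the same face
  \<open>E\<close> of the base, because layers are positively scaled translates. The layer maxima
  form a sinusoid in the latitude, so the overall maximum is reached on one level or on two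
  neighbouring ones.\<close>

lemma face_of_globe_cases:
  assumes "F face_of globe v m P" "F \<noteq> {}" "F \<noteq> globe v m P"
  obtains E k where "E face_of P" "E \<noteq> {}" "k \<in> levels m"
    "F = L k E \<or> k + 1 \<in> levels m \<and> F = frustum v m k E"
proof -
  obtain w b where b: "b > 0" and le: "\<And>y. y \<in> globe v m P \<Longrightarrow> w \<bullet> y \<le> b"
    and F: "F = {y \<in> globe v m P. w \<bullet> y = b}"
    using proper_face_exposed[OF polytope_globe zero_rel_interior_globe assms(1,3,2)] by metis
  obtain x0 where x0: "x0 \<in> P" "\<And>x. x \<in> P \<Longrightarrow> w \<bullet> x \<le> w \<bullet> x0"
  proof -
    have "continuous_on P (\<lambda>x. w \<bullet> x)" by (intro continuous_intros)
    then show thesis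
      using continuous_attains_sup[of P "\<lambda>x. w \<bullet> x"] polytope_imp_compact[OF poly] zero_mem that by blast
  qed
  define M where "M = w \<bullet> x0"
  \<comment> \<open>\<open>E\<close> may be all of \<open>P\<close>; this happens for the top and
    the bottom facet.\<close>
  define E where "E = P \<inter> {x. w \<bullet> x = M}"
  have E: "E face_of P" unfolding E_def
    by (rule face_of_Int_supporting_hyperplane_le) (use polytope_imp_convex[OF poly] x0 in \<open>auto simp: M_def\<close>)
  define f where "f j = M * cos (lat j) + (w \<bullet> v) * sin (lat j)" for j
  have val: "w \<bullet> (cos (lat j) *\<^sub>R x + sin (lat j) *\<^sub>R v) = f j - cos (lat j) * (M - w \<bullet> x)" for j x
    unfolding inner_layer_point f_def by (simp add: algebra_simps)
  have gens_le: "w \<bullet> y \<le> b" if "y \<in> (\<Union>k\<in>levels m. L k P)" for y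
    using le that layer_subset_globe by blast
  have fle: "f j \<le> b" if "j \<in> levels m" for j
  proof -
    have "cos (lat j) *\<^sub>R x0 + sin (lat j) *\<^sub>R v \<in> L j P" using x0(1) by (auto simp: layer_def)
    then have "w \<bullet> (cos (lat j) *\<^sub>R x0 + sin (lat j) *\<^sub>R v) \<le> b" using gens_le that by blast
    then show ?thesis using val[of j x0] M_def by simp
  qed
  have eq: "w \<bullet> (cos (lat j) *\<^sub>R x + sin (lat j) *\<^sub>R v) = b \<longleftrightarrow> w \<bullet> x = M \<and> f j = b"
    if "x \<in> P" "j \<in> levels m" for j x
  proof -
    have "cos (lat j) * (M - w \<bullet> x) \<ge> 0"
      using cos_latitude_pos[OF that(2)] x0(2)[OF that(1)] by (simp add: M_def)
    then have "w \<bullet> (cos (lat j) *\<^sub>R x + sin (lat j) *\<^sub>R v) = b \<longleftrightarrow> cos (lat j) * (M - w \<bullet> x) = 0 \<and> f j = b"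
      using val[of j x] fle[OF that(2)] by linarith
    then show ?thesis using cos_latitude_pos[OF that(2)] by auto
  qed
  define T where "T = {j \<in> levels m. f j = b}"
  have "F = globe v m P \<inter> {y. w \<bullet> y = b}" using F by blast
  also have "\<dots> = convex hull {y \<in> (\<Union>k\<in>levels m. L k P). w \<bullet> y = b}"
    unfolding globe_eq_layers by (rule convex_hull_Int_supporting_hyperplane[OF compact_layers gens_le])
  also have "{y \<in> (\<Union>k\<in>levels m. L k P). w \<bullet> y = b} = (\<Union>j\<in>T. L j E)" (is "?A = ?B")
  proof (intro equalityI subsetI)
    fix y assume "y \<in> ?A"
    then obtain j x where "j \<in> levels m" "x \<in> P" "y = cos (lat j) *\<^sub>R x + sin (lat j) *\<^sub>R v" "w \<bullet> y = b"
      unfolding layer_def by blast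
    then show "y \<in> ?B" using eq[of x j] unfolding layer_def T_def E_def by blast
  next
    fix y assume "y \<in> ?B"
    then obtain j x where "j \<in> levels m" "f j = b" "x \<in> P" "w \<bullet> x = M"
      "y = cos (lat j) *\<^sub>R x + sin (lat j) *\<^sub>R v"
      unfolding layer_def T_def E_def by blast
    then show "y \<in> ?A" using eq[of x j] unfolding layer_def by blast
  qed
  finally have FT: "F = convex hull (\<Union>j\<in>T. L j E)" .
  then have "T \<noteq> {}" and En: "E \<noteq> {}" using assms(2) by (auto simp: layer_def)
  have m1: "1 - int m \<in> levels m" "int m - 1 \<in> levels m" using m2 by auto
  have diam: "lat (int m - 1) - lat (- int m + 1) < pi"
    using latitude_gt[of "- int m + 1" m] latitude_lt[of "int m - 1" m] m1 by auto
  obtain i where i: "i \<in> levels m" "T = {i} \<or> i + 1 \<in> levels m \<and> T = {i, i + 1}"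
    using sinusoid_argmax_adjacent[OF strict_mono_on_latitude diam, of M "w \<bullet> v" b] fle b \<open>T \<noteq> {}\<close>
    unfolding T_def f_def by (metis (no_types, lifting) finite_atLeastAtMost_int)
  from i(2) have "F = L i E \<or> i + 1 \<in> levels m \<and> F = frustum v m i E"
  proof
    assume "T = {i}"
    then show ?thesis using FT convex_layer[of E v m i] face_of_imp_convex[OF E] by (simp add: hull_same)
  next
    assume "i + 1 \<in> levels m \<and> T = {i, i + 1}"
    then show ?thesis using FT by (simp add: frustum_def)
  qed
  then show thesis using that E En i(1) by blast
qed

lemma sin_lat_less:
  assumes "j \<in> levels m" "k \<in> levels m"
  shows "sin (lat j) < sin (lat k) \<longleftrightarrow> j < k"
proof -
  have "sin (lat j) = of_int j / real m" "sin (lat k) = of_int k / real m"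
    using sin_latitude assms by blast+
  then show ?thesis using m2 by (simp add: divide_less_cancel)
qed

lemma frustum_height_ge:
  assumes "F \<subseteq> P" "k \<in> levels m" "k + 1 \<in> levels m" "y \<in> frustum v m k F"
  shows "sin (lat k) \<le> v \<bullet> y"
proof -
  have "(- v) \<bullet> z \<le> - sin (lat k)" if "z \<in> L k F \<union> L (k + 1) F" for z
    using that layer_height[OF assms(1)] sin_lat_less[OF assms(2,3)] by auto
  then have "(- v) \<bullet> y \<le> - sin (lat k)"
    using convex_hull_le_hyperplane[of "L k F \<union> L (k + 1) F" "- v"] assms(4) unfolding frustum_def by blast
  then show ?thesis by simp
qed

lemma frustum_Int_level:
  assumes "F face_of P" "k \<in> levels m" "k + 1 \<in> levels m"
  shows "frustum v m k F \<inter> {y. v \<bullet> y = sin (lat k)} = L k F"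
proof -
  have FP: "F \<subseteq> P" using face_of_imp_subset assms(1) by blast
  have cF: "compact F" using face_of_imp_compact assms(1) poly polytope_imp_compact polytope_imp_convex by blast
  have comp: "compact (L k F \<union> L (k + 1) F)" by (intro compact_Un compact_layer cF)
  have le: "(- v) \<bullet> z \<le> - sin (lat k)" if "z \<in> L k F \<union> L (k + 1) F" for z
    using that layer_height[OF FP] sin_lat_less[OF assms(2,3)] by auto
  have "frustum v m k F \<inter> {y. (- v) \<bullet> y = - sin (lat k)} =
      convex hull {z \<in> L k F \<union> L (k + 1) F. (- v) \<bullet> z = - sin (lat k)}"
    unfolding frustum_def by (rule convex_hull_Int_supporting_hyperplane[OF comp le])
  also have "{z \<in> L k F \<union> L (k + 1) F. (- v) \<bullet> z = - sin (lat k)} = L k F"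
    using layer_height[OF FP] sin_lat_less[OF assms(2,3)] by auto
  also have "convex hull L k F = L k F"
    using convex_layer[OF face_of_imp_convex[OF assms(1)], of v m k] by (simp add: hull_same)
  finally show ?thesis by simp
qed

lemma layer_subset_frustum: "L k F \<subseteq> frustum v m k F" "L (k + 1) F \<subseteq> frustum v m k F"
  unfolding frustum_def using hull_subset[of "L k F \<union> L (k + 1) F" convex] by auto

text \<open>The lowest height occurring in a frustum gives its level, and the slice at that height
  is the lower copy, which gives the face.\<close>

lemma frustum_inject:
  assumes "E face_of P" "E \<noteq> {}" "F face_of P" "F \<noteq> {}"
    and "j \<in> levels m" "j + 1 \<in> levels m" "k \<in> levels m" "k + 1 \<in> levels m"
    and eq: "frustum v m j E = frustum v m k F"
  shows "j = k \<and> E = F"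
proof -
  have EF: "E \<subseteq> P" "F \<subseteq> P" using face_of_imp_subset assms(1,3) by auto
  have low: "\<not> k < j" if A: "E \<subseteq> P" "F \<subseteq> P" "F \<noteq> {}" "j \<in> levels m" "j + 1 \<in> levels m" "k \<in> levels m"
    "frustum v m j E = frustum v m k F" for j k E F
  proof -
    obtain y where y: "y \<in> L k F" using layer_eq_empty A(3) by blast
    then have "sin (lat j) \<le> sin (lat k)"
      using layer_subset_frustum(1)[of k F] A frustum_height_ge[of E j y] layer_height[of F y k] by auto
    then show ?thesis using sin_lat_less[OF A(6,4)] by auto
  qed
  have "j = k"
    using low[of E F j k] low[of F E k j] EF assms by auto
  then show ?thesis
    using frustum_Int_level[OF assms(1,5,6)] frustum_Int_level[OF assms(3,7,8)] eq
      layer_inject[OF assms(5)] by metis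
qed

lemma layer_inject2:
  assumes "E \<subseteq> P" "E \<noteq> {}" "F \<subseteq> P" "j \<in> levels m" "k \<in> levels m" "L j E = L k F"
  shows "j = k \<and> E = F"
proof -
  obtain y where y: "y \<in> L j E" using layer_eq_empty assms(2) by blast
  then have "sin (lat j) = sin (lat k)"
    using layer_height[OF assms(1) y] layer_height[OF assms(3), of y k] assms(6) by simp
  then have "j = k" using sin_lat_less[OF assms(4,5)] sin_lat_less[OF assms(5,4)] by auto
  then show ?thesis using layer_inject assms by metis
qed

text \<open>The two copies are parallel, so a single point \<open>y0\<close> of the upper copy
  already generates, with the lower copy, the affine hull of both. It raises the dimension by one
  since it has a different height.\<close>

lemma aff_dim_frustum:
  assumes "F face_of P" "F \<noteq> {}" "k \<in> levels m" "k + 1 \<in> levels m"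
  shows "aff_dim (frustum v m k F) = aff_dim F + 1"
proof -
  have FP: "F \<subseteq> P" using face_of_imp_subset assms(1) by blast
  let ?p = "\<lambda>j x. cos (lat j) *\<^sub>R x + sin (lat j) *\<^sub>R v"
  obtain x0 where x0: "x0 \<in> F" using assms(2) by blast
  define y0 where "y0 = ?p (k + 1) x0"
  let ?A = "affine hull (insert y0 (L k F))"
  have "v \<bullet> y = sin (lat k)" if "y \<in> affine hull (L k F)" for y
  proof -
    have "affine hull (L k F) \<subseteq> {y. v \<bullet> y = sin (lat k)}"
      by (rule hull_minimal) (use layer_height[OF FP] affine_hyperplane in auto)
    then show ?thesis using that by blast
  qed
  moreover have "v \<bullet> y0 = sin (lat (k + 1))"
    by (rule layer_height[OF FP]) (use x0 in \<open>auto simp: y0_def layer_def\<close>)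
  ultimately have y0: "y0 \<notin> affine hull (L k F)" using sin_lat_less[OF assms(3,4)] by force
  have "L (k + 1) F \<subseteq> ?A"
  proof
    fix y assume "y \<in> L (k + 1) F"
    then obtain x where x: "x \<in> F" "y = ?p (k + 1) x" unfolding layer_def by blast
    have "?p k x \<in> ?A" "?p k x0 \<in> ?A" "y0 \<in> ?A"
      using x(1) x0 by (auto simp: layer_def intro!: hull_inc)
    then have "y0 + (cos (lat (k + 1)) / cos (lat k)) *\<^sub>R (?p k x - ?p k x0) \<in> ?A"
      by (intro mem_affine_3_minus affine_affine_hull)
    also have "?p k x - ?p k x0 = cos (lat k) *\<^sub>R (x - x0)" by (simp add: scaleR_right_diff_distrib)
    also have "y0 + (cos (lat (k + 1)) / cos (lat k)) *\<^sub>R (cos (lat k) *\<^sub>R (x - x0)) = y"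
      using cos_latitude_pos[OF assms(3)] unfolding y0_def x(2) by (simp add: scaleR_right_diff_distrib)
    finally show "y \<in> ?A" .
  qed
  moreover have "L k F \<subseteq> ?A" using hull_subset[of "insert y0 (L k F)" affine] by blast
  ultimately have "affine hull (L k F \<union> L (k + 1) F) \<subseteq> ?A"
    by (intro hull_minimal) auto
  moreover have "?A \<subseteq> affine hull (L k F \<union> L (k + 1) F)"
    by (rule hull_mono) (use x0 in \<open>auto simp: y0_def layer_def\<close>)
  ultimately have "aff_dim (frustum v m k F) = aff_dim (insert y0 (L k F))"
    unfolding frustum_def by (metis aff_dim_affine_hull aff_dim_convex_hull subset_antisym)
  then show ?thesis using y0 aff_dim_layer[OF assms(3)] by (simp add: aff_dim_insert)
qed

section \<open>Face numbers of globes\<close>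

lemma proper_if_aff_dim_less: "aff_dim F = int i \<Longrightarrow> int i < aff_dim P \<Longrightarrow> F \<noteq> P \<and> F \<noteq> {}"
  by auto

lemma finite_faces: "finite {F. F face_of P}"
  by (rule finite_polytope_faces[OF poly])

lemma finite_faces_globe: "finite {F. F face_of globe v m P}"
  by (rule finite_polytope_faces[OF polytope_globe])

lemma card_levels: "card (levels m) = 2 * m - 1"
proof -
  have "int (card (levels m)) = 2 * int m - 1" using m2 by simp
  then show ?thesis by linarith
qed

lemma f_num_globe_ge:
  assumes "int i < aff_dim P"
  shows "m * f_num i P \<le> f_num i (globe v m P)"
proof -
  let ?S = "levels m \<times> {F. F face_of P \<and> aff_dim F = int i}"
  have "inj_on (\<lambda>(k, F). L k F) ?S"
  proof (rule inj_onI)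
    fix a b assume "a \<in> ?S" "b \<in> ?S" "(\<lambda>(k, F). L k F) a = (\<lambda>(k, F). L k F) b"
    then show "a = b"
      using layer_inject2[of "snd a" "snd b" "fst a" "fst b"] proper_if_aff_dim_less[OF _ assms]
      by (auto simp: face_of_imp_subset split: prod.splits)
  qed
  moreover have "(\<lambda>(k, F). L k F) ` ?S \<subseteq> {F. F face_of globe v m P \<and> aff_dim F = int i}"
    using face_of_globe_layer proper_if_aff_dim_less[OF _ assms] by (auto simp: aff_dim_layer)
  moreover have "finite {F. F face_of globe v m P \<and> aff_dim F = int i}"
    by (rule finite_subset[OF _ finite_faces_globe]) auto
  ultimately have "card ?S \<le> f_num i (globe v m P)"
    unfolding f_num_def by (rule card_inj_on_le)
  moreover have "card ?S = card (levels m) * f_num i P" by (simp add: card_cartesian_product f_num_def)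
  moreover have "m \<le> card (levels m)" using m2 by simp
  ultimately show ?thesis by (metis mult_le_mono1 le_trans)
qed

lemma f_num_Suc_globe_ge:
  assumes "int i < aff_dim P"
  shows "m * f_num i P \<le> f_num (Suc i) (globe v m P)"
proof -
  \<comment> \<open>The top level has no neighbour above it; the remaining \<open>2 * m - 2\<close>
    levels are still at least \<open>m\<close> because \<open>m \<ge> 2\<close>.\<close>
  let ?K = "{- int m + 1..int m - 2}"
  let ?S = "?K \<times> {F. F face_of P \<and> aff_dim F = int i}"
  have K: "k \<in> levels m \<and> k + 1 \<in> levels m" if "k \<in> ?K" for k using that by auto
  have "inj_on (\<lambda>(k, F). frustum v m k F) ?S"
  proof (rule inj_onI)
    fix a b assume "a \<in> ?S" "b \<in> ?S" "(\<lambda>(k, F). frustum v m k F) a = (\<lambda>(k, F). frustum v m k F) b"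
    then show "a = b"
      using frustum_inject[of "snd a" "snd b" "fst a" "fst b"] proper_if_aff_dim_less[OF _ assms] K
      by (cases a; cases b) auto
  qed
  moreover have "(\<lambda>(k, F). frustum v m k F) ` ?S \<subseteq> {F. F face_of globe v m P \<and> aff_dim F = int (Suc i)}"
    using face_of_globe_frustum proper_if_aff_dim_less[OF _ assms] K by (auto simp: aff_dim_frustum)
  moreover have "finite {F. F face_of globe v m P \<and> aff_dim F = int (Suc i)}"
    by (rule finite_subset[OF _ finite_faces_globe]) auto
  ultimately have "card ?S \<le> f_num (Suc i) (globe v m P)"
    unfolding f_num_def by (rule card_inj_on_le)
  moreover have "card ?S = card ?K * f_num i P" by (simp add: card_cartesian_product f_num_def)
  moreover have "m \<le> card ?K" using m2 by simp
  ultimately show ?thesis by (metis mult_le_mono1 le_trans)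
qed

lemma card_faces_globe_le: "card {F. F face_of globe v m P} \<le> 4 * m * card {F. F face_of P}"
proof -
  let ?N = "card {F. F face_of P}"
  let ?A = "levels m \<times> {F. F face_of P}"
  have finA: "finite ?A" using finite_faces by simp
  have "{F. F face_of globe v m P} \<subseteq>
      {{}, globe v m P} \<union> (\<lambda>(k, F). L k F) ` ?A \<union> (\<lambda>(k, F). frustum v m k F) ` ?A" (is "_ \<subseteq> ?B \<union> ?C \<union> ?D")
  proof
    fix F assume "F \<in> {F. F face_of globe v m P}"
    then have F: "F face_of globe v m P" by blast
    show "F \<in> ?B \<union> ?C \<union> ?D"
    proof (cases "F = {} \<or> F = globe v m P")
      case False
      then obtain E k where "E face_of P" "E \<noteq> {}" "k \<in> levels m"
        "F = L k E \<or> k + 1 \<in> levels m \<and> F = frustum v m k E"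
        using face_of_globe_cases[OF F] by metis
      then show ?thesis by auto
    qed auto
  qed
  then have "card {F. F face_of globe v m P} \<le> card (?B \<union> ?C \<union> ?D)"
    using finA by (intro card_mono) auto
  also have "\<dots> \<le> card ?B + card ?C + card ?D"
    by (meson add_le_mono card_Un_le le_refl le_trans)
  also have "\<dots> \<le> 2 + card ?A + card ?A"
    using card_image_le[OF finA] by (intro add_mono) (auto simp: card_insert_if)
  also have "\<dots> = 2 + 2 * ((2 * m - 1) * ?N)"
    using card_levels by (simp add: card_cartesian_product)
  \<comment> \<open>The two improper faces are absorbed by rounding \<open>2 * m - 1\<close> up to
    \<open>2 * m\<close>, which gains \<open>2 * ?N \<ge> 2\<close>.\<close>
  also have "\<dots> \<le> 4 * m * ?N"
  proof -
    have "card {P} \<le> ?N" using finite_faces polytope_imp_convex[OF poly] by (intro card_mono) (auto simp: face_of_refl)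
    then have "1 \<le> ?N" by simp
    moreover obtain m' where "m = Suc m'" using m2 by (cases m) auto
    ultimately show ?thesis by (simp add: algebra_simps)
  qed
  finally show ?thesis .
qed

end

text \<open>Missing the relative interiors, the hyperplane leaves each of \<open>A\<close> and
  \<open>B\<close> weakly on one side. If it were the same side, \<open>y\<close> would be a
  relative interior minimizer over the hull and the functional would be constant, although
  \<open>a\<close> is off the hyperplane. Hence the sides differ, and this can be read off at any
  two chosen relative interior points.\<close>

lemma rel_interior_Un_hull_hit:
  fixes A B :: "'a::euclidean_space set"
  assumes "convex A" "convex B" "a \<in> rel_interior A" "b \<in> rel_interior B"
    and A: "\<And>x. x \<in> rel_interior A \<Longrightarrow> u \<bullet> x \<noteq> c" and B: "\<And>x. x \<in> rel_interior B \<Longrightarrow> u \<bullet> x \<noteq> c"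
    and hit: "y \<in> rel_interior (convex hull (A \<union> B))" "u \<bullet> y = c"
  shows "(u \<bullet> a - c) * (u \<bullet> b - c) < 0"
proof -
  \<comment> \<open>Otherwise the segment from \<open>s\<close> to \<open>x\<close> crosses the
    level \<open>d\<close> before reaching \<open>x\<close>, at a point that is still in the
    relative interior.\<close>
  have const: "w \<bullet> x \<ge> d" if S: "convex S" "s \<in> rel_interior S" "w \<bullet> s > d"
    and ne: "\<And>x. x \<in> rel_interior S \<Longrightarrow> w \<bullet> x \<noteq> d" and x: "x \<in> S" for S w d x and s :: 'a
  proof (rule ccontr)
    assume "\<not> w \<bullet> x \<ge> d"
    then have lt: "w \<bullet> x < d" by simp
    define t where "t = (w \<bullet> s - d) / (w \<bullet> s - w \<bullet> x)"
    have t: "0 < t" "t < 1" using lt S(3) by (auto simp: t_def field_simps)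
    have "(1 - t) *\<^sub>R s + t *\<^sub>R x = s - t *\<^sub>R (s - x)" by (simp add: algebra_simps)
    moreover have "x - (1 - t) *\<^sub>R (x - s) \<in> rel_interior S"
      using rel_interior_convex_shrink[OF S(1,2) x, of "1 - t"] t by simp
    moreover have "x - (1 - t) *\<^sub>R (x - s) = s - t *\<^sub>R (s - x)" by (simp add: algebra_simps)
    ultimately have "s - t *\<^sub>R (s - x) \<in> rel_interior S" by simp
    moreover have "w \<bullet> (s - t *\<^sub>R (s - x)) = d"
      using lt S(3) by (simp add: t_def inner_diff_right)
    ultimately show False using ne by blast
  qed
  have key: False if "w \<bullet> a > d" "w \<bullet> b > d" "w \<bullet> y = d"
    "\<And>x. x \<in> rel_interior A \<Longrightarrow> w \<bullet> x \<noteq> d" "\<And>x. x \<in> rel_interior B \<Longrightarrow> w \<bullet> x \<noteq> d" for w d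
  proof -
    have "(- w) \<bullet> x \<le> - d" if "x \<in> A \<union> B" for x
      using that const[OF assms(1,3) \<open>w \<bullet> a > d\<close>] const[OF assms(2,4) \<open>w \<bullet> b > d\<close>] that
        \<open>\<And>x. x \<in> rel_interior A \<Longrightarrow> w \<bullet> x \<noteq> d\<close> \<open>\<And>x. x \<in> rel_interior B \<Longrightarrow> w \<bullet> x \<noteq> d\<close> by auto
    then have "(- w) \<bullet> x \<le> - d" if "x \<in> convex hull (A \<union> B)" for x
      using convex_hull_le_hyperplane[OF _ that] by blast
    then have "w \<bullet> y \<le> w \<bullet> x" if "x \<in> convex hull (A \<union> B)" for x
      using that \<open>w \<bullet> y = d\<close> by force
    moreover have "a \<in> convex hull (A \<union> B)"
      using assms(3) rel_interior_subset by (blast intro: hull_inc)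
    ultimately have "w \<bullet> a = w \<bullet> y"
      using rel_interior_minimizer[OF convex_convex_hull hit(1)] by blast
    then show False using that by simp
  qed
  have "u \<bullet> a \<noteq> c" "u \<bullet> b \<noteq> c" using A B assms(3,4) by auto
  moreover have "\<not> (u \<bullet> a > c \<and> u \<bullet> b > c)" using key[of c u] hit A B by blast
  moreover have "\<not> (u \<bullet> a < c \<and> u \<bullet> b < c)" using key[of "- c" "- u"] hit A B by auto
  ultimately show ?thesis by (auto simp: mult_less_0_iff)
qed

section \<open>Faces of a globe crossed by a hyperplane\<close>

context globe_over
begin

text \<open>If \<open>u\<close> does not vanish on \<open>P\<close>, undoing the scaling and
  translation of a layer turns the cut into an affine cut of \<open>P\<close>, which costs at most
  \<open>A\<close> per level. If \<open>u\<close> vanishes on \<open>P\<close>, it is constant on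
  each layer with different constants, so at most one level is met, and that level costs at most all
  faces of \<open>P\<close>.\<close>

lemma card_hit_layers_le:
  fixes c :: real
  assumes "\<And>c. (\<exists>x\<in>P. u \<bullet> x \<noteq> 0) \<Longrightarrow> card (hit_faces P {x. u \<bullet> x = c}) \<le> A"
    and "\<exists>y\<in>globe v m P. u \<bullet> y \<noteq> 0"
  defines "h \<equiv> \<lambda>k. {E. E face_of P \<and> rel_interior (L k E) \<inter> {x. u \<bullet> x = c} \<noteq> {}}"
  shows "(\<Sum>k\<in>levels m. card (h k)) \<le> 2 * m * A + card {F. F face_of P}"
proof (cases "\<exists>x\<in>P. u \<bullet> x \<noteq> 0")
  case True
  have "h k \<subseteq> hit_faces P {x. u \<bullet> x = (c - sin (lat k) * (u \<bullet> v)) / cos (lat k)}" if k: "k \<in> levels m" for k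
  proof
    fix E assume "E \<in> h k"
    then have E: "E face_of P" and "L k (rel_interior E) \<inter> {x. u \<bullet> x = c} \<noteq> {}"
      by (auto simp: h_def rel_interior_layer[OF k])
    then obtain x where x: "x \<in> rel_interior E" "u \<bullet> (cos (lat k) *\<^sub>R x + sin (lat k) *\<^sub>R v) = c"
      unfolding layer_def by blast
    have "u \<bullet> x = (c - sin (lat k) * (u \<bullet> v)) / cos (lat k)"
      using x(2) cos_latitude_pos[OF k] unfolding inner_layer_point by (simp add: field_simps)
    then show "E \<in> hit_faces P {x. u \<bullet> x = (c - sin (lat k) * (u \<bullet> v)) / cos (lat k)}"
      using E x(1) unfolding hit_faces_def by blast
  qed
  then have "card (h k) \<le> A" if k: "k \<in> levels m" for k
    using card_mono[OF finite_hit_faces[OF poly]] k assms(1)[OF True] le_trans by meson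
  then have "(\<Sum>k\<in>levels m. card (h k)) \<le> (\<Sum>k\<in>levels m. A)" by (intro sum_mono) auto
  also have "\<dots> = (2 * m - 1) * A" using card_levels by simp
  also have "\<dots> \<le> 2 * m * A" by (intro mult_le_mono1) simp
  finally show ?thesis by simp
next
  case False
  then have uP: "u \<bullet> x = 0" if "x \<in> P" for x using that by blast
  have "u \<bullet> v \<noteq> 0"
  proof
    assume "u \<bullet> v = 0"
    then have "insert v P \<subseteq> {y. u \<bullet> y = 0}" using uP by blast
    then have "span (insert v P) \<subseteq> {y. u \<bullet> y = 0}" by (rule span_minimal) (rule subspace_hyperplane)
    then show False using assms(2) span_globe span_base by blast
  qed
  define K where "K = {k \<in> levels m. sin (lat k) * (u \<bullet> v) = c}"
  have "h k = {}" if "k \<in> levels m - K" for k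
  proof -
    have k: "k \<in> levels m" using that by blast
    have "u \<bullet> y = sin (lat k) * (u \<bullet> v)" if "E face_of P" "y \<in> rel_interior (L k E)" for E y
    proof -
      have "E \<subseteq> P" using face_of_imp_subset that(1) by blast
      moreover have "y \<in> L k E" using that(2) rel_interior_subset by blast
      ultimately obtain x where "x \<in> P" "y = cos (lat k) *\<^sub>R x + sin (lat k) *\<^sub>R v"
        unfolding layer_def by blast
      then show ?thesis using uP by (simp add: inner_layer_point)
    qed
    then show ?thesis using that by (auto simp: h_def K_def)
  qed
  then have "(\<Sum>k\<in>levels m. card (h k)) = (\<Sum>k\<in>K. card (h k))"
    by (intro sum.mono_neutral_right) (auto simp: K_def)
  also have "\<dots> \<le> (\<Sum>k\<in>K. card {F. F face_of P})"
    by (intro sum_mono card_mono finite_faces) (auto simp: h_def)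
  also have "\<dots> = card K * card {F. F face_of P}" by simp
  also have "card K \<le> 1"
  proof -
    have "j = k" if "j \<in> K" "k \<in> K" for j k
    proof -
      have "sin (lat j) * (u \<bullet> v) = sin (lat k) * (u \<bullet> v)" using that by (simp add: K_def)
      then have "sin (lat j) = sin (lat k)" using \<open>u \<bullet> v \<noteq> 0\<close> by simp
      moreover have "j \<in> levels m" "k \<in> levels m" using that by (simp_all add: K_def)
      ultimately have "\<not> j < k" "\<not> k < j" using sin_lat_less less_irrefl by metis+
      then show ?thesis by simp
    qed
    moreover have "finite K" by (rule finite_subset[of _ "levels m"]) (auto simp: K_def)
    ultimately show ?thesis by (simp add: card_le_Suc0_iff_eq)
  qed
  finally show ?thesis by simp
qed

text \<open>A frustum is met through its lower copy (\<open>?C\<close>), through its upper copy (\<open>?D\<close>), or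
  strictly between them (\<open>?Z\<close>); in the last case the functional changes sign along the arc
  through the point \<open>ctr E\<close>, which happens for at most two levels.\<close>

lemma card_hit_faces_globe_le:
  assumes "\<And>c. (\<exists>x\<in>P. u \<bullet> x \<noteq> 0) \<Longrightarrow> card (hit_faces P {x. u \<bullet> x = c}) \<le> A"
    and "\<exists>y\<in>globe v m P. u \<bullet> y \<noteq> 0"
  shows "card (hit_faces (globe v m P) {x. u \<bullet> x = c}) \<le> 1 + 6 * m * A + 5 * card {F. F face_of P}"
proof -
  let ?H = "{x. u \<bullet> x = c}"
  let ?N = "card {F. F face_of P}"
  define h where "h k = {E. E face_of P \<and> rel_interior (L k E) \<inter> ?H \<noteq> {}}" for k
  define ctr where "ctr E = (SOME x. x \<in> rel_interior E)" for E :: "'a set"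
  have ctr: "ctr E \<in> rel_interior E" if "E face_of P" "E \<noteq> {}" for E
    unfolding ctr_def using someI_ex[of "\<lambda>x. x \<in> rel_interior E"]
      rel_interior_eq_empty[OF face_of_imp_convex[OF that(1)]] that(2) by blast
  define g where "g E k = (u \<bullet> ctr E) * cos (lat k) + (u \<bullet> v) * sin (lat k) - c" for E k
  define X where "X E = {k \<in> levels m. k + 1 \<in> levels m \<and> g E k * g E (k + 1) < 0}" for E
  have m1: "1 - int m \<in> levels m" "int m - 1 \<in> levels m" using m2 by auto
  have diam: "lat (int m - 1) - lat (- int m + 1) < pi"
    using latitude_gt[of "- int m + 1" m] latitude_lt[of "int m - 1" m] m1 by auto
  have X: "card (X E) \<le> 2" for E
    unfolding X_def g_def by (rule card_sinusoid_sign_changes[OF strict_mono_on_latitude diam])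
  have finh: "finite (h k)" for k
    by (rule finite_subset[OF _ finite_faces]) (auto simp: h_def)
  have finX: "finite (X E)" for E
    by (rule finite_subset[of _ "levels m"]) (auto simp: X_def)
  let ?B = "\<Union>k\<in>levels m. L k ` h k"
  let ?C = "\<Union>k\<in>levels m. frustum v m k ` h k"
  \<comment> \<open>A frustum is indexed by its lower level, whereas here \<open>k\<close> is the
    level of its upper copy.\<close>
  let ?D = "\<Union>k\<in>levels m. frustum v m (k - 1) ` h k"
  let ?Z = "\<Union>E\<in>{F. F face_of P}. (\<lambda>k. frustum v m k E) ` X E"
  have "hit_faces (globe v m P) ?H \<subseteq> {globe v m P} \<union> ?B \<union> ?C \<union> ?D \<union> ?Z"
  proof
    fix F assume "F \<in> hit_faces (globe v m P) ?H"
    then have F: "F face_of globe v m P" "rel_interior F \<inter> ?H \<noteq> {}" unfolding hit_faces_def by auto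
    show "F \<in> {globe v m P} \<union> ?B \<union> ?C \<union> ?D \<union> ?Z"
    proof (cases "F = globe v m P")
      case False
      have "F \<noteq> {}" using F(2) by auto
      then obtain E k where E: "E face_of P" "E \<noteq> {}" "k \<in> levels m"
        and Fc: "F = L k E \<or> k + 1 \<in> levels m \<and> F = frustum v m k E"
        using face_of_globe_cases[OF F(1)] False by metis
      from Fc show ?thesis
      proof
        assume "F = L k E"
        then have "E \<in> h k" using E F(2) by (simp add: h_def)
        then show ?thesis using E(3) \<open>F = L k E\<close> by blast
      next
        assume fr: "k + 1 \<in> levels m \<and> F = frustum v m k E"
        consider "E \<in> h k" | "E \<in> h (k + 1)" | "E \<notin> h k" "E \<notin> h (k + 1)" by blast
        then show ?thesis
        proof cases
          case 1
          then show ?thesis using E(3) fr by blast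
        next
          case 2
          then have "F \<in> frustum v m (k + 1 - 1) ` h (k + 1)" using fr by simp
          then show ?thesis using fr by blast
        next
          case 3
          let ?p = "\<lambda>k. cos (lat k) *\<^sub>R ctr E + sin (lat k) *\<^sub>R v"
          obtain y where y: "y \<in> rel_interior (convex hull (L k E \<union> L (k + 1) E))" "u \<bullet> y = c"
            using F(2) fr unfolding frustum_def by blast
          have p: "?p k \<in> rel_interior (L k E)" "?p (k + 1) \<in> rel_interior (L (k + 1) E)"
            using ctr[OF E(1,2)] fr E(3) by (auto simp: rel_interior_layer, auto simp: layer_def)
          have "(u \<bullet> ?p k - c) * (u \<bullet> ?p (k + 1) - c) < 0"
            by (rule rel_interior_Un_hull_hit[OF _ _ p _ _ y])
              (use 3 E(1) face_of_imp_convex[OF E(1)] in \<open>auto simp: h_def intro: convex_layer\<close>)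
          then have "g E k * g E (k + 1) < 0"
            unfolding g_def inner_layer_point by (simp add: mult.commute)
          then have "F \<in> (\<lambda>k. frustum v m k E) ` X E" using E(3) fr by (simp add: X_def)
          then have "F \<in> ?Z" using E(1) by (intro UN_I[of E]) simp_all
          then show ?thesis by simp
        qed
      qed
    qed simp
  qed
  then have "card (hit_faces (globe v m P) ?H) \<le> card ({globe v m P} \<union> ?B \<union> ?C \<union> ?D \<union> ?Z)"
    using finh finX finite_faces by (intro card_mono) auto
  also have "\<dots> \<le> 1 + card ?B + card ?C + card ?D + card ?Z"
  proof -
    have "card ({globe v m P} \<union> ?B) \<le> 1 + card ?B" using card_Un_le[of "{globe v m P}" ?B] by simp
    moreover have "card ({globe v m P} \<union> ?B \<union> ?C) \<le> card ({globe v m P} \<union> ?B) + card ?C" by (rule card_Un_le)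
    moreover have "card ({globe v m P} \<union> ?B \<union> ?C \<union> ?D) \<le> card ({globe v m P} \<union> ?B \<union> ?C) + card ?D" by (rule card_Un_le)
    moreover have "card ({globe v m P} \<union> ?B \<union> ?C \<union> ?D \<union> ?Z) \<le> card ({globe v m P} \<union> ?B \<union> ?C \<union> ?D) + card ?Z" by (rule card_Un_le)
    ultimately show ?thesis by linarith
  qed
  also have "\<dots> \<le> 1 + (2 * m * A + ?N) + (2 * m * A + ?N) + (2 * m * A + ?N) + 2 * ?N"
  proof -
    have S: "(\<Sum>k\<in>levels m. card (h k)) \<le> 2 * m * A + ?N"
      unfolding h_def by (rule card_hit_layers_le[OF assms])
    have U: "card (\<Union>k\<in>levels m. f k ` h k) \<le> 2 * m * A + ?N" for f :: "int \<Rightarrow> 'a set \<Rightarrow> 'a set"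
    proof -
      have "card (\<Union>k\<in>levels m. f k ` h k) \<le> (\<Sum>k\<in>levels m. card (f k ` h k))" by (rule card_UN_le) simp
      also have "\<dots> \<le> (\<Sum>k\<in>levels m. card (h k))" by (intro sum_mono card_image_le finh)
      finally show ?thesis using S by simp
    qed
    have "card ?Z \<le> (\<Sum>E\<in>{F. F face_of P}. card ((\<lambda>k. frustum v m k E) ` X E))"
      by (rule card_UN_le[OF finite_faces])
    also have "\<dots> \<le> (\<Sum>E\<in>{F. F face_of P}. 2)"
      by (intro sum_mono le_trans[OF card_image_le[OF finX] X])
    finally have "card ?Z \<le> 2 * ?N" by simp
    then show ?thesis using U[of "\<lambda>k. L k"] U[of "\<lambda>k. frustum v m k"] U[of "\<lambda>k. frustum v m (k - 1)"]
      by linarith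
  qed
  finally show ?thesis by (simp add: algebra_simps)
qed

end

section \<open>Bipyramids\<close>

locale bipyr_over =
  fixes v :: "'a::euclidean_space" and P :: "'a set"
  assumes poly: "polytope P" and zero: "0 \<in> rel_interior P"
    and orth: "\<And>x. x \<in> P \<Longrightarrow> v \<bullet> x = 0" and unit: "v \<bullet> v = 1"
begin

lemma zero_mem: "0 \<in> P"
  using zero rel_interior_subset by blast

lemma convex_P: "convex P"
  by (rule polytope_imp_convex[OF poly])

lemma compact_gens: "compact (P \<union> {v, - v})"
  using polytope_imp_compact[OF poly] by (intro compact_Un) auto

lemma polytope_bipyr: "polytope (bipyr v P)"
proof -
  have "bipyr v P = convex hull (\<Union>S\<in>{P, {v}, {- v}}. S)"
    unfolding bipyr_def by (rule arg_cong[where f="\<lambda>S. convex hull S"]) auto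
  moreover have "polytope (convex hull (\<Union>S\<in>{P, {v}, {- v}}. S))"
    by (rule polytope_convex_hull_UN) (use poly polytope_sing in auto)
  ultimately show ?thesis by simp
qed

lemma subset_bipyr: "P \<subseteq> bipyr v P" "v \<in> bipyr v P" "- v \<in> bipyr v P"
  unfolding bipyr_def by (auto intro: hull_inc)

lemma span_bipyr: "span (bipyr v P) = span (insert v P)"
proof (rule span_eq[THEN iffD2], intro conjI)
  have "P \<union> {v, - v} \<subseteq> span (insert v P)" by (auto intro: span_base span_neg)
  then show "bipyr v P \<subseteq> span (insert v P)"
    unfolding bipyr_def by (rule hull_minimal) (simp add: subspace_imp_convex)
  show "insert v P \<subseteq> span (bipyr v P)" using subset_bipyr by (auto intro: span_base)
qed

lemma zero_rel_interior_bipyr: "0 \<in> rel_interior (bipyr v P)"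
proof (rule rel_interiorI_minimizers)
  show "convex (bipyr v P)" using polytope_bipyr polytope_imp_convex by blast
  show "0 \<in> bipyr v P" using zero_mem subset_bipyr by blast
  fix a x assume a: "\<And>x. x \<in> bipyr v P \<Longrightarrow> a \<bullet> 0 \<le> a \<bullet> x" and x: "x \<in> bipyr v P"
  have aP: "a \<bullet> y = 0" if "y \<in> P" for y
    using rel_interior_minimizer[OF convex_P zero, of a y] a subset_bipyr that by auto
  have "a \<bullet> v = 0" using a[OF subset_bipyr(2)] a[OF subset_bipyr(3)] by simp
  then have "insert v P \<subseteq> {y. a \<bullet> y = 0}" using aP by blast
  then have "span (insert v P) \<subseteq> {y. a \<bullet> y = 0}" by (rule span_minimal) (rule subspace_hyperplane)
  moreover have "x \<in> span (insert v P)" using x span_base[of x "bipyr v P"] span_bipyr by simp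
  ultimately show "a \<bullet> x = a \<bullet> 0" by auto
qed

text \<open>A face is determined by its trace on \<open>P\<close>, which is a face of
  \<open>P\<close>, and by which of the two apices it contains; the factor 4 counts the latter
  choices.\<close>

lemma card_faces_bipyr_le: "card {F. F face_of bipyr v P} \<le> 4 * card {F. F face_of P}"
proof -
  let ?f = "\<lambda>F. (F \<inter> P, v \<in> F, - v \<in> F)"
  have fin: "finite {F. F face_of P}" by (rule finite_polytope_faces[OF poly])
  have "inj_on ?f {F. F face_of bipyr v P}"
  proof (rule inj_onI)
    fix E F assume "E \<in> {F. F face_of bipyr v P}" "F \<in> {F. F face_of bipyr v P}" "?f E = ?f F"
    then have "E \<inter> (P \<union> {v, - v}) = F \<inter> (P \<union> {v, - v})"
      "E = convex hull (E \<inter> (P \<union> {v, - v}))" "F = convex hull (F \<inter> (P \<union> {v, - v}))"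
      using face_of_convex_hull_eq[OF compact_gens] unfolding bipyr_def by auto
    then show "E = F" by metis
  qed
  moreover have "?f ` {F. F face_of bipyr v P} \<subseteq> {F. F face_of P} \<times> UNIV \<times> UNIV"
  proof -
    have "F \<inter> P face_of P" if "F face_of bipyr v P" for F
      using face_of_slice[OF that convex_P] subset_bipyr(1) by (simp add: Int_absorb1)
    then show ?thesis by auto
  qed
  ultimately have "card {F. F face_of bipyr v P} \<le> card ({F. F face_of P} \<times> (UNIV :: bool set) \<times> (UNIV :: bool set))"
    using fin by (intro card_inj_on_le) auto
  then show ?thesis by (simp add: card_cartesian_product)
qed

text \<open>Keep the exposing functional \<open>a\<close> on the base and prescribe its value
  \<open>\<beta>\<close> at the apex \<open>v'\<close>: with \<open>\<beta> = 0\<close> it exposes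
  \<open>F\<close> alone, with \<open>\<beta> = b\<close> the cone over \<open>F\<close>. The
  opposite apex has value \<open>- \<beta>\<close>, below \<open>b\<close> since
  \<open>b > 0\<close>.\<close>

lemma face_of_bipyr:
  assumes "F face_of P" "F \<noteq> {}" "F \<noteq> P" "v' \<in> {v, - v}"
  shows "F face_of bipyr v P" "convex hull (insert v' F) face_of bipyr v P"
proof -
  obtain a b where ab: "b > 0" "\<And>x. x \<in> P \<Longrightarrow> a \<bullet> x \<le> b" "F = {x \<in> P. a \<bullet> x = b}"
    using proper_face_exposed[OF poly zero assms(1,3,2)] by metis
  have v': "v' \<bullet> v' = 1" "\<And>x. x \<in> P \<Longrightarrow> v' \<bullet> x = 0" and vv: "{v, - v} = {v', - v'}"
    using assms(4) orth unit by auto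
  define w where "w \<beta> = (a - (a \<bullet> v') *\<^sub>R v') + \<beta> *\<^sub>R v'" for \<beta> :: real
  have wx: "w \<beta> \<bullet> x = a \<bullet> x" if "x \<in> P" for x \<beta>
    using v'(2)[OF that] by (simp add: w_def inner_add_left inner_diff_left)
  have wv: "w \<beta> \<bullet> v' = \<beta>" for \<beta>
    by (simp add: w_def inner_add_left inner_diff_left v')
  have gen: "convex hull {x \<in> P \<union> {v', - v'}. w \<beta> \<bullet> x = b} face_of bipyr v P" if "0 \<le> \<beta>" "\<beta> \<le> b" for \<beta>
    unfolding bipyr_def vv using compact_gens vv
    by (intro exposed_face_of_convex_hull) (use that ab wx wv in auto)
  have "{x \<in> P \<union> {v', - v'}. w 0 \<bullet> x = b} = F" using ab wx wv by auto
  then show "F face_of bipyr v P"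
    using gen[of 0] ab(1) face_of_imp_convex[OF assms(1)] by (simp add: hull_same)
  have "{x \<in> P \<union> {v', - v'}. w b \<bullet> x = b} = insert v' F" using ab wx[of _ b] wv[of b] by auto
  then show "convex hull (insert v' F) face_of bipyr v P"
    using gen[of b] ab(1) by simp
qed

text \<open>Recovers the base face from its cone, which is what makes maps from faces to cones
  injective.\<close>

lemma cone_Int:
  assumes "F \<subseteq> P" "convex F" "v' \<in> {v, - v}" "F \<noteq> {}"
  shows "convex hull (insert v' F) \<inter> {x. v \<bullet> x = 0} = F"
proof (intro equalityI subsetI)
  fix y assume y: "y \<in> convex hull (insert v' F) \<inter> {x. v \<bullet> x = 0}"
  have v': "v \<bullet> v' \<noteq> 0" using assms(3) unit by auto
  obtain s t x where st: "0 \<le> s" "0 \<le> t" "s + t = 1" "x \<in> F" "y = s *\<^sub>R v' + t *\<^sub>R x"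
    using y convex_hull_insert_alt[of v' F] assms(4) hull_same[of convex F] assms(2)
    unfolding convex_hull_insert[OF assms(4)] by auto
  have "s * (v \<bullet> v') = 0" using y st orth[of x] assms(1) by (auto simp: inner_add_right)
  then have "s = 0" using v' by simp
  then show "y \<in> F" using st by simp
next
  fix y assume "y \<in> F"
  then show "y \<in> convex hull (insert v' F) \<inter> {x. v \<bullet> x = 0}"
    using orth assms(1) by (auto intro: hull_inc)
qed

lemma aff_dim_cone:
  assumes "F \<subseteq> P" "v' \<in> {v, - v}"
  shows "aff_dim (convex hull (insert v' F)) = aff_dim F + 1"
proof -
  have "affine hull F \<subseteq> {x. v \<bullet> x = 0}"
    by (rule hull_minimal) (use orth assms(1) affine_hyperplane in auto)
  moreover have "v \<bullet> v' \<noteq> 0" using assms(2) unit by auto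
  ultimately have "v' \<notin> affine hull F" by auto
  then show ?thesis by (simp add: aff_dim_convex_hull aff_dim_insert)
qed

lemma finite_faces_bipyr: "finite {F. F face_of bipyr v P}"
  by (rule finite_polytope_faces[OF polytope_bipyr])

lemma f_num_bipyr_ge:
  assumes "int i < aff_dim P"
  shows "f_num i P \<le> f_num i (bipyr v P)" "f_num i P \<le> f_num (Suc i) (bipyr v P)"
proof -
  have pr: "F \<noteq> {} \<and> F \<noteq> P" if "aff_dim F = int i" for F using that assms by auto
  show "f_num i P \<le> f_num i (bipyr v P)"
    unfolding f_num_def
    by (rule card_mono[OF finite_subset[OF _ finite_faces_bipyr]]) (use pr face_of_bipyr(1)[of _ v] in auto)
  let ?c = "\<lambda>F. convex hull (insert v F)"
  have "inj_on ?c {F. F face_of P \<and> aff_dim F = int i}"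
  proof (rule inj_onI)
    fix E F assume EF: "E \<in> {F. F face_of P \<and> aff_dim F = int i}" "F \<in> {F. F face_of P \<and> aff_dim F = int i}"
      "?c E = ?c F"
    have c: "?c E \<inter> {x. v \<bullet> x = 0} = E" if "E face_of P" "aff_dim E = int i" for E
      by (rule cone_Int[OF face_of_imp_subset[OF that(1)] face_of_imp_convex[OF that(1)]])
        (use pr[OF that(2)] in auto)
    have "?c E \<inter> {x. v \<bullet> x = 0} = E" "?c F \<inter> {x. v \<bullet> x = 0} = F"
      using c EF(1,2) by simp_all
    then show "E = F" unfolding EF(3) by (rule trans[OF sym])
  qed
  moreover have "?c ` {F. F face_of P \<and> aff_dim F = int i} \<subseteq> {F. F face_of bipyr v P \<and> aff_dim F = int (Suc i)}"
  proof (rule image_subsetI)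
    fix F assume "F \<in> {F. F face_of P \<and> aff_dim F = int i}"
    then have F: "F face_of P" "aff_dim F = int i" by auto
    then have "aff_dim (?c F) = int (Suc i)" using aff_dim_cone[OF face_of_imp_subset, of F v] by simp
    moreover have "?c F face_of bipyr v P" using face_of_bipyr(2)[of F v] pr F by simp
    ultimately show "?c F \<in> {F. F face_of bipyr v P \<and> aff_dim F = int (Suc i)}" by blast
  qed
  moreover have "finite {F. F face_of bipyr v P \<and> aff_dim F = int (Suc i)}"
    by (rule finite_subset[OF _ finite_faces_bipyr]) auto
  ultimately show "f_num i P \<le> f_num (Suc i) (bipyr v P)"
    unfolding f_num_def by (rule card_inj_on_le)
qed

end

section \<open>Central sections of bipyramids\<close>

lemma polytope_central_section: "polytope P \<Longrightarrow> polytope (central_section P u)"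
  unfolding central_section_def by (intro polytope_Int_polyhedron polyhedron_hyperplane)

lemma zero_rel_interior_central_section:
  assumes "convex P" "0 \<in> rel_interior P"
  shows "0 \<in> rel_interior (central_section P u)"
proof -
  have "rel_interior (P \<inter> {x. u \<bullet> x = 0}) = rel_interior P \<inter> {x. u \<bullet> x = 0}"
    by (rule convex_affine_rel_interior_Int[OF assms(1) affine_hyperplane]) (use assms(2) in auto)
  then show ?thesis using assms(2) by (simp add: central_section_def)
qed

lemma aff_dim_central_section:
  assumes "convex P" "0 \<in> rel_interior P" "\<exists>x\<in>P. u \<bullet> x \<noteq> 0"
  shows "aff_dim (central_section P u) = aff_dim P - 1"
  unfolding central_section_def
  by (rule aff_dim_Int_hyperplane[OF assms(1)]) (use assms(2,3) in auto)

text \<open>A functional minimized over the cone strictly inside the segment from \<open>x\<close>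
  to \<open>p\<close> has equal values at both ends. So \<open>x\<close> is a minimizer too; being
  relatively interior to \<open>F\<close>, it forces the functional to be constant on
  \<open>F\<close> and then on the cone.\<close>

lemma rel_interior_cone:
  fixes F :: "'a::euclidean_space set"
  assumes "x \<in> rel_interior F" "convex F" "0 < t" "t < 1"
  shows "(1 - t) *\<^sub>R x + t *\<^sub>R p \<in> rel_interior (convex hull (insert p F))" (is "?y \<in> rel_interior ?C")
proof (rule rel_interiorI_minimizers)
  have xC: "x \<in> ?C" using assms(1) rel_interior_subset by (blast intro: hull_inc)
  have pC: "p \<in> ?C" by (auto intro: hull_inc)
  show cv: "convex ?C" by simp
  show "?y \<in> ?C" by (rule convexD[OF cv xC pC]) (use assms in auto)
  fix a z assume a: "\<And>z. z \<in> ?C \<Longrightarrow> a \<bullet> ?y \<le> a \<bullet> z" and z: "z \<in> ?C"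
  have ay: "a \<bullet> ?y = (1 - t) * (a \<bullet> x) + t * (a \<bullet> p)" by (simp add: inner_add_right)
  have le: "a \<bullet> ?y \<le> a \<bullet> x" "a \<bullet> ?y \<le> a \<bullet> p" using a xC pC by auto
  have "(1 - t) * (a \<bullet> x - a \<bullet> ?y) + t * (a \<bullet> p - a \<bullet> ?y) = 0"
    unfolding ay by (simp add: algebra_simps)
  moreover have "(1 - t) * (a \<bullet> x - a \<bullet> ?y) \<ge> 0" "t * (a \<bullet> p - a \<bullet> ?y) \<ge> 0"
    using le assms(3,4) by auto
  ultimately have "(1 - t) * (a \<bullet> x - a \<bullet> ?y) = 0" "t * (a \<bullet> p - a \<bullet> ?y) = 0" by linarith+
  then have eq: "a \<bullet> x = a \<bullet> ?y" "a \<bullet> p = a \<bullet> ?y" using assms(3,4) by auto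
  have "a \<bullet> f = a \<bullet> x" if "f \<in> F" for f
  proof (rule rel_interior_minimizer[OF assms(2,1) _ that])
    fix g assume "g \<in> F"
    then show "a \<bullet> x \<le> a \<bullet> g" using a[of g] eq by (auto intro: hull_inc)
  qed
  then have "insert p F \<subseteq> {z. a \<bullet> z = a \<bullet> ?y}" using eq by auto
  then have "?C \<subseteq> {z. a \<bullet> z = a \<bullet> ?y}" by (rule hull_minimal) (rule convex_hyperplane)
  then show "a \<bullet> z = a \<bullet> ?y" using z by blast
qed

context bipyr_over
begin

lemma central_section_bipyr:
  assumes "u \<bullet> v = 0"
  shows "central_section (bipyr v P) u = bipyr v (central_section P u)"
proof
  show "bipyr v (central_section P u) \<subseteq> central_section (bipyr v P) u"
  proof
    fix y assume y: "y \<in> bipyr v (central_section P u)"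
    have "bipyr v (central_section P u) \<subseteq> bipyr v P"
      unfolding bipyr_def by (rule hull_mono) (auto simp: central_section_def)
    moreover have "bipyr v (central_section P u) \<subseteq> {x. u \<bullet> x = 0}"
      unfolding bipyr_def by (rule hull_minimal) (use assms in \<open>auto simp: central_section_def convex_hyperplane\<close>)
    ultimately show "y \<in> central_section (bipyr v P) u" using y by (auto simp: central_section_def)
  qed
  show "central_section (bipyr v P) u \<subseteq> bipyr v (central_section P u)"
  proof
    fix y assume "y \<in> central_section (bipyr v P) u"
    then have y: "y \<in> bipyr v P" "u \<bullet> y = 0" by (auto simp: central_section_def)
    have "bipyr v P = convex hull (insert v (insert (- v) P))"
      unfolding bipyr_def by (rule arg_cong[where f="\<lambda>S. convex hull S"]) auto
    then obtain s t z where st: "0 \<le> s" "0 \<le> t" "s + t = 1" "y = s *\<^sub>R v + t *\<^sub>R z"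
      and z: "z \<in> convex hull (insert (- v) P)"
      using y(1) by (auto simp: convex_hull_insert)
    have "P \<noteq> {}" using zero_mem by blast
    then obtain s' t' p where st': "0 \<le> s'" "0 \<le> t'" "s' + t' = 1" "z = s' *\<^sub>R (- v) + t' *\<^sub>R p"
      and p: "p \<in> P"
      using z by (auto simp: convex_hull_insert hull_same[of convex P, OF convex_P])
    \<comment> \<open>The point \<open>p\<close> enters \<open>y\<close> with coefficient
      \<open>t * t'\<close>, and the apices lie in the hyperplane. So either \<open>p\<close> lies
      in it as well or its coefficient is 0, and then \<open>p\<close> may be replaced by the
      origin.\<close>
    define q where "q = (if u \<bullet> p = 0 then p else 0)"
    have q: "q \<in> central_section P u" using p zero_mem by (auto simp: q_def central_section_def)
    have "t * t' * (u \<bullet> p) = 0" using y(2) assms by (simp add: st(4) st'(4) inner_add_right inner_diff_right)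
    then have eq: "(t * t') *\<^sub>R p = (t * t') *\<^sub>R q" by (auto simp: q_def)
    have y_eq: "y = s *\<^sub>R v + t *\<^sub>R (s' *\<^sub>R (- v) + t' *\<^sub>R q)"
      using eq by (auto simp: st(4) st'(4) scaleR_add_right)
    let ?C = "bipyr v (central_section P u)"
    have cv: "convex ?C" by (simp add: bipyr_def)
    have m: "v \<in> ?C" "- v \<in> ?C" "q \<in> ?C" using q by (auto simp: bipyr_def intro: hull_inc)
    have "s' *\<^sub>R (- v) + t' *\<^sub>R q \<in> ?C" by (rule convexD[OF cv m(2,3) st'(1-3)])
    then show "y \<in> ?C" unfolding y_eq by (rule convexD[OF cv m(1) _ st(1-3)])
  qed
qed

lemma bipyr_over_central_section: "bipyr_over v (central_section P u)"
proof
  show "polytope (central_section P u)" by (rule polytope_central_section[OF poly])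
  show "0 \<in> rel_interior (central_section P u)" by (rule zero_rel_interior_central_section[OF convex_P zero])
  show "v \<bullet> x = 0" if "x \<in> central_section P u" for x using that orth by (simp add: central_section_def)
qed (rule unit)

text \<open>A face of the base that leaves the hyperplane is replaced by the cone over it whose apex lies on
  the opposite side.\<close>

lemma f_num_oblique_section_bipyr_ge:
  assumes "u \<bullet> v \<noteq> 0" "int i < aff_dim P"
  shows "f_num i P \<le> f_num i (central_section (bipyr v P) u)"
proof -
  let ?H = "{x. u \<bullet> x = 0}"
  let ?S = "{F. F face_of P \<and> aff_dim F = int i}"
  let ?T = "{F \<in> hit_faces (bipyr v P) ?H. aff_dim (F \<inter> ?H) = int i}"
  \<comment> \<open>The slice condition is carried along because it makes the later choice of
    \<open>C\<close> injective in \<open>F\<close>.\<close>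
  have ex: "\<exists>C\<in>?T. C \<inter> {x. v \<bullet> x = 0} = F" if FS: "F \<in> ?S" for F
  proof -
    have F: "F face_of P" "aff_dim F = int i" using FS by auto
    have Fne: "F \<noteq> {}" "F \<noteq> P" using F(2) assms(2) by auto
    have FP: "F \<subseteq> P" by (rule face_of_imp_subset[OF F(1)])
    have cF: "convex F" by (rule face_of_imp_convex[OF F(1)])
    have rne: "rel_interior F \<noteq> {}" using rel_interior_eq_empty[OF cF] Fne by blast
    show ?thesis
    proof (cases "F \<subseteq> ?H")
      case True
      have "rel_interior F \<inter> ?H \<noteq> {}" using rne True rel_interior_subset[of F] by blast
      moreover have "F \<inter> ?H = F" using True by blast
      ultimately have "F \<in> ?T" using face_of_bipyr(1)[OF F(1) Fne, of v] F(2) by (simp add: hit_faces_def)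
      moreover have "F \<inter> {x. v \<bullet> x = 0} = F" using orth FP by auto
      ultimately show ?thesis by blast
    next
      case False
      \<comment> \<open>The cone can only be crossed in its relative interior if the segment to the
        apex starts at a relative interior point off the hyperplane; such points exist because
        \<open>F\<close> lies in the closure of its relative interior.\<close>
      have "\<not> rel_interior F \<subseteq> ?H"
      proof
        assume "rel_interior F \<subseteq> ?H"
        then have "closure (rel_interior F) \<subseteq> ?H" by (rule closure_minimal) (rule closed_hyperplane)
        then show False using False convex_closure_rel_interior[OF cF] closure_subset[of F] by blast
      qed
      then obtain x where x: "x \<in> rel_interior F" "u \<bullet> x \<noteq> 0" by blast
      obtain v' where v': "v' \<in> {v, - v}" "(u \<bullet> x) * (u \<bullet> v') < 0"
      proof (cases "(u \<bullet> x) * (u \<bullet> v) < 0")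
        case True
        then show ?thesis using that by blast
      next
        case False
        moreover have "(u \<bullet> x) * (u \<bullet> v) \<noteq> 0" using x(2) assms(1) by simp
        moreover have "(u \<bullet> x) * (u \<bullet> (- v)) = - ((u \<bullet> x) * (u \<bullet> v))" by simp
        ultimately have "(u \<bullet> x) * (u \<bullet> (- v)) < 0" by linarith
        then show ?thesis using that by blast
      qed
      define t where "t = (u \<bullet> x) / (u \<bullet> x - u \<bullet> v')"
      have t: "0 < t" "t < 1" "(1 - t) * (u \<bullet> x) + t * (u \<bullet> v') = 0"
        using v'(2) by (auto simp: t_def mult_less_0_iff field_simps)
      let ?C = "convex hull (insert v' F)"
      have "(1 - t) *\<^sub>R x + t *\<^sub>R v' \<in> rel_interior ?C" by (rule rel_interior_cone[OF x(1) cF t(1,2)])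
      moreover have "(1 - t) *\<^sub>R x + t *\<^sub>R v' \<in> ?H" using t(3) by (simp add: inner_add_right)
      ultimately have hit: "rel_interior ?C \<inter> ?H \<noteq> {}" by blast
      have "u \<bullet> v' \<noteq> 0" using v'(2) by auto
      moreover have "v' \<in> ?C" by (auto intro: hull_inc)
      ultimately have "\<not> ?C \<subseteq> ?H" by blast
      then have "aff_dim (?C \<inter> ?H) = int i"
        using aff_dim_Int_hyperplane[OF convex_convex_hull hit] aff_dim_cone[OF FP v'(1)] F(2) by simp
      then have "?C \<in> ?T" using hit face_of_bipyr(2)[OF F(1) Fne v'(1)] by (simp add: hit_faces_def)
      moreover have "?C \<inter> {x. v \<bullet> x = 0} = F" by (rule cone_Int[OF FP cF v'(1) Fne(1)])
      ultimately show ?thesis by blast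
    qed
  qed
  then have "\<forall>F\<in>?S. \<exists>C. C \<in> ?T \<and> C \<inter> {x. v \<bullet> x = 0} = F" by (simp only: Bex_def Ball_def) simp
  from bchoice[OF this] obtain \<Phi> where
    \<Phi>: "\<forall>F\<in>?S. \<Phi> F \<in> ?T \<and> \<Phi> F \<inter> {x. v \<bullet> x = 0} = F" by (rule exE)
  have "inj_on \<Phi> ?S"
  proof (rule inj_onI)
    fix E F assume EF: "E \<in> ?S" "F \<in> ?S" "\<Phi> E = \<Phi> F"
    have "\<Phi> E \<inter> {x. v \<bullet> x = 0} = E" "\<Phi> F \<inter> {x. v \<bullet> x = 0} = F"
      by (rule conjunct2[OF bspec[OF \<Phi> EF(1)]], rule conjunct2[OF bspec[OF \<Phi> EF(2)]])
    then show "E = F" unfolding EF(3) by (rule trans[OF sym])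
  qed
  moreover have "\<Phi> ` ?S \<subseteq> ?T" by (rule image_subsetI) (rule conjunct1[OF bspec[OF \<Phi>]])
  moreover have "finite ?T" by (rule finite_subset[OF _ finite_hit_faces[OF polytope_bipyr]]) auto
  ultimately have "card ?S \<le> card ?T" by (rule card_inj_on_le)
  then show ?thesis unfolding f_num_central_section_eq[OF polytope_bipyr] by (simp add: f_num_def)
qed

end

text \<open>The factor 2 pays for the passage from vertices to facets.\<close>

definition rich :: "nat \<Rightarrow> nat \<Rightarrow> 'a::euclidean_space set \<Rightarrow> bool" where
  "rich N d P \<longleftrightarrow> (\<forall>i<d. N \<le> 2 * f_num i P) \<and>
     (\<forall>u i. (\<exists>x\<in>P. u \<bullet> x \<noteq> 0) \<longrightarrow> Suc i < d \<longrightarrow> N \<le> 2 * f_num i (central_section P u))"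

context bipyr_over
begin

text \<open>Faces of the base keep their dimension in the bipyramid, and cones over its facets
  supply the one new dimension. The same argument serves sections through the apices, which are
  bipyramids over sections; an oblique section inherits directly from the faces of the base.\<close>

lemma rich_bipyr:
  assumes d: "aff_dim P = int d" "2 \<le> d" and rich: "rich N d P"
  shows "rich N (Suc d) (bipyr v P)"
  unfolding rich_def
proof (intro conjI allI impI)
  have P: "N \<le> 2 * f_num i P" if "i < d" for i using rich that by (simp add: rich_def)
  fix i assume "i < Suc d"
  then consider "i < d" | j where "i = Suc j" "j < d" using d(2) by (cases i) (auto simp: less_Suc_eq)
  then show "N \<le> 2 * f_num i (bipyr v P)"
  proof cases
    case 1
    then show ?thesis using P[of i] f_num_bipyr_ge(1)[of i] d(1) by simp
  next
    case 2
    then show ?thesis using P[of j] f_num_bipyr_ge(2)[of j] d(1) by simp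
  qed
next
  fix u i assume u: "\<exists>x\<in>bipyr v P. u \<bullet> x \<noteq> 0" and i: "Suc i < Suc d"
  have P: "N \<le> 2 * f_num i P" if "i < d" for i using rich that by (simp add: rich_def)
  show "N \<le> 2 * f_num i (central_section (bipyr v P) u)"
  proof (cases "u \<bullet> v = 0")
    case True
    have uP: "\<exists>x\<in>P. u \<bullet> x \<noteq> 0"
    proof (rule ccontr)
      assume "\<not> (\<exists>x\<in>P. u \<bullet> x \<noteq> 0)"
      then have "P \<union> {v, - v} \<subseteq> {x. u \<bullet> x = 0}" using True by auto
      then have "bipyr v P \<subseteq> {x. u \<bullet> x = 0}" unfolding bipyr_def by (rule hull_minimal) (rule convex_hyperplane)
      then show False using u by blast
    qed
    have S: "N \<le> 2 * f_num i (central_section P u)" if "Suc i < d" for i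
      using rich uP that by (simp add: rich_def)
    have dim: "aff_dim (central_section P u) = int d - 1"
      using aff_dim_central_section[OF convex_P zero uP] d(1) by simp
    interpret sec: bipyr_over v "central_section P u" by (rule bipyr_over_central_section)
    \<comment> \<open>For \<open>i = 0\<close> the first case needs \<open>2 \<le> d\<close>, so
      that the section of the base has vertices strictly below its own dimension.\<close>
    consider "Suc i < d" | j where "i = Suc j" "Suc j < d" using i d(2) by (cases i) (auto simp: less_Suc_eq)
    then show ?thesis unfolding central_section_bipyr[OF True]
    proof cases
      case 1
      then show "N \<le> 2 * f_num i (bipyr v (central_section P u))"
        using S[of i] sec.f_num_bipyr_ge(1)[of i] dim by simp
    next
      case 2
      then show "N \<le> 2 * f_num i (bipyr v (central_section P u))"
        using S[of j] sec.f_num_bipyr_ge(2)[of j] dim by simp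
    qed
  next
    case False
    then show ?thesis using P[of i] f_num_oblique_section_bipyr_ge[of u i] i d(1) by simp
  qed
qed

end

section \<open>Shell polytopes\<close>

text \<open>Points of a sphere are exposed by themselves: \<open>x \<bullet> y = 1\<close> for unit
  vectors forces \<open>x = y\<close>.\<close>

lemma unit_vectors_extreme:
  fixes A :: "'a::euclidean_space set"
  assumes "compact A" "\<And>y. y \<in> A \<Longrightarrow> y \<bullet> y = 1" "x \<in> A"
  shows "x extreme_point_of convex hull A"
proof -
  have sq: "(x - y) \<bullet> (x - y) = 2 - 2 * (x \<bullet> y)" if "y \<in> A" for y
    using assms(2)[OF that] assms(2)[OF assms(3)] by (simp add: inner_diff_left inner_diff_right inner_commute)
  have le: "x \<bullet> y \<le> 1" if "y \<in> A" for y
    using sq[OF that] inner_ge_zero[of "x - y"] by linarith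
  have "{y \<in> A. x \<bullet> y = 1} = {x}"
  proof (intro equalityI subsetI)
    fix y assume "y \<in> {y \<in> A. x \<bullet> y = 1}"
    then have "(x - y) \<bullet> (x - y) = 0" using sq[of y] by simp
    then show "y \<in> {x}" by simp
  qed (use assms in auto)
  then show ?thesis
    using exposed_face_of_convex_hull[OF assms(1) le] by (simp add: face_of_singleton)
qed

lemma half_pi_split: "c > 0 \<Longrightarrow> c * (pi / (2 * c)) = pi / 2" for c :: real
  by simp

lemma
  fixes n i :: nat
  assumes "n \<ge> 3" "i \<in> {1..n - 1}"
  shows shell_angle_ge: "- (pi / 4) \<le> shell_angle n i" and shell_angle_le: "shell_angle n i \<le> pi / 4"
proof -
  have n: "real n - 2 > 0" using assms(1) by simp
  have i: "0 \<le> real i - 1" "real i - 1 \<le> real n - 2" using assms by auto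
  have "0 \<le> (real i - 1) * (pi / (2 * (real n - 2)))" using i n by simp
  then show "- (pi / 4) \<le> shell_angle n i" by (simp add: shell_angle_def)
  have "(real i - 1) * (pi / (2 * (real n - 2))) \<le> (real n - 2) * (pi / (2 * (real n - 2)))"
    using i n by (intro mult_right_mono) auto
  also have "\<dots> = pi / 2" by (rule half_pi_split[OF n])
  finally show "shell_angle n i \<le> pi / 4" unfolding shell_angle_def by linarith
qed

lemma shell_angle_first: "shell_angle n 1 = - (pi / 4)"
  by (simp add: shell_angle_def)

lemma shell_angle_last: "n \<ge> 3 \<Longrightarrow> shell_angle n (n - 1) = pi / 4"
proof -
  assume n: "n \<ge> 3"
  then have "real (n - 1) - 1 = real n - 2" by simp
  then have "(real (n - 1) - 1) * (pi / (2 * (real n - 2))) = pi / 2"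
    using half_pi_split[of "real n - 2"] n by (simp only:)
  then show ?thesis unfolding shell_angle_def by linarith
qed

lemma strict_mono_on_shell_angle:
  assumes "n \<ge> 3" shows "strict_mono_on {1..n - 1} (shell_angle n)"
proof (rule strict_mono_onI)
  fix i j :: nat assume "i < j"
  then have "(real i - 1) * (pi / (2 * (real n - 2))) < (real j - 1) * (pi / (2 * (real n - 2)))"
    using assms by (intro mult_strict_right_mono) auto
  then show "shell_angle n i < shell_angle n j" by (simp add: shell_angle_def)
qed

definition arc_pt :: "nat \<Rightarrow> 'a::euclidean_space \<Rightarrow> 'a \<Rightarrow> nat \<Rightarrow> 'a" where
  "arc_pt n p r i = sin (shell_angle n i) *\<^sub>R p + cos (shell_angle n i) *\<^sub>R r"

text \<open>With the orthonormal frame as a parameter, exchanging the two arcs is the substitution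
  of \<open>q\<close>, \<open>p\<close>, \<open>- r\<close> for \<open>p\<close>, \<open>q\<close>,
  \<open>r\<close>, so facts about one arc transfer to the other.\<close>

definition shell :: "nat \<Rightarrow> 'a::euclidean_space \<Rightarrow> 'a \<Rightarrow> 'a \<Rightarrow> 'a set" where
  "shell n p q r = convex hull (arc_pt n p r ` {1..n - 1} \<union> arc_pt n q (- r) ` {1..n - 1})"

lemma shell_polytope_eq: "shell_polytope e n = shell n (e 0) (e 1) (e 2)"
  unfolding shell_polytope_def shell_def arc_pt_def by simp

lemma shell_swap: "shell n q p (- r) = shell n p q r"
  unfolding shell_def by (simp add: Un_commute)

lemma inner_arc_pt: "a \<bullet> arc_pt n p r i = sin (shell_angle n i) * (a \<bullet> p) + cos (shell_angle n i) * (a \<bullet> r)"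
  by (simp add: arc_pt_def inner_add_right)

text \<open>A linear functional that peaks strictly inside the arc increases towards its apex.\<close>

lemma interior_peak_pos:
  fixes a b c \<theta> :: real
  assumes "a * sin \<theta> + c * cos \<theta> = b" "b > 0" "\<bar>sin \<theta>\<bar> < sqrt 2 / 2" "cos \<theta> \<ge> sqrt 2 / 2"
    and "a + c \<le> sqrt 2 * b" "- a + c \<le> sqrt 2 * b"
  shows "c > 0"
proof (rule ccontr)
  assume "\<not> c > 0"
  then have c: "c \<le> 0" by simp
  \<comment> \<open>With \<open>c \<le> 0\<close>, lowering \<open>cos \<theta>\<close> to
    \<open>\<bar>sin \<theta>\<bar>\<close> only enlarges the value; the bounds at the two ends of
    the arc then yield \<open>b < b\<close>.\<close>
  have "a * sin \<theta> \<le> \<bar>a\<bar> * \<bar>sin \<theta>\<bar>" by (metis abs_ge_self abs_mult)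
  moreover have "c * cos \<theta> \<le> c * \<bar>sin \<theta>\<bar>" using c assms(3,4) by (intro mult_left_mono_neg) auto
  ultimately have "b \<le> (\<bar>a\<bar> + c) * \<bar>sin \<theta>\<bar>" using assms(1) by (simp add: algebra_simps)
  moreover have "(\<bar>a\<bar> + c) * \<bar>sin \<theta>\<bar> \<le> sqrt 2 * b * \<bar>sin \<theta>\<bar>"
    using assms(5,6) by (intro mult_right_mono) auto
  moreover have "sqrt 2 * b * \<bar>sin \<theta>\<bar> < sqrt 2 * b * (sqrt 2 / 2)"
    using assms(2,3) by (intro mult_strict_left_mono) auto
  moreover have "sqrt 2 * b * (sqrt 2 / 2) = b" by simp
  ultimately show False by linarith
qed

locale shell_frame =
  fixes p q r :: "'a::euclidean_space" and n :: nat
  assumes pp: "p \<bullet> p = 1" and qq: "q \<bullet> q = 1" and rr: "r \<bullet> r = 1"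
    and pq: "p \<bullet> q = 0" and pr: "p \<bullet> r = 0" and qr: "q \<bullet> r = 0" and n3: "n \<ge> 3"
begin

lemma qp: "q \<bullet> p = 0" and rp: "r \<bullet> p = 0" and rq: "r \<bullet> q = 0"
  using pq pr qr by (simp_all add: inner_commute)

lemmas frame = pp qq rr pq pr qr qp rp rq

abbreviation vs where "vs \<equiv> arc_pt n p r"
abbreviation ws where "ws \<equiv> arc_pt n q (- r)"
abbreviation I where "I \<equiv> {1..n - 1}"
abbreviation th where "th \<equiv> shell_angle n"

lemma shell_frame_swap: "shell_frame q p (- r) n"
  by standard (use pp qq rr pq pr qr n3 in \<open>auto simp: inner_commute\<close>)

lemma ends: "1 \<in> I" "n - 1 \<in> I"
  using n3 by auto

lemma sin_ends: "sin (th 1) = - (sqrt 2 / 2)" "sin (th (n - 1)) = sqrt 2 / 2"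
  "cos (th 1) = sqrt 2 / 2" "cos (th (n - 1)) = sqrt 2 / 2"
  unfolding shell_angle_first shell_angle_last[OF n3] by (simp_all add: sin_45 cos_45)

lemma sin_th_less:
  assumes "i \<in> I" "j \<in> I" "i < j" shows "sin (th i) < sin (th j)"
proof (rule sin_monotone_2pi)
  show "th i < th j" by (rule strict_mono_onD[OF strict_mono_on_shell_angle[OF n3] assms])
  show "- (pi / 2) \<le> th i" using shell_angle_ge[OF n3 assms(1)] pi_gt_zero by linarith
  show "th j \<le> pi / 2" using shell_angle_le[OF n3 assms(2)] pi_gt_zero by linarith
qed

lemma gens_ends:
  "vs 1 = (sqrt 2 / 2) *\<^sub>R (r - p)" "vs (n - 1) = (sqrt 2 / 2) *\<^sub>R (r + p)"
  "ws 1 = (sqrt 2 / 2) *\<^sub>R (- r - q)" "ws (n - 1) = (sqrt 2 / 2) *\<^sub>R (q - r)"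
  unfolding arc_pt_def sin_ends by (simp_all add: scaleR_diff_right scaleR_add_right)

lemma sin_th_bounds: "i \<in> I \<Longrightarrow> - (sqrt 2 / 2) \<le> sin (th i) \<and> sin (th i) \<le> sqrt 2 / 2"
  using sin_th_less[OF ends(1), of i] sin_th_less[OF _ ends(2), of i] sin_ends
  by (cases "i = 1"; cases "i = n - 1") auto

lemma sin_th_eq_end: 
  assumes "i \<in> I" shows "sin (th i) = sqrt 2 / 2 \<longleftrightarrow> i = n - 1" "sin (th i) = - (sqrt 2 / 2) \<longleftrightarrow> i = 1"
  using sin_th_less[OF ends(1), of i] sin_th_less[OF _ ends(2), of i] sin_ends assms
  by (cases "i = 1"; cases "i = n - 1"; force)+

lemma cos_th_ge: "i \<in> I \<Longrightarrow> cos (th i) \<ge> sqrt 2 / 2"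
proof -
  assume i: "i \<in> I"
  have "\<bar>th i\<bar> \<le> pi / 4" using shell_angle_ge[OF n3 i] shell_angle_le[OF n3 i] by (auto simp: abs_le_iff)
  then have "cos (pi / 4) \<le> cos (th i)"
    using cos_le_cos_abs[of "pi / 4" "th i"] pi_gt_zero by simp
  then show ?thesis by (simp add: cos_45)
qed

lemma cos_th_pos: "i \<in> I \<Longrightarrow> cos (th i) > 0"
  by (rule less_le_trans[OF _ cos_th_ge]) simp_all

lemma inj_vs: "inj_on vs I"
proof (rule inj_onI)
  fix i j assume ij: "i \<in> I" "j \<in> I" "vs i = vs j"
  then have "p \<bullet> vs i = p \<bullet> vs j" by simp
  then have "sin (th i) = sin (th j)" by (simp add: inner_arc_pt pp pr)
  then show "i = j" using sin_th_less[OF ij(1,2)] sin_th_less[OF ij(2,1)] by force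
qed

lemma vs_neq_ws: "i \<in> I \<Longrightarrow> j \<in> I \<Longrightarrow> vs i \<noteq> ws j"
proof
  assume ij: "i \<in> I" "j \<in> I" "vs i = ws j"
  then have "r \<bullet> vs i = r \<bullet> ws j" by simp
  then have "cos (th i) = - cos (th j)" by (simp add: inner_arc_pt frame)
  then show False using cos_th_pos[OF ij(1)] cos_th_pos[OF ij(2)] by simp
qed

lemma unit_gens: "y \<in> vs ` I \<union> ws ` I \<Longrightarrow> y \<bullet> y = 1"
  by (auto simp: arc_pt_def inner_add_left inner_add_right inner_diff_left inner_diff_right frame power2_eq_square[symmetric] simp flip: distrib_left)

lemma compact_shell_gens: "compact (vs ` I \<union> ws ` I)"
  by (intro finite_imp_compact) simp

lemma polytope_shell: "polytope (shell n p q r)"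
  unfolding shell_def by (intro polytope_convex_hull) simp

lemma gens_in_shell: "i \<in> I \<Longrightarrow> vs i \<in> shell n p q r" "i \<in> I \<Longrightarrow> ws i \<in> shell n p q r"
  unfolding shell_def by (auto intro: hull_inc)

lemma inner_end_points:
  "a \<bullet> vs 1 = sqrt 2 / 2 * (- (a \<bullet> p) + a \<bullet> r)" "a \<bullet> vs (n - 1) = sqrt 2 / 2 * (a \<bullet> p + a \<bullet> r)"
  "a \<bullet> ws 1 = sqrt 2 / 2 * (- (a \<bullet> q) - a \<bullet> r)" "a \<bullet> ws (n - 1) = sqrt 2 / 2 * (a \<bullet> q - a \<bullet> r)"
  unfolding gens_ends by (simp_all add: inner_add_right inner_diff_right)

lemma zero_on_gens: 
  assumes "a \<bullet> p = 0" "a \<bullet> q = 0" "a \<bullet> r = 0" "x \<in> shell n p q r" shows "a \<bullet> x = 0"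
proof -
  have "shell n p q r \<subseteq> {x. a \<bullet> x = 0}"
    unfolding shell_def by (rule hull_minimal) (use assms(1-3) in \<open>auto simp: inner_arc_pt convex_hyperplane\<close>)
  then show ?thesis using assms(4) by blast
qed

lemma convex_shell: "convex (shell n p q r)"
  by (simp add: shell_def)

lemma zero_in_shell: "0 \<in> shell n p q r"
proof -
  have m: "midpoint x y \<in> shell n p q r" if "x \<in> shell n p q r" "y \<in> shell n p q r" for x y
    using convexD[OF convex_shell that, of "1/2" "1/2"] by (simp add: midpoint_def scaleR_add_right)
  \<comment> \<open>The chords joining the ends of the two arcs have midpoints
    \<open>(sqrt 2 / 2) *\<^sub>R r\<close> and its negative.\<close>
  have "midpoint (midpoint (vs 1) (vs (n - 1))) (midpoint (ws 1) (ws (n - 1))) = 0"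
    unfolding gens_ends by (simp add: midpoint_def algebra_simps)
  then show ?thesis using m gens_in_shell ends by metis
qed

lemma zero_rel_interior_shell: "0 \<in> rel_interior (shell n p q r)"
proof (rule rel_interiorI_minimizers[OF convex_shell zero_in_shell])
  fix a x assume a: "\<And>x. x \<in> shell n p q r \<Longrightarrow> a \<bullet> 0 \<le> a \<bullet> x" and x: "x \<in> shell n p q r"
  have "0 \<le> a \<bullet> vs 1" "0 \<le> a \<bullet> vs (n - 1)" "0 \<le> a \<bullet> ws 1" "0 \<le> a \<bullet> ws (n - 1)"
    using a gens_in_shell ends by auto
  \<comment> \<open>With \<open>c\<close> the value at \<open>r\<close>, the first arc gives that
    \<open>c\<close> is at least the absolute value at \<open>p\<close>, the second that
    \<open>- c\<close> is at least the absolute value at \<open>q\<close>; so all three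
    vanish.\<close>
  then have "a \<bullet> p = 0 \<and> a \<bullet> q = 0 \<and> a \<bullet> r = 0"
    unfolding inner_end_points by (auto simp: zero_le_mult_iff)
  then show "a \<bullet> x = a \<bullet> 0" using zero_on_gens[OF _ _ _ x] by simp
qed

lemma span_shell: "span (shell n p q r) = span {p, q, r}"
proof (rule span_eq[THEN iffD2], intro conjI)
  have "vs i \<in> span {p, q, r}" "ws i \<in> span {p, q, r}" for i
    unfolding arc_pt_def by (intro span_add span_scale span_neg; simp add: span_base span_neg)+
  then have "vs ` I \<union> ws ` I \<subseteq> span {p, q, r}" by blast
  then show "shell n p q r \<subseteq> span {p, q, r}"
    unfolding shell_def by (rule hull_minimal) (simp add: subspace_imp_convex)
  let ?S = "span (shell n p q r)"
  have m: "vs 1 \<in> ?S" "vs (n - 1) \<in> ?S" "ws 1 \<in> ?S" "ws (n - 1) \<in> ?S"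
    using gens_in_shell ends by (auto intro: span_base)
  have "(sqrt 2 / 2) *\<^sub>R (vs (n - 1) - vs 1) \<in> ?S" "(sqrt 2 / 2) *\<^sub>R (vs (n - 1) + vs 1) \<in> ?S"
    "(sqrt 2 / 2) *\<^sub>R (ws (n - 1) - ws 1) \<in> ?S"
    by (intro span_scale span_add span_diff m)+
  moreover have "(sqrt 2 / 2) *\<^sub>R (vs (n - 1) - vs 1) = p" "(sqrt 2 / 2) *\<^sub>R (vs (n - 1) + vs 1) = r"
    "(sqrt 2 / 2) *\<^sub>R (ws (n - 1) - ws 1) = q"
    unfolding gens_ends by (simp_all flip: scaleR_diff_right scaleR_add_right)
  ultimately show "{p, q, r} \<subseteq> ?S" by simp
qed

lemma extreme_gens: "x \<in> vs ` I \<union> ws ` I \<Longrightarrow> x extreme_point_of shell n p q r"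
  unfolding shell_def by (rule unit_vectors_extreme[OF compact_shell_gens unit_gens])

text \<open>The direction \<open>q\<close> is orthogonal to the plane of the first arc, so its
  coefficient can be tuned without disturbing the peak at \<open>vs i\<close>, until the second arc
  reaches the same height exactly at its end \<open>ws k\<close>.\<close>

lemma edge_vs_end:
  assumes i: "i \<in> I" and k: "k \<in> {1, n - 1}"
  shows "convex hull {vs i, ws k} face_of shell n p q r"
proof -
  \<comment> \<open>The sign selects the end: \<open>\<sigma> * sin (th j)\<close> is largest at
    \<open>j = k\<close> and nowhere else.\<close>
  define \<sigma> :: real where "\<sigma> = (if k = n - 1 then 1 else - 1)"
  have kI: "k \<in> I" using k ends by auto
  have \<sigma>: "\<sigma> * sin (th j) \<le> sqrt 2 / 2 \<and> (\<sigma> * sin (th j) = sqrt 2 / 2 \<longleftrightarrow> j = k)" if "j \<in> I" for j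
    using sin_th_bounds[OF that] sin_th_eq_end[OF that] k by (auto simp: \<sigma>_def)
  \<comment> \<open>In the plane of \<open>p\<close> and \<open>r\<close> this is
    \<open>vs i\<close> itself, with value 1 at its peak. The \<open>q\<close>-coefficient solves
    the equation that the value at \<open>ws k\<close> is 1, where sine and cosine are
    \<open>sqrt 2 / 2\<close> up to sign.\<close>
  define a where "a = sin (th i) *\<^sub>R p + (\<sigma> * (sqrt 2 + cos (th i))) *\<^sub>R q + cos (th i) *\<^sub>R r"
  have av: "a \<bullet> vs j = cos (th i - th j)" for j
    by (simp add: a_def inner_arc_pt inner_add_left frame cos_diff)
  have aw: "a \<bullet> ws j = (sqrt 2 + cos (th i)) * (\<sigma> * sin (th j)) - cos (th i) * cos (th j)" for j
    by (simp add: a_def inner_arc_pt inner_add_left frame)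
  have bv: "a \<bullet> vs j \<le> 1 \<and> (a \<bullet> vs j = 1 \<longleftrightarrow> j = i)" if j: "j \<in> I" for j
  proof -
    have "\<bar>th i - th j\<bar> \<le> pi"
      using shell_angle_ge[OF n3 i] shell_angle_le[OF n3 i] shell_angle_ge[OF n3 j] shell_angle_le[OF n3 j]
      by (auto simp: abs_le_iff)
    then have "cos (th i - th j) = 1 \<longleftrightarrow> th i = th j"
      using cos_le_cos_abs[of 0 "th i - th j"] by auto
    also have "\<dots> \<longleftrightarrow> j = i"
      using strict_mono_on_eqD[OF strict_mono_on_shell_angle[OF n3] _ j i] by auto
    finally show ?thesis by (simp add: av)
  qed
  have bw: "a \<bullet> ws j \<le> 1 \<and> (a \<bullet> ws j = 1 \<longleftrightarrow> j = k)" if j: "j \<in> I" for j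
  proof -
    have c: "cos (th i) > 0" by (rule cos_th_pos[OF i])
    have 1: "cos (th i) * (sqrt 2 / 2) \<le> cos (th i) * cos (th j)"
      using c cos_th_ge[OF j] by (intro mult_left_mono) auto
    have 2: "(sqrt 2 + cos (th i)) * (\<sigma> * sin (th j)) \<le> (sqrt 2 + cos (th i)) * (sqrt 2 / 2)"
      using c \<sigma>[OF j] by (intro mult_left_mono) auto
    have 3: "(sqrt 2 + cos (th i)) * (sqrt 2 / 2) - cos (th i) * (sqrt 2 / 2) = 1"
      by (simp add: algebra_simps)
    have "j = k" if "a \<bullet> ws j = 1"
    proof -
      have "(sqrt 2 + cos (th i)) * (\<sigma> * sin (th j)) = (sqrt 2 + cos (th i)) * (sqrt 2 / 2)"
        using 1 2 3 that unfolding aw by linarith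
      moreover have "sqrt 2 + cos (th i) > 0" using c by (simp add: add_pos_pos)
      ultimately have "\<sigma> * sin (th j) = sqrt 2 / 2" by simp
      then show ?thesis using \<sigma>[OF j] by blast
    qed
    moreover have "a \<bullet> ws j = 1" if "j = k"
    proof -
      have "cos (th j) = sqrt 2 / 2" using that k sin_ends by auto
      moreover have "\<sigma> * sin (th j) = sqrt 2 / 2" using \<sigma>[OF j] that by blast
      ultimately show ?thesis using 3 unfolding aw by (simp only:)
    qed
    ultimately show ?thesis using 1 2 3 unfolding aw by linarith
  qed
  have "{x \<in> vs ` I \<union> ws ` I. a \<bullet> x = 1} = {vs i, ws k}"
    using bv bw i kI by auto
  moreover have "a \<bullet> x \<le> 1" if "x \<in> vs ` I \<union> ws ` I" for x using that bv bw by auto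
  ultimately show ?thesis
    using exposed_face_of_convex_hull[OF compact_shell_gens, of a 1] unfolding shell_def by simp
qed

text \<open>The empty set stands for faces that contain no point of the arc in question.\<close>

definition arc_faces :: "nat set set" where
  "arc_faces = {{}} \<union> (\<lambda>i. {i}) ` I \<union> (\<lambda>i. {i, i + 1}) ` I"

lemma finite_arc_faces: "finite arc_faces"
  by (simp add: arc_faces_def)

lemma card_arc_faces: "card arc_faces \<le> 2 * n - 1"
proof -
  have "card arc_faces \<le> card ({{}} \<union> (\<lambda>i. {i}) ` I) + card ((\<lambda>i. {i, i + 1}) ` I)"
    unfolding arc_faces_def by (rule card_Un_le)
  also have "\<dots> \<le> (card {{} :: nat set} + card ((\<lambda>i. {i}) ` I)) + card ((\<lambda>i. {i, i + 1}) ` I)"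
    by (intro add_mono card_Un_le order_refl)
  also have "\<dots> \<le> (1 + card I) + card I"
    by (intro add_mono card_image_le) auto
  also have "\<dots> = 2 * n - 1" using n3 by simp
  finally show ?thesis .
qed

lemma arc_argmax:
  assumes "b > 0" "\<And>i. i \<in> I \<Longrightarrow> w \<bullet> vs i \<le> b"
  shows "{i \<in> I. w \<bullet> vs i = b} \<in> arc_faces"
proof (cases "{i \<in> I. w \<bullet> vs i = b} = {}")
  case False
  have diam: "th (n - 1) - th 1 < pi"
    unfolding shell_angle_first shell_angle_last[OF n3] using pi_gt_zero by linarith
  let ?f = "\<lambda>i. (w \<bullet> r) * cos (th i) + (w \<bullet> p) * sin (th i)"
  have f: "w \<bullet> vs i = ?f i" for i by (simp add: inner_arc_pt)
  have le: "?f i \<le> b" if "i \<in> I" for i using assms(2)[OF that] f by simp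
  have ne: "{i \<in> I. ?f i = b} \<noteq> {}" using False f by simp
  obtain i where "i \<in> I" "{i \<in> I. ?f i = b} = {i} \<or> i + 1 \<in> I \<and> {i \<in> I. ?f i = b} = {i, i + 1}"
    using sinusoid_argmax_adjacent[OF strict_mono_on_shell_angle[OF n3] diam le assms(1) _ ne] by auto
  then show ?thesis unfolding f arc_faces_def by auto
qed (simp add: arc_faces_def)

text \<open>The role of the quarter-circle arcs: a peak strictly inside this arc needs a functional
  pointing towards \<open>r\<close>, while one inside the other arc needs it to point towards
  \<open>- r\<close>.\<close>

lemma interior_peak:
  assumes "b > 0" "\<And>i. i \<in> I \<Longrightarrow> w \<bullet> vs i \<le> b" "i \<in> I" "i \<notin> {1, n - 1}" "w \<bullet> vs i = b"
  shows "w \<bullet> r > 0"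
proof (rule interior_peak_pos[of "w \<bullet> p" "th i" "w \<bullet> r" b])
  show "w \<bullet> p * sin (th i) + w \<bullet> r * cos (th i) = b" using assms(5) by (simp add: inner_arc_pt mult.commute)
  show "\<bar>sin (th i)\<bar> < sqrt 2 / 2"
    using sin_th_bounds[OF assms(3)] sin_th_eq_end[OF assms(3)] assms(4) by (auto simp: abs_less_iff less_le)
  show "cos (th i) \<ge> sqrt 2 / 2" by (rule cos_th_ge[OF assms(3)])
  have s: "x \<le> sqrt 2 * b" if "sqrt 2 / 2 * x \<le> b" for x
  proof -
    have "sqrt 2 * (sqrt 2 / 2 * x) \<le> sqrt 2 * b" using that by (intro mult_left_mono) auto
    moreover have "sqrt 2 * (sqrt 2 / 2 * x) = x" by simp
    ultimately show ?thesis by (simp only:)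
  qed
  show "w \<bullet> p + w \<bullet> r \<le> sqrt 2 * b" by (rule s) (use assms(2)[OF ends(2)] in \<open>simp only: inner_end_points\<close>)
  show "- (w \<bullet> p) + w \<bullet> r \<le> sqrt 2 * b" by (rule s) (use assms(2)[OF ends(1)] in \<open>simp only: inner_end_points\<close>)
qed (rule assms(1))

lemma swap_arc_argmax:
  assumes "b > 0" "\<And>i. i \<in> I \<Longrightarrow> w \<bullet> ws i \<le> b"
  shows "{i \<in> I. w \<bullet> ws i = b} \<in> arc_faces"
proof -
  interpret swap: shell_frame q p "- r" n by (rule shell_frame_swap)
  have "swap.arc_faces = arc_faces" by (simp add: arc_faces_def swap.arc_faces_def)
  then show ?thesis using swap.arc_argmax[OF assms] by simp
qed

lemma swap_interior_peak:
  assumes "b > 0" "\<And>i. i \<in> I \<Longrightarrow> w \<bullet> ws i \<le> b" "i \<in> I" "i \<notin> {1, n - 1}" "w \<bullet> ws i = b"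
  shows "w \<bullet> r < 0"
proof -
  interpret swap: shell_frame q p "- r" n by (rule shell_frame_swap)
  show ?thesis using swap.interior_peak[OF assms] by simp
qed

text \<open>\<open>A\<close> and \<open>B\<close> are the sets of indices at which the exposing
  functional peaks on the two arcs. Interior peaks on both would demand opposite signs of
  \<open>w \<bullet> r\<close>. The description of \<open>A\<close> by membership in
  \<open>F\<close> is kept for counting the arc points on a facet.\<close>

lemma face_of_shell_cases:
  assumes "F face_of shell n p q r" "F \<noteq> {}" "F \<noteq> shell n p q r"
  obtains A B where "A \<in> arc_faces" "B \<in> arc_faces" "A \<subseteq> {1, n - 1} \<or> B \<subseteq> {1, n - 1}"
    "F = convex hull (vs ` A \<union> ws ` B)" "A = {i \<in> I. vs i \<in> F}"
proof -
  obtain w b where b: "b > 0" and le: "\<And>y. y \<in> shell n p q r \<Longrightarrow> w \<bullet> y \<le> b"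
    and F: "F = {y \<in> shell n p q r. w \<bullet> y = b}"
    using proper_face_exposed[OF polytope_shell zero_rel_interior_shell assms(1,3,2)] by metis
  define A where "A = {i \<in> I. w \<bullet> vs i = b}"
  define B where "B = {i \<in> I. w \<bullet> ws i = b}"
  have lev: "w \<bullet> vs i \<le> b" "w \<bullet> ws i \<le> b" if "i \<in> I" for i using le gens_in_shell[OF that] by auto
  have "F = convex hull (F \<inter> (vs ` I \<union> ws ` I))"
    using face_of_convex_hull_eq[OF compact_shell_gens] assms(1) unfolding shell_def by blast
  also have "F \<inter> (vs ` I \<union> ws ` I) = vs ` A \<union> ws ` B"
    unfolding F A_def B_def using gens_in_shell by blast
  finally have FAB: "F = convex hull (vs ` A \<union> ws ` B)" .
  have "A \<in> arc_faces" unfolding A_def by (rule arc_argmax[OF b lev(1)])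
  moreover have "B \<in> arc_faces" unfolding B_def by (rule swap_arc_argmax[OF b lev(2)])
  moreover have "A \<subseteq> {1, n - 1} \<or> B \<subseteq> {1, n - 1}"
  proof (rule ccontr)
    assume "\<not> ?thesis"
    then obtain i j where ij: "i \<in> A" "i \<notin> {1, n - 1}" "j \<in> B" "j \<notin> {1, n - 1}" by blast
    have "w \<bullet> r > 0" by (rule interior_peak[OF b lev(1) _ ij(2)]) (use ij(1) in \<open>simp_all add: A_def\<close>)
    moreover have "w \<bullet> r < 0" by (rule swap_interior_peak[OF b lev(2) _ ij(4)]) (use ij(3) in \<open>simp_all add: B_def\<close>)
    ultimately show False by simp
  qed
  moreover have "A = {i \<in> I. vs i \<in> F}" unfolding A_def F using gens_in_shell by blast
  ultimately show thesis using that FAB by blast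
qed

text \<open>Linear and not quadratic in \<open>n\<close>, because one of the two index sets is
  always among the four subsets of the end indices, and each arc offers at most
  \<open>2 * n - 1\<close> choices for the other.\<close>

lemma card_faces_shell: "card {F. F face_of shell n p q r} \<le> 16 * n"
proof -
  let ?f = "\<lambda>(A, B). convex hull (vs ` A \<union> ws ` B)"
  let ?E = "Pow {1, n - 1}"
  have "{F. F face_of shell n p q r} \<subseteq> {{}, shell n p q r} \<union> ?f ` (?E \<times> arc_faces) \<union> ?f ` (arc_faces \<times> ?E)"
  proof
    fix F assume "F \<in> {F. F face_of shell n p q r}"
    then have F: "F face_of shell n p q r" by blast
    show "F \<in> {{}, shell n p q r} \<union> ?f ` (?E \<times> arc_faces) \<union> ?f ` (arc_faces \<times> ?E)"
    proof (cases "F = {} \<or> F = shell n p q r")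
      case False
      then obtain A B where "A \<in> arc_faces" "B \<in> arc_faces" "A \<subseteq> {1, n - 1} \<or> B \<subseteq> {1, n - 1}"
        "F = convex hull (vs ` A \<union> ws ` B)"
        using face_of_shell_cases[OF F] by metis
      then have "F = ?f (A, B)" "(A, B) \<in> ?E \<times> arc_faces \<or> (A, B) \<in> arc_faces \<times> ?E" by auto
      then show ?thesis by blast
    qed blast
  qed
  then have "card {F. F face_of shell n p q r} \<le>
      card ({{}, shell n p q r} \<union> ?f ` (?E \<times> arc_faces) \<union> ?f ` (arc_faces \<times> ?E))"
    using finite_arc_faces by (intro card_mono) auto
  also have "\<dots> \<le> card {{}, shell n p q r} + card (?f ` (?E \<times> arc_faces)) + card (?f ` (arc_faces \<times> ?E))"
    by (meson add_le_mono card_Un_le le_refl le_trans)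
  also have "\<dots> \<le> 2 + card (?E \<times> arc_faces) + card (arc_faces \<times> ?E)"
    using finite_arc_faces by (intro add_mono card_image_le) (auto simp: card_insert_if)
  also have "\<dots> \<le> 2 + 4 * (2 * n - 1) + (2 * n - 1) * 4"
  proof -
    have "card ?E \<le> 4" by (simp add: card_Pow card_insert_if)
    then have "card ?E * card arc_faces \<le> 4 * (2 * n - 1)" using card_arc_faces by (rule mult_le_mono)
    then show ?thesis by (simp add: card_cartesian_product mult.commute)
  qed
  also have "\<dots> \<le> 16 * n" using n3 by simp
  finally show ?thesis .
qed

lemma dim_shell: "aff_dim (shell n p q r) = 3"
proof -
  have ne: "p \<noteq> q" "p \<noteq> r" "q \<noteq> r" using frame by auto
  have "pairwise orthogonal {p, q, r}"
    using frame by (auto simp: pairwise_def orthogonal_def)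
  moreover have "0 \<notin> {p, q, r}" using frame by auto
  ultimately have "independent {p, q, r}" by (rule pairwise_orthogonal_independent)
  then have "dim (span {p, q, r}) = 3" using ne by (simp add: dim_eq_card_independent)
  then have "dim (shell n p q r) = 3" using span_shell dim_span by metis
  moreover have "0 \<in> affine hull (shell n p q r)" by (rule hull_inc[OF zero_in_shell])
  ultimately show ?thesis by (simp add: aff_dim_zero)
qed

section \<open>Face numbers of the shell polytope and of its central sections\<close>

lemma finite_faces: "finite {F. F face_of shell n p q r}"
  by (rule finite_polytope_faces[OF polytope_shell])

lemma f_num_shell_0: "n - 1 \<le> f_num 0 (shell n p q r)"
proof -
  have fin: "finite {x. x extreme_point_of shell n p q r}"
    using finite_polyhedron_extreme_points polytope_imp_polyhedron[OF polytope_shell] by blast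
  have "card (vs ` I) \<le> card {x. x extreme_point_of shell n p q r}"
    using extreme_gens by (intro card_mono[OF fin]) auto
  then show ?thesis using card_image[OF inj_vs] by (simp add: f_num_0)
qed

text \<open>All generators are extreme points of the shell, so an edge contains no generator besides
  its two ends. Edges can thus be indexed by their point on the arc.\<close>

lemma edge_contains_vs:
  assumes "i \<in> I" "j \<in> I" "k \<in> I" "vs j \<in> convex hull {vs i, ws k}"
  shows "j = i"
proof -
  have "vs j extreme_point_of shell n p q r" using extreme_gens assms by blast
  moreover have "convex hull {vs i, ws k} \<subseteq> shell n p q r"
    unfolding shell_def by (rule hull_mono) (use assms in auto)
  ultimately have "vs j extreme_point_of convex hull {vs i, ws k}"
    using assms(4) unfolding extreme_point_of_def by blast
  then have "vs j \<in> {vs i, ws k}" by (rule extreme_point_of_convex_hull)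
  then show ?thesis using vs_neq_ws assms inj_onD[OF inj_vs, of j i] by auto
qed

lemma aff_dim_edge: "i \<in> I \<Longrightarrow> k \<in> I \<Longrightarrow> aff_dim (convex hull {vs i, ws k}) = 1"
  using vs_neq_ws[of i k] by (simp add: aff_dim_convex_hull aff_dim_2)

lemma f_num_shell_1: "n - 1 \<le> f_num 1 (shell n p q r)"
proof -
  let ?e = "\<lambda>i. convex hull {vs i, ws 1}"
  have "inj_on ?e I"
  proof (rule inj_onI)
    fix i j assume ij: "i \<in> I" "j \<in> I" "?e i = ?e j"
    have "vs i \<in> ?e i" by (auto intro: hull_inc)
    then show "i = j" using edge_contains_vs[OF ij(2,1) ends(1)] ij(3) by metis
  qed
  moreover have "?e ` I \<subseteq> {F. F face_of shell n p q r \<and> aff_dim F = int 1}"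
    using edge_vs_end aff_dim_edge[OF _ ends(1)] by auto
  moreover have "finite {F. F face_of shell n p q r \<and> aff_dim F = int 1}"
    by (rule finite_subset[OF _ finite_faces]) auto
  ultimately have "card I \<le> f_num 1 (shell n p q r)"
    unfolding f_num_def by (rule card_inj_on_le)
  then show ?thesis by simp
qed

text \<open>Facets are counted through the points of one arc, of which a facet contains at most
  two.\<close>

lemma f_num_shell_2: "n - 1 \<le> 2 * f_num 2 (shell n p q r)"
proof -
  have "card (vs ` I) \<le> 2 * card {F. F facet_of shell n p q r}"
  proof (rule card_facets_ge[OF polytope_shell])
    fix F assume "F facet_of shell n p q r"
    then have F: "F face_of shell n p q r" "F \<noteq> {}" "F \<noteq> shell n p q r"
      by (auto simp: facet_of_def)
    then obtain A B where A: "A \<in> arc_faces" "A = {i \<in> I. vs i \<in> F}"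
      using face_of_shell_cases[OF F] by metis
    have "F \<inter> vs ` I = vs ` A" using A(2) by blast
    then have "card (F \<inter> vs ` I) \<le> card A" using A(2) by (simp add: card_image_le)
    also have "\<dots> \<le> 2" using A(1) by (auto simp: arc_faces_def card_insert_if)
    finally show "card (F \<inter> vs ` I) \<le> 2" .
  qed (use dim_shell extreme_gens in auto)
  then show ?thesis using card_image[OF inj_vs] f_num_facets[of "shell n p q r" 2] dim_shell by simp
qed

text \<open>Each point of the arc contributes a vertex of the section: itself, or a point of an edge that joins
  it to an end of the other arc.\<close>

lemma section_vertices_ge:
  assumes hit: "\<And>i. i \<in> I \<Longrightarrow> u \<bullet> vs i = 0 \<or> (\<exists>k\<in>{1, n - 1}. (u \<bullet> vs i) * (u \<bullet> ws k) < 0)"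
  shows "n - 1 \<le> f_num 0 (central_section (shell n p q r) u)"
proof -
  let ?H = "{x. u \<bullet> x = 0}"
  let ?T = "{F \<in> hit_faces (shell n p q r) ?H. aff_dim (F \<inter> ?H) = int 0}"
  \<comment> \<open>That \<open>C\<close> contains \<open>vs i\<close> and no other point of the arc
    makes the later choice injective.\<close>
  have "\<exists>C. C \<in> ?T \<and> (\<forall>j\<in>I. vs j \<in> C \<longleftrightarrow> j = i)" if i: "i \<in> I" for i
  proof (cases "u \<bullet> vs i = 0")
    case True
    have "{vs i} face_of shell n p q r" using extreme_gens i by (simp add: face_of_singleton)
    moreover have "{vs i} \<inter> ?H = {vs i}" using True by blast
    ultimately have "{vs i} \<in> ?T" by (simp add: hit_faces_def)
    moreover have "\<forall>j\<in>I. vs j \<in> {vs i} \<longleftrightarrow> j = i" using inj_onD[OF inj_vs] i by blast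
    ultimately show ?thesis by blast
  next
    case False
    then obtain k where k: "k \<in> {1, n - 1}" "(u \<bullet> vs i) * (u \<bullet> ws k) < 0" using hit[OF i] by blast
    have kI: "k \<in> I" using k(1) ends by auto
    let ?C = "convex hull {vs i, ws k}"
    define t where "t = (u \<bullet> vs i) / (u \<bullet> vs i - u \<bullet> ws k)"
    have t: "0 < t" "t < 1" "(1 - t) * (u \<bullet> vs i) + t * (u \<bullet> ws k) = 0"
      using k(2) by (auto simp: t_def mult_less_0_iff field_simps)
    have "(1 - t) *\<^sub>R vs i + t *\<^sub>R ws k \<in> rel_interior (convex hull (insert (ws k) {vs i}))"
      by (rule rel_interior_cone) (use t in auto)
    moreover have "(1 - t) *\<^sub>R vs i + t *\<^sub>R ws k \<in> ?H" using t(3) by (simp add: inner_add_right)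
    ultimately have hitC: "rel_interior ?C \<inter> ?H \<noteq> {}" by (auto simp: insert_commute)
    have "vs i \<in> ?C" by (auto intro: hull_inc)
    then have "\<not> ?C \<subseteq> ?H" using False by blast
    then have "aff_dim (?C \<inter> ?H) = int 0"
      using aff_dim_Int_hyperplane[OF convex_convex_hull hitC] aff_dim_edge[OF i kI] by simp
    then have "?C \<in> ?T" using hitC edge_vs_end[OF i k(1)] by (simp add: hit_faces_def)
    moreover have "\<forall>j\<in>I. vs j \<in> ?C \<longleftrightarrow> j = i"
      using edge_contains_vs[OF i _ kI] \<open>vs i \<in> ?C\<close> by blast
    ultimately show ?thesis by blast
  qed
  then have "\<forall>i\<in>I. \<exists>C. C \<in> ?T \<and> (\<forall>j\<in>I. vs j \<in> C \<longleftrightarrow> j = i)" by blast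
  from bchoice[OF this] obtain \<Phi> where
    \<Phi>: "\<forall>i\<in>I. \<Phi> i \<in> ?T \<and> (\<forall>j\<in>I. vs j \<in> \<Phi> i \<longleftrightarrow> j = i)" by (rule exE)
  have mem: "vs j \<in> \<Phi> i \<longleftrightarrow> j = i" if "i \<in> I" "j \<in> I" for i j
    by (rule bspec[OF conjunct2[OF bspec[OF \<Phi> that(1)]] that(2)])
  have "inj_on \<Phi> I"
  proof (rule inj_onI)
    fix i j assume ij: "i \<in> I" "j \<in> I" "\<Phi> i = \<Phi> j"
    show "i = j" using mem[OF ij(1,1)] mem[OF ij(2,1)] ij(3) by metis
  qed
  moreover have "\<Phi> ` I \<subseteq> ?T" by (rule image_subsetI) (rule conjunct1[OF bspec[OF \<Phi>]])
  moreover have "finite ?T" by (rule finite_subset[OF _ finite_hit_faces[OF polytope_shell]]) auto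
  ultimately have "card I \<le> card ?T" by (rule card_inj_on_le)
  then show ?thesis unfolding f_num_central_section_eq[OF polytope_shell] by simp
qed

text \<open>If the plane strictly separates the ends of one arc, every point of the other arc is on
  the plane or strictly separated from one of these ends. If it separates neither pair, the
  component of \<open>u\<close> along \<open>r\<close> dominates: the first arc lies weakly on one
  side and some end of the second strictly on the other.\<close>

lemma f_num_section_shell_0:
  assumes "\<exists>x\<in>shell n p q r. u \<bullet> x \<noteq> 0"
  shows "n - 1 \<le> f_num 0 (central_section (shell n p q r) u)"
proof -
  have opp: "x = 0 \<or> (\<exists>k\<in>{1, n - 1}. x * g k < 0)" if "g 1 * g (n - 1) < 0" for x :: real and g
    using that by (cases x "0 :: real" rule: linorder_cases) (auto simp: mult_less_0_iff)
  consider "(u \<bullet> ws 1) * (u \<bullet> ws (n - 1)) < 0" | "(u \<bullet> vs 1) * (u \<bullet> vs (n - 1)) < 0"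
    | "(u \<bullet> ws 1) * (u \<bullet> ws (n - 1)) \<ge> 0" "(u \<bullet> vs 1) * (u \<bullet> vs (n - 1)) \<ge> 0" by linarith
  then show ?thesis
  proof cases
    case 1
    then show ?thesis using opp[of "\<lambda>k. u \<bullet> ws k"] by (intro section_vertices_ge) blast
  next
    case 2
    interpret swap: shell_frame q p "- r" n by (rule shell_frame_swap)
    have "n - 1 \<le> f_num 0 (central_section (shell n q p (- r)) u)"
      using 2 opp[of "\<lambda>k. u \<bullet> vs k"] by (intro swap.section_vertices_ge) simp
    then show ?thesis by (simp add: shell_swap)
  next
    case 3
    define a b c where "a = u \<bullet> p" and "b = u \<bullet> q" and "c = u \<bullet> r"
    have "(u \<bullet> ws 1) * (u \<bullet> ws (n - 1)) = (c\<^sup>2 - b\<^sup>2) / 2" "(u \<bullet> vs 1) * (u \<bullet> vs (n - 1)) = (c\<^sup>2 - a\<^sup>2) / 2"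
      unfolding inner_end_points a_def b_def c_def by (simp_all add: field_simps power2_eq_square)
    then have abs: "\<bar>b\<bar> \<le> \<bar>c\<bar>" "\<bar>a\<bar> \<le> \<bar>c\<bar>" using 3 by (simp_all add: abs_le_square_iff)
    have c0: "c \<noteq> 0"
    proof
      assume "c = 0"
      then have "a = 0" "b = 0" using abs by auto
      then show False using assms zero_on_gens[of u] \<open>c = 0\<close> by (auto simp: a_def b_def c_def)
    qed
    have small: "\<bar>sin (th i) * a\<bar> \<le> cos (th i) * \<bar>c\<bar>" if "i \<in> I" for i
    proof -
      have "\<bar>sin (th i)\<bar> \<le> cos (th i)" using sin_th_bounds[OF that] cos_th_ge[OF that] by (simp add: abs_le_iff)
      then show ?thesis unfolding abs_mult using abs(2) cos_th_pos[OF that] by (intro mult_mono) auto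
    qed
    show ?thesis
    proof (rule section_vertices_ge)
      fix i assume i: "i \<in> I"
      have v: "u \<bullet> vs i = sin (th i) * a + cos (th i) * c" by (simp add: inner_arc_pt a_def c_def)
      have w: "u \<bullet> ws 1 = sqrt 2 / 2 * (- b - c)" "u \<bullet> ws (n - 1) = sqrt 2 / 2 * (b - c)"
        unfolding inner_end_points a_def b_def c_def by (rule refl)+
      show "u \<bullet> vs i = 0 \<or> (\<exists>k\<in>{1, n - 1}. (u \<bullet> vs i) * (u \<bullet> ws k) < 0)"
      proof (cases "c > 0")
        case True
        then have "u \<bullet> vs i \<ge> 0" using small[OF i] v by (simp add: abs_le_iff)
        \<comment> \<open>The two numbers add up to \<open>- 2 * c\<close>, so they cannot both be
          nonnegative.\<close>
        moreover have "- b - c < 0 \<or> b - c < 0" using True by linarith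
        then have "u \<bullet> ws 1 < 0 \<or> u \<bullet> ws (n - 1) < 0" unfolding w by (simp add: mult_less_0_iff)
        ultimately show ?thesis by (auto simp: mult_less_0_iff)
      next
        case False
        then have "c < 0" using c0 by simp
        then have "u \<bullet> vs i \<le> 0" using small[OF i] v by (simp add: abs_le_iff)
        moreover have "- b - c > 0 \<or> b - c > 0" using \<open>c < 0\<close> by linarith
        then have "u \<bullet> ws 1 > 0 \<or> u \<bullet> ws (n - 1) > 0" unfolding w by (simp add: zero_less_mult_iff)
        ultimately show ?thesis by (auto simp: mult_less_0_iff)
      qed
    qed
  qed
qed

lemma rich_shell: "rich (n - 1) 3 (shell n p q r)"
  unfolding rich_def
proof (intro conjI allI impI)
  fix i :: nat assume "i < 3"
  then consider "i = 0" | "i = 1" | "i = 2" by linarith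
  then show "n - 1 \<le> 2 * f_num i (shell n p q r)"
    using f_num_shell_0 f_num_shell_1 f_num_shell_2 by cases auto
next
  fix u and i :: nat assume u: "\<exists>x\<in>shell n p q r. u \<bullet> x \<noteq> 0" and "Suc i < 3"
  then consider "i = 0" | "i = 1" by linarith
  moreover have "f_num 0 (central_section (shell n p q r) u) \<le> 2 * f_num 1 (central_section (shell n p q r) u)"
    by (rule f_num_polygon[OF polytope_central_section[OF polytope_shell]])
      (simp add: aff_dim_central_section[OF convex_shell zero_rel_interior_shell u] dim_shell)
  ultimately show "n - 1 \<le> 2 * f_num i (central_section (shell n p q r) u)"
    using f_num_section_shell_0[OF u] by cases auto
qed

end

section \<open>Regular polygons and iterated constructions\<close>

text \<open>The cut is empty, a point or a segment, hence the hull of at most two points, and its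
  faces are hulls of subsets of these.\<close>

lemma card_hit_faces_polygon:
  fixes P :: "'a::euclidean_space set"
  assumes "polytope P" "aff_dim P = 2" "\<not> P \<subseteq> {x. u \<bullet> x = c}"
  shows "card (hit_faces P {x. u \<bullet> x = c}) \<le> 4"
proof -
  let ?H = "{x. u \<bullet> x = c}"
  have pol: "polytope (P \<inter> ?H)" by (intro polytope_Int_polyhedron assms(1) polyhedron_hyperplane)
  have "\<not> affine hull P \<subseteq> ?H" using assms(3) hull_subset[of P affine] by blast
  then have "aff_dim (affine hull P \<inter> ?H) \<le> 1"
    using aff_dim_affine_Int_hyperplane[of "affine hull P" u c] assms(2) by auto
  moreover have "aff_dim (P \<inter> ?H) \<le> aff_dim (affine hull P \<inter> ?H)"
    by (rule aff_dim_subset) (use hull_subset[of P affine] in blast)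
  ultimately have "aff_dim (P \<inter> ?H) \<le> 1" by linarith
  then obtain A where A: "finite A" "card A \<le> 2" "P \<inter> ?H = convex hull A"
    using polytope_aff_dim_le_1[OF pol] by metis
  have "card (hit_faces P ?H) = card {E. E face_of P \<inter> ?H \<and> E \<noteq> {}}"
    by (rule bij_betw_same_card[OF bij_betw_hit_faces[OF assms(1) affine_hyperplane]])
  also have "\<dots> \<le> card {E. E face_of P \<inter> ?H}"
    by (rule card_mono[OF finite_polytope_faces[OF pol]]) auto
  also have "\<dots> \<le> 2 ^ card A" unfolding A(3) by (rule card_faces_convex_hull_le[OF A(1)])
  also have "\<dots> \<le> 2 ^ 2" by (rule power_increasing[OF A(2)]) simp
  finally show ?thesis by simp
qed

lemma sum_cos_sin_regular:
  assumes "m > 1"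
  shows "(\<Sum>i<m. cos (2 * pi * real i / real m)) = 0" "(\<Sum>i<m. sin (2 * pi * real i / real m)) = 0"
proof -
  have "(\<Sum>i<m. cis (2 * pi * real i / real m)) = \<Sum>{z::complex. z ^ m = 1}"
    using sum.reindex_bij_betw[OF Complex.bij_betw_roots_unity[of m], of "\<lambda>z. z"] assms by simp
  then have 0: "(\<Sum>i<m. cis (2 * pi * real i / real m)) = 0" using sum_roots_unity[OF assms] by simp
  show "(\<Sum>i<m. cos (2 * pi * real i / real m)) = 0" using arg_cong[OF 0, of Re] by simp
  show "(\<Sum>i<m. sin (2 * pi * real i / real m)) = 0" using arg_cong[OF 0, of Im] by simp
qed

section \<open>Polytopes in coordinate subspaces\<close>

locale basis_enum =
  fixes e :: "nat \<Rightarrow> 'a::euclidean_space"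
  assumes basis: "bij_betw e {..<DIM('a)} (Basis :: 'a set)"
begin

lemma inner_e: "i < DIM('a) \<Longrightarrow> j < DIM('a) \<Longrightarrow> e i \<bullet> e j = (if i = j then 1 else 0)"
proof -
  assume ij: "i < DIM('a)" "j < DIM('a)"
  then have "e i \<in> Basis" "e j \<in> Basis" using basis by (auto simp: bij_betw_def)
  moreover have "e i = e j \<longleftrightarrow> i = j" using basis ij by (auto simp: bij_betw_def inj_on_def)
  ultimately show ?thesis by (simp add: inner_Basis)
qed

text \<open>The stand-in, inside the ambient space, for a \<open>j\<close>-dimensional polytope in
  \<open>\<real>\<^sup>j\<close> with the origin in its interior.\<close>

definition spanning :: "nat \<Rightarrow> 'a set \<Rightarrow> bool" where
  "spanning j P \<longleftrightarrow> polytope P \<and> 0 \<in> rel_interior P \<and> span P = span (e ` {..<j})"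

lemma orth_e:
  assumes "spanning j P" "j < DIM('a)" "x \<in> P" shows "e j \<bullet> x = 0"
proof -
  have "span (e ` {..<j}) \<subseteq> {x. e j \<bullet> x = 0}"
    by (rule span_minimal[OF _ subspace_hyperplane]) (use inner_e assms(2) in auto)
  then show ?thesis using assms(1,3) span_base[of x P] by (auto simp: spanning_def)
qed

lemma aff_dim_spanning:
  assumes "spanning j P" "j \<le> DIM('a)" shows "aff_dim P = int j"
proof -
  have "e ` {..<j} \<subseteq> Basis" using basis assms(2) by (auto simp: bij_betw_def)
  then have "independent (e ` {..<j})" using independent_Basis independent_mono by blast
  moreover have "card (e ` {..<j}) = j"
    using basis assms(2) card_image[of e "{..<j}"] by (auto simp: bij_betw_def inj_on_def)
  ultimately have "dim P = j"
    using assms(1) by (metis spanning_def dim_span dim_eq_card_independent)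
  moreover have "0 \<in> affine hull P"
    using assms(1) rel_interior_subset[of P] by (auto simp: spanning_def intro: hull_inc)
  ultimately show ?thesis by (simp add: aff_dim_zero)
qed

lemma span_insert_e: "spanning j P \<Longrightarrow> span (insert (e j) P) = span (e ` {..<Suc j})"
  by (simp add: spanning_def lessThan_Suc span_insert)

lemma spanning_full:
  assumes "spanning DIM('a) P"
  shows "full_polytope P" "u \<noteq> 0 \<Longrightarrow> \<exists>x\<in>P. u \<bullet> x \<noteq> 0"
proof -
  have d: "aff_dim P = int DIM('a)" by (rule aff_dim_spanning[OF assms order_refl])
  then have "affine hull P = UNIV" by (simp add: aff_dim_eq_full)
  then have "rel_interior P = interior P" by (rule rel_interior_interior)
  then show "full_polytope P" using assms d by (simp add: full_polytope_def spanning_def)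
  have sp: "span P = UNIV" using assms basis by (simp add: spanning_def bij_betw_def)
  show "\<exists>x\<in>P. u \<bullet> x \<noteq> 0" if "u \<noteq> 0"
  proof (rule ccontr)
    assume "\<not> ?thesis"
    then have "span P \<subseteq> {x. u \<bullet> x = 0}" by (intro span_minimal[OF _ subspace_hyperplane]) auto
    then have "u \<bullet> u = 0" using sp by blast
    then show False using that by simp
  qed
qed

lemma globe_over_e: "spanning j P \<Longrightarrow> j < DIM('a) \<Longrightarrow> m \<ge> 2 \<Longrightarrow> globe_over (e j) m P"
  using orth_e[of j P] inner_e by unfold_locales (auto simp: spanning_def)

lemma bipyr_over_e: "spanning j P \<Longrightarrow> j < DIM('a) \<Longrightarrow> bipyr_over (e j) P"
  using orth_e[of j P] inner_e by unfold_locales (auto simp: spanning_def)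

lemma spanning_globe:
  assumes "spanning j P" "j < DIM('a)" "m \<ge> 2" shows "spanning (Suc j) (globe (e j) m P)"
proof -
  interpret globe_over "e j" m P by (rule globe_over_e[OF assms])
  show ?thesis
    using polytope_globe zero_rel_interior_globe span_globe span_insert_e[OF assms(1)] by (simp add: spanning_def)
qed

lemma spanning_bipyr:
  assumes "spanning j P" "j < DIM('a)" shows "spanning (Suc j) (bipyr (e j) P)"
proof -
  interpret bipyr_over "e j" P by (rule bipyr_over_e[OF assms])
  show ?thesis
    using polytope_bipyr zero_rel_interior_bipyr span_bipyr span_insert_e[OF assms(1)] by (simp add: spanning_def)
qed

end

section \<open>The regular polygon\<close>

locale polygon = basis_enum +
  fixes m :: nat
  assumes m3: "m \<ge> 3" and dim2: "DIM('a) \<ge> 2"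
begin

text \<open>Integer indices let the neighbours \<open>i - 1\<close> and \<open>i + 1\<close> be
  named without wrapping around; periodicity is used only when a vertex must be found in the
  generating set.\<close>

definition vert :: "int \<Rightarrow> 'a" where
  "vert i = cos (2 * pi * of_int i / real m) *\<^sub>R e 0 + sin (2 * pi * of_int i / real m) *\<^sub>R e 1"

abbreviation P where "P \<equiv> regular_polygon e m"

lemma frame: "e 0 \<bullet> e 0 = 1" "e 1 \<bullet> e 1 = 1" "e 0 \<bullet> e 1 = 0" "e 1 \<bullet> e 0 = 0"
  using inner_e dim2 by auto

lemma vert_periodic: "vert (i + int m) = vert i"
proof -
  have "2 * pi * of_int (i + int m) / real m = 2 * pi * of_int i / real m + 2 * pi"
    using m3 by (simp add: field_simps)
  then show ?thesis by (simp add: vert_def)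
qed

lemma polygon_eq: "P = convex hull (vert ` {0..<int m})"
proof -
  have "vert ` {0..<int m} = (\<lambda>i. vert (int i)) ` {..<m}"
    using image_int_atLeastLessThan[of 0 m] by (auto simp: image_image[symmetric] lessThan_atLeast0)
  then show ?thesis by (simp add: regular_polygon_def vert_def)
qed

lemma vert_in_polygon: "vert i \<in> P"
proof -
  have per: "vert (i + int m * k) = vert i" for i k
  proof (induction k rule: int_induct[where k=0])
    case (step1 k) then show ?case using vert_periodic[of "i + int m * k"] by (simp add: algebra_simps)
  next
    case (step2 k) then show ?case using vert_periodic[of "i + int m * (k - 1)"] by (simp add: algebra_simps)
  qed simp
  have "vert i = vert (i mod int m)" using per[of "i mod int m" "i div int m"] by (simp add: mult.commute)
  then have "vert i \<in> vert ` {0..<int m}" using m3 by auto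
  then show ?thesis unfolding polygon_eq by (rule hull_inc)
qed

lemma inner_vert: "w \<bullet> vert i =
  (w \<bullet> e 0) * cos (2 * pi * of_int i / real m) + (w \<bullet> e 1) * sin (2 * pi * of_int i / real m)"
  by (simp add: vert_def inner_add_right mult.commute)

lemma inner_vert_vert:
  "vert i \<bullet> vert j = cos (2 * pi * of_int i / real m - 2 * pi * of_int j / real m)"
  unfolding vert_def inner_add_left inner_add_right inner_scaleR_left inner_scaleR_right frame cos_diff by simp

lemma inj_vert: "inj_on vert {0..<int m}"
proof (rule inj_onI)
  fix i j assume ij: "i \<in> {0..<int m}" "j \<in> {0..<int m}" "vert i = vert j"
  have "vert i \<bullet> vert j = 1" using ij(3) by (simp add: inner_vert_vert)
  then have "cos (2 * pi * of_int i / real m - 2 * pi * of_int j / real m) = 1"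
    by (simp only: inner_vert_vert)
  then obtain k :: int where "2 * pi * of_int i / real m - 2 * pi * of_int j / real m = of_int k * 2 * pi"
    using cos_one_2pi_int by metis
  then have "2 * pi * (of_int i - of_int j - of_int k * real m) = 0" using m3 by (simp add: field_simps)
  then have "of_int i - of_int j = of_int k * real m" by simp
  then have "i - j = k * int m" by (metis of_int_diff of_int_eq_iff of_int_mult of_int_of_nat_eq)
  moreover have "\<bar>i - j\<bar> < int m" using ij by auto
  ultimately have "\<bar>k\<bar> * int m < 1 * int m" by (simp add: abs_mult)
  then have "\<bar>k\<bar> < 1" by (rule mult_right_less_imp_less) simp
  then have "k = 0" by simp
  then show "i = j" using \<open>i - j = k * int m\<close> by simp
qed

lemma polytope_polygon: "polytope P"
  unfolding polygon_eq by (rule polytope_convex_hull) simp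

lemma sum_vert: "(\<Sum>i<m. vert (int i)) = 0"
  using sum_cos_sin_regular[of m] m3 by (simp add: vert_def sum.distrib flip: scaleR_left.sum)

lemma zero_in_polygon: "0 \<in> P"
proof -
  have "(\<Sum>i<m. (1 / real m) *\<^sub>R vert (int i)) \<in> P"
    by (rule convex_sum) (use m3 vert_in_polygon polytope_polygon polytope_imp_convex in auto)
  then show ?thesis using sum_vert by (simp flip: scaleR_right.sum)
qed

text \<open>The vertices sum to zero, so a functional nonnegative at all of them vanishes at all of
  them.\<close>

lemma zero_rel_interior_polygon: "0 \<in> rel_interior P"
proof (rule rel_interiorI_minimizers[OF polytope_imp_convex[OF polytope_polygon] zero_in_polygon])
  fix a x assume a: "\<And>x. x \<in> P \<Longrightarrow> a \<bullet> 0 \<le> a \<bullet> x" and x: "x \<in> P"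
  have "(\<Sum>i<m. a \<bullet> vert (int i)) = 0" using sum_vert by (simp flip: inner_sum_right)
  then have "\<forall>i\<in>{..<m}. a \<bullet> vert (int i) = 0"
    using a vert_in_polygon by (subst (asm) sum_nonneg_eq_0_iff) auto
  then have "a \<bullet> vert i = 0" if "i \<in> {0..<int m}" for i
    using that by (auto dest: bspec[of _ _ "nat i"])
  then have "vert ` {0..<int m} \<subseteq> {x. a \<bullet> x = 0}" by blast
  then have "P \<subseteq> {x. a \<bullet> x = 0}" unfolding polygon_eq by (rule hull_minimal) (rule convex_hyperplane)
  then show "a \<bullet> x = a \<bullet> 0" using x by auto
qed

lemma spanning_polygon: "spanning 2 P"
  unfolding spanning_def
proof (intro conjI polytope_polygon zero_rel_interior_polygon)
  have E: "e ` {..<2} = {e 0, e 1}" by (auto simp: numeral_2_eq_2 lessThan_Suc)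
  have "vert i \<in> span {e 0, e 1}" for i
    unfolding vert_def by (intro span_add span_scale span_base) auto
  then have 1: "P \<subseteq> span {e 0, e 1}"
    unfolding polygon_eq by (intro hull_minimal) (auto simp: subspace_imp_convex)
  have e0: "e 0 \<in> span P" using span_base[OF vert_in_polygon[of 0]] by (simp add: vert_def)
  have s: "sin (2 * pi / real m) > 0" by (rule sin_gt_zero) (use m3 in \<open>auto simp: field_simps\<close>)
  have "vert 1 - cos (2 * pi / real m) *\<^sub>R e 0 \<in> span P"
    by (intro span_diff span_scale e0 span_base vert_in_polygon)
  then have "sin (2 * pi / real m) *\<^sub>R e 1 \<in> span P" by (simp add: vert_def)
  then have "(1 / sin (2 * pi / real m)) *\<^sub>R sin (2 * pi / real m) *\<^sub>R e 1 \<in> span P" by (rule span_scale)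
  then have "e 1 \<in> span P" using s by simp
  then show "span P = span (e ` {..<2})" unfolding E using 1 e0 by (intro span_eq[THEN iffD2]) auto
qed

lemma f_num_polygon_0: "m \<le> f_num 0 P"
proof -
  have "vert i extreme_point_of P" if "i \<in> {0..<int m}" for i
    unfolding polygon_eq by (rule unit_vectors_extreme)
      (use that in \<open>auto intro!: finite_imp_compact simp: inner_vert_vert\<close>)
  moreover have "finite {x. x extreme_point_of P}"
    using finite_polyhedron_extreme_points polytope_imp_polyhedron[OF polytope_polygon] by blast
  ultimately have "card (vert ` {0..<int m}) \<le> f_num 0 P" unfolding f_num_0 by (intro card_mono) auto
  then show ?thesis using card_image[OF inj_vert] by simp
qed

text \<open>The full circle is too long for the arc argument, so it is applied to whichever arc
  between the two vertices is shorter than a half circle; a vertex inside it would exceed the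
  maximum. Antipodal vertices have opposite values and cannot both attain
  \<open>b > 0\<close>.\<close>

lemma polygon_face_neighbours:
  assumes "\<And>y. y \<in> P \<Longrightarrow> w \<bullet> y \<le> b" "b > 0" "w \<bullet> vert i = b" "w \<bullet> vert j = b" "i < j" "j < i + int m"
  shows "j = i + 1 \<or> j = i + int m - 1"
proof -
  define \<delta> where "\<delta> = 2 * pi / real m"
  have \<delta>: "\<delta> > 0" "\<delta> * real m = 2 * pi" using m3 by (auto simp: \<delta>_def)
  have ang: "2 * pi * of_int i / real m = of_int i * \<delta>" for i by (simp add: \<delta>_def)
  have gap: "l = k + 1" if "w \<bullet> vert k = b" "w \<bullet> vert l = b" "k < l" "of_int (l - k) * \<delta> < pi" for k l
  proof (rule ccontr)
    assume "l \<noteq> k + 1"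
    then have "of_int k * \<delta> < of_int (k + 1) * \<delta>" "of_int (k + 1) * \<delta> < of_int l * \<delta>"
      using \<delta> that(3) by (auto intro!: mult_strict_right_mono)
    moreover have "of_int l * \<delta> - of_int k * \<delta> < pi" using that(4) by (simp add: left_diff_distrib)
    ultimately have "w \<bullet> vert (k + 1) > b"
      using sinusoid_arc_gt[of "of_int k * \<delta>" "of_int (k + 1) * \<delta>" "of_int l * \<delta>" "w \<bullet> e 0" "w \<bullet> e 1" b]
        that(1,2) assms(2) unfolding inner_vert ang by blast
    then show False using assms(1)[OF vert_in_polygon[of "k + 1"]] by simp
  qed
  consider "of_int (j - i) * \<delta> < pi" | "of_int (j - i) * \<delta> = pi" | "of_int (i + int m - j) * \<delta> < pi"
    using \<delta>(2) by (fastforce simp: algebra_simps)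
  then show ?thesis
  proof cases
    case 1
    then show ?thesis using gap[OF assms(3,4,5)] by simp
  next
    case 2
    then have "of_int j * \<delta> = of_int i * \<delta> + pi" by (simp add: algebra_simps)
    then have "w \<bullet> vert j = - (w \<bullet> vert i)" unfolding inner_vert ang by simp
    then show ?thesis using assms(2-4) by simp
  next
    case 3
    then show ?thesis using gap[of j "i + int m"] assms(3,4,6) by (simp add: vert_periodic)
  qed
qed

text \<open>All vertices of a proper nonempty face are cyclic neighbours of one of them or that
  vertex itself, so such a face is spanned by one of the eight subsets of a triple of consecutive
  vertices; \<open>2 + 8 * m \<le> 9 * m\<close> since \<open>m \<ge> 3\<close>.\<close>

lemma card_faces_polygon: "card {F. F face_of P} \<le> 9 * m"
proof -
  let ?N = "\<lambda>i. vert ` {i - 1, i, i + 1}"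
  have "{F. F face_of P} \<subseteq> {{}, P} \<union> (\<Union>i\<in>{0..<int m}. (hull) convex ` Pow (?N i))"
  proof
    fix F assume "F \<in> {F. F face_of P}"
    then have F: "F face_of P" by blast
    show "F \<in> {{}, P} \<union> (\<Union>i\<in>{0..<int m}. (hull) convex ` Pow (?N i))"
    proof (cases "F = {} \<or> F = P")
      case False
      obtain w b where b: "b > 0" and le: "\<And>y. y \<in> P \<Longrightarrow> w \<bullet> y \<le> b" and Fw: "F = {y \<in> P. w \<bullet> y = b}"
        using proper_face_exposed[OF polytope_polygon zero_rel_interior_polygon F] False by metis
      have FV: "F = convex hull (F \<inter> vert ` {0..<int m})"
        using face_of_convex_hull_eq[of "vert ` {0..<int m}" F] F unfolding polygon_eq
        by (simp add: finite_imp_compact)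
      then have "F \<inter> vert ` {0..<int m} \<noteq> {}" using False by auto
      then obtain i where i: "i \<in> {0..<int m}" "vert i \<in> F" by blast
      have "F \<inter> vert ` {0..<int m} \<subseteq> ?N i"
      proof
        fix y assume "y \<in> F \<inter> vert ` {0..<int m}"
        then obtain j where j: "j \<in> {0..<int m}" "y = vert j" "w \<bullet> vert j = b" using Fw by auto
        have wi: "w \<bullet> vert i = b" using i Fw by auto
        consider "j = i" | "i < j" | "j < i" by linarith
        then show "y \<in> ?N i"
        proof cases
          case 2
          then have "j = i + 1 \<or> j = i - 1 + int m"
            using polygon_face_neighbours[OF le b wi j(3)] i j(1) by force
          then show ?thesis using vert_periodic[of "i - 1"] j(2) by auto
        next
          case 3
          then have "i = j + 1 \<or> i = j + int m - 1"
            using polygon_face_neighbours[OF le b j(3) wi] i j(1) by force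
          then have "j = i - 1 \<or> i + 1 = j + int m" by linarith
          then show ?thesis using vert_periodic[of j] j(2) by auto
        qed (use j in auto)
      qed
      then have "F \<in> (hull) convex ` Pow (?N i)" using FV by blast
      then show ?thesis using i(1) by blast
    qed auto
  qed
  then have "card {F. F face_of P} \<le> card ({{}, P} \<union> (\<Union>i\<in>{0..<int m}. (hull) convex ` Pow (?N i)))"
    by (intro card_mono) auto
  also have "\<dots> \<le> card {{}, P} + card (\<Union>i\<in>{0..<int m}. (hull) convex ` Pow (?N i))" by (rule card_Un_le)
  also have "\<dots> \<le> 2 + (\<Sum>i\<in>{0..<int m}. card ((hull) convex ` Pow (?N i)))"
    by (intro add_mono card_UN_le) (auto simp: card_insert_if)
  also have "\<dots> \<le> 2 + (\<Sum>i\<in>{0..<int m}. 8)"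
  proof (intro add_left_mono sum_mono)
    fix i
    have "card (?N i) \<le> card {i - 1, i, i + 1}" by (rule card_image_le) simp
    also have "\<dots> \<le> 3" by (simp add: card_insert_if)
    finally have "card (Pow (?N i)) \<le> 2 ^ 3" by (simp only: card_Pow finite.intros finite_imageI) (rule power_increasing, auto)
    moreover have "card ((hull) convex ` Pow (?N i)) \<le> card (Pow (?N i))" by (rule card_image_le) simp
    ultimately show "card ((hull) convex ` Pow (?N i)) \<le> 8" by simp
  qed
  also have "\<dots> \<le> 9 * m" using m3 by simp
  finally show ?thesis .
qed

section \<open>Iterated globes\<close>

lemma spanning_iter_globe: "r + 2 \<le> DIM('a) \<Longrightarrow> spanning (r + 2) (iter_globe e m r)"
proof (induction r)
  case 0
  then show ?case using spanning_polygon by (simp add: numeral_2_eq_2)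
next
  case (Suc r)
  then show ?case using spanning_globe[of "r + 2" "iter_globe e m r" m] m3 by simp
qed

lemma iter_globe_over: "Suc r + 2 \<le> DIM('a) \<Longrightarrow> globe_over (e (r + 2)) m (iter_globe e m r)"
  using globe_over_e[OF spanning_iter_globe[of r], of m] m3 by simp

text \<open>Every globe step gains a factor \<open>m\<close> in each dimension: copies on the levels
  for the old dimensions, frusta over facets for the new one. The factor 2 comes from the polygon,
  whose edges are counted through its vertices.\<close>

lemma f_num_iter_globe_ge:
  assumes "r + 2 \<le> DIM('a)" "i < r + 2"
  shows "m ^ (r + 1) \<le> 2 * f_num i (iter_globe e m r)"
  using assms
proof (induction r arbitrary: i)
  case 0
  have "f_num 0 P \<le> 2 * f_num 1 P"
    by (rule f_num_polygon[OF polytope_polygon]) (use aff_dim_spanning[OF spanning_polygon dim2] in simp)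
  moreover have "i = 0 \<or> i = 1" using 0 by auto
  ultimately show ?case using f_num_polygon_0 by auto
next
  case (Suc r)
  let ?Q = "iter_globe e m r"
  interpret globe_over "e (r + 2)" m ?Q by (rule iter_globe_over[OF Suc.prems(1)])
  have d: "aff_dim ?Q = int (r + 2)" using aff_dim_spanning[OF spanning_iter_globe] Suc.prems(1) by simp
  have ge: "m * f_num j ?Q \<le> f_num i (iter_globe e m (Suc r)) \<Longrightarrow> j < r + 2 \<Longrightarrow> ?case" for j
  proof -
    assume j: "m * f_num j ?Q \<le> f_num i (iter_globe e m (Suc r))" "j < r + 2"
    have "m * m ^ (r + 1) \<le> m * (2 * f_num j ?Q)"
      using Suc.IH[of j] Suc.prems(1) j(2) by (intro mult_left_mono) auto
    also have "\<dots> \<le> 2 * f_num i (iter_globe e m (Suc r))" using j(1) by linarith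
    finally show ?case by simp
  qed
  show ?case
  proof (cases "i < r + 2")
    case True
    then show ?thesis using ge[of i] f_num_globe_ge[of i] d by simp
  next
    case False
    then have "i = Suc (r + 1)" using Suc.prems(2) by simp
    then show ?thesis using ge[of "r + 1"] f_num_Suc_globe_ge[of "r + 1"] d by simp
  qed
qed

lemma card_faces_iter_globe_le:
  "r + 2 \<le> DIM('a) \<Longrightarrow> card {F. F face_of iter_globe e m r} \<le> 9 * 4 ^ r * m ^ (r + 1)"
proof (induction r)
  case 0
  then show ?case using card_faces_polygon by simp
next
  case (Suc r)
  interpret globe_over "e (r + 2)" m "iter_globe e m r" by (rule iter_globe_over[OF Suc.prems])
  have "card {F. F face_of iter_globe e m (Suc r)} \<le> 4 * m * card {F. F face_of iter_globe e m r}"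
    using card_faces_globe_le by simp
  also have "\<dots> \<le> 4 * m * (9 * 4 ^ r * m ^ (r + 1))" using Suc by (intro mult_left_mono) auto
  finally show ?case by (simp add: algebra_simps)
qed

text \<open>The induction needs a constant \<open>a r\<close> with \<open>6 * a r + 46 * 10 ^ r \<le> a (r + 1)\<close>.\<close>

lemma card_hit_faces_iter_globe_le:
  "r + 2 \<le> DIM('a) \<Longrightarrow> \<exists>x\<in>iter_globe e m r. u \<bullet> x \<noteq> 0 \<Longrightarrow>
    card (hit_faces (iter_globe e m r) {x. u \<bullet> x = c}) \<le> 50 * 10 ^ r * m ^ r"
proof (induction r arbitrary: c)
  case 0
  have "\<not> P \<subseteq> {x. u \<bullet> x = c}"
  proof
    assume sub: "P \<subseteq> {x. u \<bullet> x = c}"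
    then have "u \<bullet> 0 = c" using zero_in_polygon by blast
    then show False using sub 0(2) by auto
  qed
  then have "card (hit_faces P {x. u \<bullet> x = c}) \<le> 4"
    using aff_dim_spanning[OF spanning_polygon dim2] by (intro card_hit_faces_polygon polytope_polygon) auto
  then show ?case by simp
next
  case (Suc r)
  let ?Q = "iter_globe e m r"
  interpret globe_over "e (r + 2)" m ?Q by (rule iter_globe_over[OF Suc.prems(1)])
  have "card (hit_faces (globe (e (r + 2)) m ?Q) {x. u \<bullet> x = c})
      \<le> 1 + 6 * m * (50 * 10 ^ r * m ^ r) + 5 * card {F. F face_of ?Q}"
    by (rule card_hit_faces_globe_le) (use Suc.IH Suc.prems in auto)
  also have "\<dots> \<le> m ^ Suc r * 10 ^ r + 6 * m * (50 * 10 ^ r * m ^ r) + 5 * (9 * 10 ^ r * m ^ (r + 1))"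
  proof (intro add_mono mult_left_mono order_refl)
    show "1 \<le> m ^ Suc r * 10 ^ r" using m3 by simp
    have "card {F. F face_of ?Q} \<le> 9 * 4 ^ r * m ^ (r + 1)"
      using card_faces_iter_globe_le Suc.prems(1) by simp
    \<comment> \<open>Weakening \<open>4 ^ r\<close> to \<open>10 ^ r\<close> gives all terms one
      growth rate, which exceeds the factor 6 of the recursion.\<close>
    also have "\<dots> \<le> 9 * 10 ^ r * m ^ (r + 1)" by (intro mult_right_mono mult_left_mono power_mono) auto
    finally show "card {F. F face_of ?Q} \<le> 9 * 10 ^ r * m ^ (r + 1)" .
  qed auto
  also have "\<dots> = 346 * (10 ^ r * m ^ Suc r)" by (simp add: algebra_simps)
  also have "\<dots> \<le> 500 * (10 ^ r * m ^ Suc r)" by (intro mult_right_mono) auto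
  finally show ?case by simp
qed

end

section \<open>Iterated bipyramids over the shell polytope\<close>

locale shell_enum = basis_enum +
  fixes n :: nat
  assumes n3: "n \<ge> 3" and dim3: "DIM('a) \<ge> 3"
begin

sublocale shell_frame "e 0" "e 1" "e 2" n
  by unfold_locales (use inner_e dim3 n3 in auto)

abbreviation Q where "Q \<equiv> iter_bipyr e 3"

lemma iter_bipyr_shell:
  "r + 3 \<le> DIM('a) \<Longrightarrow> spanning (r + 3) (Q r (shell_polytope e n)) \<and>
    rich (n - 1) (r + 3) (Q r (shell_polytope e n)) \<and>
    card {F. F face_of Q r (shell_polytope e n)} \<le> 16 * n * 4 ^ r"
proof (induction r)
  case 0
  have "e ` {..<3} = {e 0, e 1, e 2}" by (auto simp: numeral_3_eq_3 lessThan_Suc numeral_2_eq_2)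
  then have "spanning 3 (shell n (e 0) (e 1) (e 2))"
    using polytope_shell zero_rel_interior_shell span_shell by (simp add: spanning_def)
  then show ?case using rich_shell card_faces_shell by (simp add: shell_polytope_eq)
next
  case (Suc r)
  let ?B = "Q r (shell_polytope e n)"
  have IH: "spanning (r + 3) ?B" "rich (n - 1) (r + 3) ?B" "card {F. F face_of ?B} \<le> 16 * n * 4 ^ r"
    using Suc by auto
  have r: "r + 3 < DIM('a)" using Suc.prems by simp
  interpret b: bipyr_over "e (r + 3)" ?B by (rule bipyr_over_e[OF IH(1) r])
  have step: "Q (Suc r) (shell_polytope e n) = bipyr (e (r + 3)) ?B" by (simp add: add.commute)
  have "card {F. F face_of bipyr (e (r + 3)) ?B} \<le> 4 * (16 * n * 4 ^ r)"
    using b.card_faces_bipyr_le IH(3) by linarith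
  moreover have "rich (n - 1) (Suc (r + 3)) (bipyr (e (r + 3)) ?B)"
    by (rule b.rich_bipyr[OF _ _ IH(2)]) (use aff_dim_spanning[OF IH(1)] r in auto)
  ultimately show ?case unfolding step using spanning_bipyr[OF IH(1) r] by simp
qed

end

theorem theorem6p18:
  fixes e :: "nat \<Rightarrow> 'a::euclidean_space"
  assumes dim: "DIM('a) \<ge> 3"
    and basis: "bij_betw e {..<DIM('a)} (Basis :: 'a set)"
  shows "\<not> comb_busemann_petty TYPE('a) \<and>
    \<not> (\<exists>C>0. comb_slicing TYPE('a) C) \<and>
    (\<forall>k\<in>{1..DIM('a) - 1}. \<forall>C>(0::real). \<exists>n\<ge>3. \<exists>m\<ge>3.
      (\<forall>u\<in>sphere 0 1.
         f_num (k - 1) (central_section (G e (DIM('a)) m) u)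
           \<le> f_num (k - 1) (central_section (iter_bipyr e 3 (DIM('a) - 3) (shell_polytope e n)) u)) \<and>
      real (f_num k (G e (DIM('a)) m))
        > C * real (f_num k (iter_bipyr e 3 (DIM('a) - 3) (shell_polytope e n))))"
proof -
  let ?d = "DIM('a)"
  let ?G = "\<lambda>m. G e ?d m"
  let ?B = "\<lambda>n. iter_bipyr e 3 (?d - 3) (shell_polytope e n)"
  interpret basis_enum e by unfold_locales (rule basis)
  have polygon: "polygon e m" if "m \<ge> 3" for m
    by unfold_locales (use that dim in auto)
  have shell: "shell_enum e n" if "n \<ge> 3" for n
    by unfold_locales (use that dim in auto)
  have d: "?d - 2 + 2 = ?d" "?d - 3 + 3 = ?d" "?d - 2 + 1 = ?d - 1" using dim by auto
  have G_span: "spanning ?d (?G m)" if "m \<ge> 3" for m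
    using polygon.spanning_iter_globe[OF polygon[OF that], of "?d - 2"] d by (simp add: G_def)
  have B_props: "spanning ?d (?B n)" "rich (n - 1) ?d (?B n)" "card {F. F face_of ?B n} \<le> 16 * n * 4 ^ (?d - 3)"
    if "n \<ge> 3" for n
    using shell_enum.iter_bipyr_shell[OF shell[OF that], of "?d - 3"] d by auto
  have main: "\<exists>n\<ge>3. \<exists>m\<ge>3.
      (\<forall>u\<in>sphere 0 1. f_num (k - 1) (central_section (?G m) u) \<le> f_num (k - 1) (central_section (?B n) u)) \<and>
      real (f_num k (?G m)) > C * real (f_num k (?B n))"
    if k: "k \<in> {1..?d - 1}" and C: "C > 0" for k and C :: real
  proof -
    \<comment> \<open>Twice the coefficient in the bound on crossed faces of the globe; the doubling
      matches the factor 2 in \<open>rich\<close>.\<close>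
    define A where "A = 50 * 10 ^ (?d - 2) * (2 :: nat)"
    \<comment> \<open>Chosen so that \<open>D * M\<close> bounds the face number
      \<open>16 * n * 4 ^ (d - 3)\<close> of the bipyramid once \<open>n \<le> 2 * (A * M)\<close>,
      with \<open>d\<close> the dimension.\<close>
    define D where "D = 16 * 4 ^ (?d - 3) * (2 * A)"
    have A: "A \<ge> 4" by (simp add: A_def)
    \<comment> \<open>The globe has at least \<open>m * M / 2\<close> faces and the bipyramid at
      most \<open>D * M\<close>, both of dimension \<open>k\<close>; comparing them cancels
      \<open>M\<close> and leaves this condition on \<open>m\<close>.\<close>
    obtain m where m: "real m > 2 * C * real D" "m \<ge> 3"
      using reals_Archimedean2[of "max (2 * C * real D) 3"] by auto
    define M where "M = m ^ (?d - 2)"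
    \<comment> \<open>The lower bounds for the shell are in terms of \<open>n - 1\<close>, which
      becomes exactly \<open>A * M\<close>.\<close>
    define n where "n = A * M + 1"
    have M: "M \<ge> 1" using m(2) by (simp add: M_def)
    have AM: "A * M \<ge> 4" using A M mult_le_mono[OF A M] by simp
    have n: "n \<ge> 3" "n \<le> 2 * (A * M)" using AM unfolding n_def by linarith+
    have polyG: "polytope (?G m)" using G_span[OF m(2)] by (simp add: spanning_def)
    have polyB: "polytope (?B n)" using B_props(1)[OF n(1)] by (simp add: spanning_def)
    have "f_num (k - 1) (central_section (?G m) u) \<le> f_num (k - 1) (central_section (?B n) u)"
      if u: "u \<in> sphere 0 1" for u
    proof -
      have u0: "u \<noteq> 0" using u by auto
      have "f_num (k - 1) (central_section (?G m) u) \<le> card (hit_faces (?G m) {x. u \<bullet> x = 0})"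
        by (rule f_num_central_section_le[OF polyG])
      also have "\<dots> \<le> 50 * 10 ^ (?d - 2) * m ^ (?d - 2)"
        using polygon.card_hit_faces_iter_globe_le[OF polygon[OF m(2)], of "?d - 2" u 0] d
          spanning_full(2)[OF G_span[OF m(2)] u0] by (simp add: G_def)
      finally have "2 * f_num (k - 1) (central_section (?G m) u) \<le> n - 1"
        by (simp add: n_def A_def M_def algebra_simps)
      also have "\<dots> \<le> 2 * f_num (k - 1) (central_section (?B n) u)"
        using B_props(2)[OF n(1)] spanning_full(2)[OF B_props(1)[OF n(1)] u0] k dim unfolding rich_def by auto
      finally show ?thesis by simp
    qed
    moreover have "real (f_num k (?G m)) > C * real (f_num k (?B n))"
    proof -
      have "f_num k (?B n) \<le> 16 * n * 4 ^ (?d - 3)"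
        using f_num_le_card_faces[OF polyB, of k] B_props(3)[OF n(1)] by simp
      also have "\<dots> \<le> 16 * (2 * (A * M)) * 4 ^ (?d - 3)" using n(2) by (intro mult_right_mono mult_left_mono) auto
      also have "\<dots> = D * M" by (simp add: D_def)
      finally have "C * real (f_num k (?B n)) \<le> C * (real D * real M)"
        using C by (intro mult_left_mono) (auto simp flip: of_nat_mult)
      moreover have "2 * C * real D * real M < real m * real M" using m(1) M by (intro mult_strict_right_mono) auto
      moreover have "m * M \<le> 2 * f_num k (?G m)"
        using polygon.f_num_iter_globe_ge[OF polygon[OF m(2)], of "?d - 2" k] k d dim by (simp add: G_def M_def)
      then have "real m * real M \<le> 2 * real (f_num k (?G m))"
        by (metis of_nat_le_iff of_nat_mult of_nat_numeral)
      ultimately show ?thesis by (simp add: algebra_simps)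
    qed
    ultimately show ?thesis using n(1) m(2) by blast
  qed
  have full: "full_polytope (?G m)" "full_polytope (?B n)" if "m \<ge> 3" "n \<ge> 3" for m n
    using spanning_full(1) G_span B_props(1) that by blast+
  \<comment> \<open>Both general statements are refuted at \<open>k = 1\<close>, with the constant 1
    in the first case.\<close>
  have k1: "1 \<in> {1..?d - 1}" using dim by auto
  have "\<not> comb_busemann_petty TYPE('a)"
  proof
    assume "comb_busemann_petty TYPE('a)"
    moreover obtain n m where nm: "n \<ge> 3" "m \<ge> 3"
      "\<forall>u\<in>sphere 0 1. f_num (1 - 1) (central_section (?G m) u) \<le> f_num (1 - 1) (central_section (?B n) u)"
      "real (f_num 1 (?G m)) > 1 * real (f_num 1 (?B n))"
      using main[OF k1, of 1] by auto
    ultimately have "f_num 1 (?G m) \<le> f_num 1 (?B n)"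
      using k1 full[OF nm(2,1)] unfolding comb_busemann_petty_def by blast
    then show False using nm(4) by simp
  qed
  moreover have "\<not> comb_slicing TYPE('a) C" if C: "C > 0" for C
  proof
    assume "comb_slicing TYPE('a) C"
    moreover obtain n m where nm: "n \<ge> 3" "m \<ge> 3"
      "\<forall>u\<in>sphere 0 1. f_num (1 - 1) (central_section (?G m) u) \<le> f_num (1 - 1) (central_section (?B n) u)"
      "real (f_num 1 (?G m)) > C * real (f_num 1 (?B n))"
      using main[OF k1 C] by auto
    ultimately have "real (f_num 1 (?G m)) \<le> C * real (f_num 1 (?B n))"
      using k1 full[OF nm(2,1)] unfolding comb_slicing_def by blast
    then show False using nm(4) by simp
  qed
  ultimately show ?thesis using main by blast
qed

end
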